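(* Let $(D_A\subseteq A)$ be a nondegenerate $C^*$-subalgebra and let $B$ be a $C^*$-algebra with finite nuclear dimension. If $\dim_{\mathrm{diag}}(D_A\subseteq A;\,B)<\infty$, then $A$ is a nuclear $C^*$-algebra with finite nuclear dimension, satisfying $$\dim_{\mathrm{nuc}}(A)+1\le\big(\dim_{\mathrm{nuc}}(B)+1\big)\big(\dim_{\mathrm{diag}}(D_A\subseteq A;\,B)+1\big).$$
   Context: Order zero maps. All $C^*$-algebras are concrete, i.e. faithfully represented on some Hilbert space. A completely positive map $\phi:A\to B$ between $C^*$-algebras has order zero if $\phi(a)\phi(a')=0$ for all positive $a,a'\in A$ with $aa'=0$. By the Winter–Zacharias theorem, with $C=C^*(\phi(A))$, there are a positive $h\in\mathcal{M}(C)\cap C'$ with $\|h\|=\|\phi\|$ and a $*$-homomorphism $\pi:A\to\mathcal{M}(C)\cap\{h\}'$ with $\phi(a)=h\pi(a)$ for all $a\in A$ ($h=\phi(1_A)$ if $A$ is unital); such a $\pi$ is called a supporting $*$-homomorphism of $\phi$. Nuclear dimension (Winter–Zacharias). $\dim_{\mathrm{nuc}}(A)\le d$ if for any finite $\mathcal{F}\subseteq A$ and $\varepsilon>0$ there exist a finite-dimensional $C^*$-algebra $F=F^{(0)}\oplus\dots\oplus F^{(d)}$ and completely positive maps $A\xrightarrow{\psi}F\xrightarrow{\phi}A$ with $\psi$ contractive, $\|\phi\circ\psi(a)-a\|<\varepsilon$ for all $a\in\mathcal{F}$, and each $\phi|_{F^{(i)}}$ a contractive order zero map; $\dim_{\mathrm{nuc}}(A)$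 is the least such $d$. Normalisers. For a $C^*$-subalgebra $D\subseteq A$, $\mathcal{N}_A(D)=\{a\in A: aDa^*\subseteq D,\ a^*Da\subseteq D\}$. The inclusion is nondegenerate if $D$ contains an approximate unit for $A$. Generalised diagonal dimension. Fix a $C^*$-algebra $B$ and a nondegenerate $C^*$-subalgebra $D_A\subseteq A$. Write $\dim_{\mathrm{diag}}(D_A\subseteq A;\,B)\le d$ if for any finite $\mathcal{F}\subseteq A$ and $\varepsilon>0$ there exist a finite-dimensional $C^*$-algebra $F=F^{(0)}\oplus\dots\oplus F^{(d)}$ with canonical diagonal (the diagonal matrices) $D_F=D^{(0)}\oplus\dots\oplus D^{(d)}$ and completely positive maps $A\xrightarrow{\psi}F\otimes B\xrightarrow{\phi}A$ such that: (1) $\psi$ is contractive; (2) $\|\phi\circ\psi(a)-a\|<\varepsilon$ for every $a\in\mathcal{F}$; (3) $\phi^{(i)}:=\phi|_{F^{(i)}\otimes B}$ is a contractive order zero map for each $i\in\{0,\dots,d\}$; (4) $\psi(D_A)\subseteq D_F\otimes B$; (5) $\phi^{(i)}(D^{(i)}\otimes B)\subseteq\mathcal{N}_A(D_A)$, and $\phi^{(i)}(v\otimes B)\subseteq\mathcal{N}_A(D_A)$ for each matrix unit $v\in F^{(i)}$ with respect to $D^{(i)}$ (i.e. $vv^*$ and $v^*v$ are minimal projections of $D^{(i)}$); (6) for each $i$, if $\pi^{(i)}$ is a supporting $*$-homomorphism of $\phi^{(i)}$ and $\{u_\lambda\}_\lambda$ is an approximate unit of $B$, then the strong operator limit of $\pi^{(i)}(v\otimes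 u_\lambda)$ over $\lambda$ lies in the commutant $(D_A)'$, for each minimal projection $v\in D^{(i)}$. $\dim_{\mathrm{diag}}(D_A\subseteq A;\,B)$ is the least such $d$ ($\infty$ if none exists). *)

theory Defs
  imports
    "HOL-Analysis.Analysis"
    "HOL-Library.Extended_Nat"
    "HOL-Library.Nonpos_Ints"
begin

section \<open>Complex Hilbert spaces\<close>

text \<open>The inner product \<open>cinner\<close> is conjugate-linear in its first argument.\<close>

class complex_hilbert_space = real_inner + banach +
  fixes scaleC :: "complex \<Rightarrow> 'a \<Rightarrow> 'a"  (infixr "*\<^sub>C" 75)
    and cinner :: "'a \<Rightarrow> 'a \<Rightarrow> complex"
  assumes scaleC_add_right: "c *\<^sub>C (x + y) = c *\<^sub>C x + c *\<^sub>C y"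
    and scaleC_add_left: "(c + d) *\<^sub>C x = c *\<^sub>C x + d *\<^sub>C x"
    and scaleC_scaleC: "c *\<^sub>C d *\<^sub>C x = (c * d) *\<^sub>C x"
    and scaleR_eq_scaleC: "r *\<^sub>R x = complex_of_real r *\<^sub>C x"
    and cinner_commute: "cinner x y = cnj (cinner y x)"
    and cinner_add_right: "cinner x (y + z) = cinner x y + cinner x z"
    and cinner_scaleC_right: "cinner x (c *\<^sub>C y) = c * cinner x y"
    and inner_eq_Re_cinner: "inner x y = Re (cinner x y)"

lemma cinner_same: "cinner x x = complex_of_real ((norm x)\<^sup>2)"
  for x :: "'a::complex_hilbert_space"
proof (rule complex_eqI)
  show "Re (cinner x x) = Re (complex_of_real ((norm x)\<^sup>2))"
    by (simp add: inner_eq_Re_cinner [symmetric] power2_norm_eq_inner)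
  show "Im (cinner x x) = Im (complex_of_real ((norm x)\<^sup>2))"
    using arg_cong [OF cinner_commute [of x x], of Im] by simp
qed

lemma norm_scaleC: "norm (c *\<^sub>C x) = cmod c * norm x"
  for x :: "'a::complex_hilbert_space"
proof -
  have "cinner (c *\<^sub>C x) (c *\<^sub>C x) = c * cnj (c * cinner x x)"
    by (subst cinner_scaleC_right, subst cinner_commute, simp add: cinner_scaleC_right)
  also have "\<dots> = complex_of_real ((cmod c * norm x)\<^sup>2)"
    by (simp add: cinner_same power_mult_distrib flip: complex_norm_square)
  finally have "(norm (c *\<^sub>C x))\<^sup>2 = (cmod c * norm x)\<^sup>2"
    by (simp add: cinner_same flip: of_real_power of_real_mult)
  then show ?thesis
    by (simp add: power2_eq_iff_nonneg)
qed

lemma bounded_linear_scaleC: "bounded_linear (\<lambda>x::'a::complex_hilbert_space. c *\<^sub>C x)"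
proof (rule bounded_linear_intro)
  show "c *\<^sub>C (x + y) = c *\<^sub>C x + c *\<^sub>C y" for x y :: 'a
    by (rule scaleC_add_right)
  show "c *\<^sub>C (r *\<^sub>R x) = r *\<^sub>R (c *\<^sub>C x)" for r and x :: 'a
    by (simp add: scaleR_eq_scaleC scaleC_scaleC mult.commute)
  show "norm (c *\<^sub>C x) \<le> norm x * cmod c" for x :: 'a
    by (simp add: norm_scaleC mult.commute)
qed

instantiation complex :: complex_hilbert_space
begin

definition scaleC_complex :: "complex \<Rightarrow> complex \<Rightarrow> complex" where
  "scaleC_complex c x = c * x"

definition cinner_complex :: "complex \<Rightarrow> complex \<Rightarrow> complex" where
  "cinner_complex x y = cnj x * y"

instance
  by standard
     (auto simp: scaleC_complex_def cinner_complex_def inner_complex_def algebra_simps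
        scaleR_conv_of_real)

end


subsection \<open>Square-summable families\<close>

text \<open>
  The Hilbert space \<open>('i, 'k) ell2\<close> of square-summable families indexed by \<open>'i\<close> with values in
  the Hilbert space \<open>'k\<close>, that is, \<open>\<ell>\<^sup>2('i) \<otimes> 'k\<close>.  It provides one type on which
  direct sums of matrix algebras of arbitrary size over operators on \<open>'k\<close> act.
\<close>

typedef (overloaded) ('i, 'k) ell2 =
  "{f :: 'i \<Rightarrow> 'k::complex_hilbert_space. (\<lambda>i. (norm (f i))\<^sup>2) summable_on UNIV}"
  morphisms ell2_nth Abs_ell2
  by (rule exI [of _ "\<lambda>_. 0"]) simp

setup_lifting type_definition_ell2

lemma ell2_eqI: "(\<And>i. ell2_nth x i = ell2_nth y i) \<Longrightarrow> x = y"
  by (metis ell2_nth_inject ext)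

lemma ell2_summable: "(\<lambda>i. (norm (ell2_nth x i))\<^sup>2) summable_on UNIV"
  using ell2_nth [of x] by simp

lemma ell2_add_summable:
  fixes f g :: "'i \<Rightarrow> 'k::real_normed_vector"
  assumes "(\<lambda>i. (norm (f i))\<^sup>2) summable_on UNIV" "(\<lambda>i. (norm (g i))\<^sup>2) summable_on UNIV"
  shows "(\<lambda>i. (norm (f i + g i))\<^sup>2) summable_on UNIV"
proof (rule summable_on_comparison_test)
  show "(\<lambda>i. 2 * ((norm (f i))\<^sup>2 + (norm (g i))\<^sup>2)) summable_on UNIV"
    by (intro summable_on_cmult_right summable_on_add assms)
  show "(norm (f i + g i))\<^sup>2 \<le> 2 * ((norm (f i))\<^sup>2 + (norm (g i))\<^sup>2)" for i
  proof -
    have "(norm (f i + g i))\<^sup>2 \<le> (norm (f i) + norm (g i))\<^sup>2"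
      by (intro power_mono norm_triangle_ineq) simp
    moreover have "0 \<le> (norm (f i) - norm (g i))\<^sup>2"
      by simp
    ultimately show ?thesis
      by (simp add: power2_sum power2_diff)
  qed
qed auto

lemma ell2_scale_summable:
  fixes f :: "'i \<Rightarrow> 'k::complex_hilbert_space"
  assumes "(\<lambda>i. (norm (f i))\<^sup>2) summable_on UNIV"
  shows "(\<lambda>i. (norm (c *\<^sub>C f i))\<^sup>2) summable_on UNIV"
  using summable_on_cmult_right [OF assms, of "(cmod c)\<^sup>2"]
  by (simp add: norm_scaleC power_mult_distrib)

instantiation ell2 :: (type, complex_hilbert_space) real_vector
begin

lift_definition zero_ell2 :: "('a, 'b) ell2" is "\<lambda>_. 0"
  by simp

lift_definition plus_ell2 :: "('a, 'b) ell2 \<Rightarrow> ('a, 'b) ell2 \<Rightarrow> ('a, 'b) ell2"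
  is "\<lambda>f g i. f i + g i"
  by (rule ell2_add_summable)

lift_definition uminus_ell2 :: "('a, 'b) ell2 \<Rightarrow> ('a, 'b) ell2" is "\<lambda>f i. - f i"
  by simp

lift_definition minus_ell2 :: "('a, 'b) ell2 \<Rightarrow> ('a, 'b) ell2 \<Rightarrow> ('a, 'b) ell2"
  is "\<lambda>f g i. f i - g i"
  subgoal for f g using ell2_add_summable [of f "\<lambda>i. - g i"] by simp
  done

lift_definition scaleR_ell2 :: "real \<Rightarrow> ('a, 'b) ell2 \<Rightarrow> ('a, 'b) ell2"
  is "\<lambda>r f i. r *\<^sub>R f i"
  unfolding scaleR_eq_scaleC by (rule ell2_scale_summable)

instance
  by standard (transfer, simp add: algebra_simps)+

end

lemma cmod_cinner_le: "cmod (cinner x y) \<le> (norm x)\<^sup>2 + (norm y)\<^sup>2"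
  for x y :: "'a::complex_hilbert_space"
proof -
  obtain u where u: "cmod u = 1" "u * cinner x y = complex_of_real (cmod (cinner x y))"
  proof (cases "cinner x y = 0")
    case True
    then show ?thesis
      by (intro that [of 1]) auto
  next
    case False
    then show ?thesis
      by (intro that [of "cnj (cinner x y) / cmod (cinner x y)"])
         (auto simp: norm_divide power2_eq_square mult.commute [of "cnj _"]
            complex_norm_square [symmetric])
  qed
  have "cmod (cinner x y) = inner x (u *\<^sub>C y)"
    by (simp add: inner_eq_Re_cinner cinner_scaleC_right u)
  also have "\<dots> \<le> norm x * norm (u *\<^sub>C y)"
    by (rule norm_cauchy_schwarz)
  also have "\<dots> = norm x * norm y"
    by (simp add: norm_scaleC u)
  also have "\<dots> \<le> (norm x)\<^sup>2 + (norm y)\<^sup>2"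
  proof -
    have "0 \<le> norm x * norm y"
      by simp
    then show ?thesis
      using sum_squares_bound [of "norm x" "norm y"] by linarith
  qed
  finally show ?thesis .
qed

lemma ell2_cinner_summable: "(\<lambda>i. cinner (ell2_nth x i) (ell2_nth y i)) summable_on UNIV"
proof (rule abs_summable_summable, rule summable_on_comparison_test)
  show "(\<lambda>i. (norm (ell2_nth x i))\<^sup>2 + (norm (ell2_nth y i))\<^sup>2) summable_on UNIV"
    by (intro summable_on_add ell2_summable)
qed (auto simp: cmod_cinner_le)

lemma ell2_inner_summable: "(\<lambda>i. inner (ell2_nth x i) (ell2_nth y i)) summable_on UNIV"
  using summable_on_Re [OF ell2_cinner_summable [of x y]] by (simp add: inner_eq_Re_cinner)

instantiation ell2 :: (type, complex_hilbert_space) real_inner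
begin

definition inner_ell2 :: "('a, 'b) ell2 \<Rightarrow> ('a, 'b) ell2 \<Rightarrow> real" where
  "inner_ell2 x y = (\<Sum>\<^sub>\<infinity>i. inner (ell2_nth x i) (ell2_nth y i))"

definition norm_ell2 :: "('a, 'b) ell2 \<Rightarrow> real" where
  "norm_ell2 x = sqrt (inner x x)"

definition dist_ell2 :: "('a, 'b) ell2 \<Rightarrow> ('a, 'b) ell2 \<Rightarrow> real" where
  "dist_ell2 x y = norm (x - y)"

definition sgn_ell2 :: "('a, 'b) ell2 \<Rightarrow> ('a, 'b) ell2" where
  "sgn_ell2 x = x /\<^sub>R norm x"

definition uniformity_ell2 :: "(('a, 'b) ell2 \<times> ('a, 'b) ell2) filter" where
  "uniformity_ell2 = (INF e\<in>{0 <..}. principal {(x, y). dist x y < e})"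

definition open_ell2 :: "('a, 'b) ell2 set \<Rightarrow> bool" where
  "open_ell2 U \<longleftrightarrow> (\<forall>x\<in>U. \<forall>\<^sub>F (x', y) in uniformity. x' = x \<longrightarrow> y \<in> U)"

instance
proof
  fix x y z :: "('a, 'b) ell2" and r :: real
  show "inner x y = inner y x"
    by (simp add: inner_ell2_def inner_commute)
  show "inner (x + y) z = inner x z + inner y z"
    unfolding inner_ell2_def
    by (simp add: plus_ell2.rep_eq inner_add_left infsum_add ell2_inner_summable)
  show "inner (r *\<^sub>R x) y = r * inner x y"
    unfolding inner_ell2_def
    by (simp add: scaleR_ell2.rep_eq infsum_cmult_right ell2_inner_summable)
  show "0 \<le> inner x x"
    unfolding inner_ell2_def by (rule infsum_nonneg) simp
  show "inner x x = 0 \<longleftrightarrow> x = 0"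
  proof
    assume "inner x x = 0"
    then have "inner (ell2_nth x i) (ell2_nth x i) = 0" for i
      by (intro nonneg_infsum_le_0D [of "\<lambda>i. inner (ell2_nth x i) (ell2_nth x i)" UNIV])
         (auto simp: inner_ell2_def ell2_inner_summable)
    then show "x = 0"
      by (intro ell2_eqI) (simp add: zero_ell2.rep_eq)
  qed (simp add: inner_ell2_def zero_ell2.rep_eq)
qed (simp_all add: norm_ell2_def dist_ell2_def sgn_ell2_def uniformity_ell2_def open_ell2_def)

end

lemma ell2_norm_square: "(norm x)\<^sup>2 = (\<Sum>\<^sub>\<infinity>i. (norm (ell2_nth x i))\<^sup>2)"
  unfolding power2_norm_eq_inner inner_ell2_def ..

lemma ell2_sum_le_norm: "finite I \<Longrightarrow> (\<Sum>i\<in>I. (norm (ell2_nth x i))\<^sup>2) \<le> (norm x)\<^sup>2"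
  unfolding ell2_norm_square
  by (rule finite_sum_le_infsum [OF ell2_summable]) auto

lemma ell2_norm_nth_le: "norm (ell2_nth x i) \<le> norm x"
  using ell2_sum_le_norm [of "{i}" x] by (auto intro: power2_le_imp_le)

lemma ell2_norm_leI:
  assumes "\<And>I. finite I \<Longrightarrow> (\<Sum>i\<in>I. (norm (ell2_nth x i))\<^sup>2) \<le> b\<^sup>2" "0 \<le> b"
  shows "norm x \<le> b"
proof (rule power2_le_imp_le [OF _ assms(2)])
  show "(norm x)\<^sup>2 \<le> b\<^sup>2"
    unfolding ell2_norm_square by (rule infsum_le_finite_sums [OF ell2_summable assms(1)])
qed

instance ell2 :: (type, complex_hilbert_space) banach
proof
  fix X :: "nat \<Rightarrow> ('a, 'b) ell2"
  assume X: "Cauchy X"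
  have "Cauchy (\<lambda>n. ell2_nth (X n) i)" for i
  proof (rule metric_CauchyI)
    fix e :: real assume "0 < e"
    then obtain M where "\<forall>m\<ge>M. \<forall>n\<ge>M. dist (X m) (X n) < e"
      using metric_CauchyD [OF X] by blast
    then show "\<exists>M. \<forall>m\<ge>M. \<forall>n\<ge>M. dist (ell2_nth (X m) i) (ell2_nth (X n) i) < e"
      using ell2_norm_nth_le [of "X _ - X _" i]
      by (metis dist_norm le_less_trans minus_ell2.rep_eq)
  qed
  then have "\<exists>l. (\<lambda>n. ell2_nth (X n) i) \<longlonglongrightarrow> l" for i
    by (simp add: Cauchy_convergent convergent_def [symmetric])
  then obtain L where L: "\<And>i. (\<lambda>n. ell2_nth (X n) i) \<longlonglongrightarrow> L i"
    by metis
  have bound: "(\<Sum>i\<in>I. (norm (ell2_nth (X m) i - L i))\<^sup>2) \<le> e\<^sup>2"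
    if M: "\<forall>n\<ge>M. dist (X m) (X n) < e" and "finite I" for I M m e
  proof (rule LIMSEQ_le_const2)
    show "(\<lambda>n. \<Sum>i\<in>I. (norm (ell2_nth (X m) i - ell2_nth (X n) i))\<^sup>2)
        \<longlonglongrightarrow> (\<Sum>i\<in>I. (norm (ell2_nth (X m) i - L i))\<^sup>2)"
      by (intro tendsto_intros L)
    have "(\<Sum>i\<in>I. (norm (ell2_nth (X m) i - ell2_nth (X n) i))\<^sup>2) \<le> e\<^sup>2" if "n \<ge> M" for n
    proof -
      have "(\<Sum>i\<in>I. (norm (ell2_nth (X m) i - ell2_nth (X n) i))\<^sup>2) \<le> (norm (X m - X n))\<^sup>2"
        using ell2_sum_le_norm [OF \<open>finite I\<close>, of "X m - X n"] by (simp add: minus_ell2.rep_eq)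
      also have "\<dots> \<le> e\<^sup>2"
        using M that by (intro power_mono) (auto simp: dist_norm intro: less_imp_le)
      finally show ?thesis .
    qed
    then show "\<exists>N. \<forall>n\<ge>N. (\<Sum>i\<in>I. (norm (ell2_nth (X m) i - ell2_nth (X n) i))\<^sup>2) \<le> e\<^sup>2"
      by blast
  qed
  have summable_diff: "(\<lambda>i. (norm (ell2_nth (X m) i - L i))\<^sup>2) summable_on UNIV"
    if "\<forall>n\<ge>M. dist (X m) (X n) < e" for M m e
    by (rule nonneg_bdd_above_summable_on)
       (auto intro!: bdd_aboveI2 [of _ _ "e\<^sup>2"] bound [OF that])
  obtain M1 where M1: "\<forall>n\<ge>M1. dist (X M1) (X n) < 1"
    using metric_CauchyD [OF X, of 1] by force
  have "(\<lambda>i. (norm (- (ell2_nth (X M1) i - L i)))\<^sup>2) summable_on UNIV"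
    using summable_diff [OF M1] by (simp only: norm_minus_cancel)
  from ell2_add_summable [OF ell2_summable [of "X M1"] this]
  have "(\<lambda>i. (norm (L i))\<^sup>2) summable_on UNIV"
    by simp
  then have nth: "ell2_nth (Abs_ell2 L) i = L i" for i
    by (simp add: Abs_ell2_inverse)
  have "X \<longlonglongrightarrow> Abs_ell2 L"
  proof (rule metric_LIMSEQ_I)
    fix e :: real assume "0 < e"
    then obtain M where M: "\<forall>m\<ge>M. \<forall>n\<ge>M. dist (X m) (X n) < e / 2"
      using metric_CauchyD [OF X, of "e / 2"] by auto
    have "dist (X m) (Abs_ell2 L) \<le> e / 2" if "m \<ge> M" for m
      unfolding dist_norm
    proof (rule ell2_norm_leI)
      show "(\<Sum>i\<in>I. (norm (ell2_nth (X m - Abs_ell2 L) i))\<^sup>2) \<le> (e / 2)\<^sup>2" if "finite I" for I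
        using bound [of M m "e / 2" I] M \<open>m \<ge> M\<close> that by (simp add: minus_ell2.rep_eq nth)
    qed (use \<open>0 < e\<close> in simp)
    then show "\<exists>M. \<forall>m\<ge>M. dist (X m) (Abs_ell2 L) < e"
      using \<open>0 < e\<close> by (intro exI [of _ M]) force
  qed
  then show "convergent X"
    by (rule convergentI)
qed

instantiation ell2 :: (type, complex_hilbert_space) complex_hilbert_space
begin

lift_definition scaleC_ell2 :: "complex \<Rightarrow> ('a, 'b) ell2 \<Rightarrow> ('a, 'b) ell2"
  is "\<lambda>c f i. c *\<^sub>C f i"
  by (rule ell2_scale_summable)

definition cinner_ell2 :: "('a, 'b) ell2 \<Rightarrow> ('a, 'b) ell2 \<Rightarrow> complex" where
  "cinner_ell2 x y = (\<Sum>\<^sub>\<infinity>i. cinner (ell2_nth x i) (ell2_nth y i))"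

instance
proof
  fix x y z :: "('a, 'b) ell2" and r :: real and c d :: complex
  show "c *\<^sub>C (x + y) = c *\<^sub>C x + c *\<^sub>C y"
    by transfer (simp add: scaleC_add_right)
  show "(c + d) *\<^sub>C x = c *\<^sub>C x + d *\<^sub>C x"
    by transfer (simp add: scaleC_add_left)
  show "c *\<^sub>C d *\<^sub>C x = (c * d) *\<^sub>C x"
    by transfer (simp add: scaleC_scaleC)
  show "r *\<^sub>R x = complex_of_real r *\<^sub>C x"
    by transfer (simp add: scaleR_eq_scaleC)
  show "cinner x y = cnj (cinner y x)"
    unfolding cinner_ell2_def infsum_cnj [symmetric]
    by (rule infsum_cong) (rule cinner_commute)
  show "cinner x (y + z) = cinner x y + cinner x z"
    unfolding cinner_ell2_def
    by (simp add: plus_ell2.rep_eq cinner_add_right infsum_add ell2_cinner_summable)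
  show "cinner x (c *\<^sub>C y) = c * cinner x y"
    unfolding cinner_ell2_def
    by (simp add: scaleC_ell2.rep_eq cinner_scaleC_right infsum_cmult_right ell2_cinner_summable)
  show "inner x y = Re (cinner x y)"
    unfolding cinner_ell2_def inner_ell2_def
    by (simp add: inner_eq_Re_cinner infsum_Re ell2_cinner_summable)
qed

end

lift_definition ell2_coord :: "'i \<Rightarrow> ('i, 'k::complex_hilbert_space) ell2 \<Rightarrow>\<^sub>L 'k"
  is "\<lambda>i x. ell2_nth x i"
  by (rule bounded_linear_intro [of _ 1])
     (auto simp: plus_ell2.rep_eq scaleR_ell2.rep_eq ell2_norm_nth_le)

lift_definition ell2_vec :: "'i \<Rightarrow> 'k::complex_hilbert_space \<Rightarrow> ('i, 'k) ell2"
  is "\<lambda>i v j. if j = i then v else 0"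
  by (rule finite_nonzero_values_imp_summable_on) (rule finite_subset [of _ "{i}" for i], auto)

lemma norm_ell2_vec: "norm (ell2_vec i v) = norm v"
proof -
  have "(norm (ell2_vec i v))\<^sup>2 = (\<Sum>\<^sub>\<infinity>j\<in>{i}. (norm (ell2_nth (ell2_vec i v) j))\<^sup>2)"
    unfolding ell2_norm_square
    by (rule infsum_cong_neutral) (auto simp: ell2_vec.rep_eq)
  then have "(norm (ell2_vec i v))\<^sup>2 = (norm v)\<^sup>2"
    by (simp add: ell2_vec.rep_eq)
  then show ?thesis
    by (simp add: power2_eq_iff_nonneg)
qed

lift_definition ell2_single :: "'i \<Rightarrow> 'k::complex_hilbert_space \<Rightarrow>\<^sub>L ('i, 'k) ell2"
  is ell2_vec
proof (rule bounded_linear_intro [of _ 1])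
  show "ell2_vec i (x + y) = ell2_vec i x + ell2_vec i y" for i :: 'i and x y :: 'k
    by transfer auto
  show "ell2_vec i (r *\<^sub>R x) = r *\<^sub>R ell2_vec i x" for i :: 'i and r and x :: 'k
    by transfer auto
qed (simp add: norm_ell2_vec)


section \<open>Operators and concrete C*-algebras\<close>

text \<open>
  The library type \<open>'h \<Rightarrow>\<^sub>L 'h\<close> consists of the bounded real-linear maps, with the
  operator norm; the bounded operators on the complex Hilbert space \<open>'h\<close> are the
  complex-linear ones among them.
\<close>

type_synonym 'h op = "'h \<Rightarrow>\<^sub>L 'h"

definition bounded_ops :: "'h::complex_hilbert_space op set" where
  "bounded_ops = {T :: 'h op. \<forall>c x. T (c *\<^sub>C x) = c *\<^sub>C T x}"

lift_definition op_scaleC :: "complex \<Rightarrow> 'h::complex_hilbert_space op \<Rightarrow> 'h op"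
  is "\<lambda>c T x. c *\<^sub>C T x"
  by (rule bounded_linear_compose [OF bounded_linear_scaleC])

definition adj :: "'h::complex_hilbert_space op \<Rightarrow> 'h op" where
  "adj T = (THE S :: 'h op. \<forall>x y. cinner (S x) y = cinner x (T y))"

definition op_pos :: "'h::complex_hilbert_space op \<Rightarrow> bool" where
  "op_pos T \<longleftrightarrow> T \<in> bounded_ops \<and> (\<forall>x. cinner x (T x) \<in> \<real>\<^sub>\<ge>\<^sub>0)"

definition cstar_algebra :: "'h::complex_hilbert_space op set \<Rightarrow> bool" where
  "cstar_algebra A \<longleftrightarrow>
     A \<subseteq> bounded_ops \<and> 0 \<in> A \<and> closed A \<and>
     (\<forall>a\<in>A. \<forall>b\<in>A. a + b \<in> A \<and> a o\<^sub>L b \<in> A) \<and>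
     (\<forall>a\<in>A. adj a \<in> A \<and> (\<forall>c. op_scaleC c a \<in> A))"

definition generated_cstar :: "'h::complex_hilbert_space op set \<Rightarrow> 'h op set" where
  "generated_cstar S = \<Inter> {C. cstar_algebra C \<and> S \<subseteq> C}"

definition commutant :: "'h::complex_hilbert_space op set \<Rightarrow> 'h op set" where
  "commutant S = {T \<in> bounded_ops. \<forall>s\<in>S. T o\<^sub>L s = s o\<^sub>L T}"

text \<open>
  The multiplier algebra of \<open>C\<close>, realised on the essential subspace \<open>[C H]\<close>: the last
  condition says that \<open>T\<close> and its adjoint vanish on the orthogonal complement of \<open>[C H]\<close>,
  so that the unit of the multiplier algebra is the projection onto \<open>[C H]\<close>
  even if \<open>C\<close> acts degenerately.
\<close>

definition multipliers :: "'h::complex_hilbert_space op set \<Rightarrow> 'h op set" where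
  "multipliers C = {T \<in> bounded_ops.
     (\<forall>c\<in>C. T o\<^sub>L c \<in> C \<and> c o\<^sub>L T \<in> C) \<and>
     (\<forall>x. (\<forall>c\<in>C. c x = 0) \<longrightarrow> T x = 0 \<and> adj T x = 0)}"

text \<open>
  Nets are represented by filters on the algebra: a net gives the filter of its
  eventual sets, and every proper filter arises from a net.
\<close>

definition approximate_unit :: "'h::complex_hilbert_space op set \<Rightarrow> 'h op filter \<Rightarrow> bool" where
  "approximate_unit A U \<longleftrightarrow>
     U \<noteq> bot \<and> (\<forall>\<^sub>F u in U. u \<in> A \<and> op_pos u \<and> norm u \<le> 1) \<and>
     (\<forall>a\<in>A. ((\<lambda>u. u o\<^sub>L a) \<longlongrightarrow> a) U \<and> ((\<lambda>u. a o\<^sub>L u) \<longlongrightarrow> a) U)"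

definition nondegenerate_subalgebra ::
    "'h::complex_hilbert_space op set \<Rightarrow> 'h op set \<Rightarrow> bool" where
  "nondegenerate_subalgebra D A \<longleftrightarrow>
     cstar_algebra D \<and> D \<subseteq> A \<and> (\<exists>U. approximate_unit A U \<and> (\<forall>\<^sub>F u in U. u \<in> D))"

definition normalisers :: "'h::complex_hilbert_space op set \<Rightarrow> 'h op set \<Rightarrow> 'h op set" where
  "normalisers A D = {a \<in> A. \<forall>d\<in>D. a o\<^sub>L d o\<^sub>L adj a \<in> D \<and> adj a o\<^sub>L d o\<^sub>L a \<in> D}"

definition minimal_projection :: "'h::complex_hilbert_space op set \<Rightarrow> 'h op \<Rightarrow> bool" where
  "minimal_projection D p \<longleftrightarrow>
     p \<in> D \<and> p o\<^sub>L p = p \<and> adj p = p \<and> p \<noteq> 0 \<and>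
     (\<forall>q\<in>D. q o\<^sub>L q = q \<and> adj q = q \<and> p o\<^sub>L q = q \<longrightarrow> q = 0 \<or> q = p)"


section \<open>Completely positive and order zero maps\<close>

text \<open>Maps are functions on all operators of which only the values on the domain algebra matter.\<close>

definition linear_on_alg ::
    "'h::complex_hilbert_space op set \<Rightarrow> ('h op \<Rightarrow> 'k::complex_hilbert_space op) \<Rightarrow> bool" where
  "linear_on_alg A \<phi> \<longleftrightarrow>
     (\<forall>a\<in>A. \<forall>b\<in>A. \<phi> (a + b) = \<phi> a + \<phi> b) \<and>
     (\<forall>a\<in>A. \<forall>c. \<phi> (op_scaleC c a) = op_scaleC c (\<phi> a))"

text \<open>Positivity of an \<open>n \<times> n\<close> matrix of operators as an operator on the \<open>n\<close>-fold sum \<open>'h\<^sup>n\<close>.\<close>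

definition matrix_pos :: "nat \<Rightarrow> (nat \<Rightarrow> nat \<Rightarrow> 'h::complex_hilbert_space op) \<Rightarrow> bool" where
  "matrix_pos n a \<longleftrightarrow> (\<forall>x. (\<Sum>i<n. \<Sum>j<n. cinner (x i) (a i j (x j))) \<in> \<real>\<^sub>\<ge>\<^sub>0)"

definition completely_positive ::
    "'h::complex_hilbert_space op set \<Rightarrow> 'k::complex_hilbert_space op set \<Rightarrow>
     ('h op \<Rightarrow> 'k op) \<Rightarrow> bool" where
  "completely_positive A B \<phi> \<longleftrightarrow>
     linear_on_alg A \<phi> \<and> \<phi> ` A \<subseteq> B \<and>
     (\<forall>n a. (\<forall>i<n. \<forall>j<n. a i j \<in> A) \<and> matrix_pos n a \<longrightarrow> matrix_pos n (\<lambda>i j. \<phi> (a i j)))"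

definition contractive_on ::
    "'h::complex_hilbert_space op set \<Rightarrow> ('h op \<Rightarrow> 'k::complex_hilbert_space op) \<Rightarrow> bool" where
  "contractive_on A \<phi> \<longleftrightarrow> (\<forall>a\<in>A. norm (\<phi> a) \<le> norm a)"

definition order_zero ::
    "'h::complex_hilbert_space op set \<Rightarrow> 'k::complex_hilbert_space op set \<Rightarrow>
     ('h op \<Rightarrow> 'k op) \<Rightarrow> bool" where
  "order_zero A B \<phi> \<longleftrightarrow>
     completely_positive A B \<phi> \<and>
     (\<forall>a\<in>A. \<forall>a'\<in>A. op_pos a \<and> op_pos a' \<and> a o\<^sub>L a' = 0 \<longrightarrow> \<phi> a o\<^sub>L \<phi> a' = 0)"

definition map_norm ::
    "'h::complex_hilbert_space op set \<Rightarrow> ('h op \<Rightarrow> 'k::complex_hilbert_space op) \<Rightarrow> real" where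
  "map_norm A \<phi> = (SUP a\<in>{a\<in>A. norm a \<le> 1}. norm (\<phi> a))"

definition star_hom ::
    "'h::complex_hilbert_space op set \<Rightarrow> 'k::complex_hilbert_space op set \<Rightarrow>
     ('h op \<Rightarrow> 'k op) \<Rightarrow> bool" where
  "star_hom A B \<pi> \<longleftrightarrow>
     linear_on_alg A \<pi> \<and> \<pi> ` A \<subseteq> B \<and>
     (\<forall>a\<in>A. \<forall>b\<in>A. \<pi> (a o\<^sub>L b) = \<pi> a o\<^sub>L \<pi> b) \<and> (\<forall>a\<in>A. \<pi> (adj a) = adj (\<pi> a))"

definition supporting_hom ::
    "'h::complex_hilbert_space op set \<Rightarrow> ('h op \<Rightarrow> 'k::complex_hilbert_space op) \<Rightarrow>
     ('h op \<Rightarrow> 'k op) \<Rightarrow> bool" where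
  "supporting_hom A \<phi> \<pi> \<longleftrightarrow>
     (let C = generated_cstar (\<phi> ` A) in
      \<exists>h. h \<in> multipliers C \<inter> commutant C \<and> op_pos h \<and> norm h = map_norm A \<phi> \<and>
          star_hom A (multipliers C \<inter> commutant {h}) \<pi> \<and>
          (\<forall>a\<in>A. \<phi> a = h o\<^sub>L \<pi> a) \<and>
          (\<forall>e\<in>A. (\<forall>a\<in>A. e o\<^sub>L a = a \<and> a o\<^sub>L e = a) \<longrightarrow> h = \<phi> e))"


section \<open>Finite-dimensional algebras and their tensor products\<close>

text \<open>
  A finite-dimensional C*-algebra \<open>F = F\<^sup>(\<^sup>0\<^sup>) \<oplus> \<dots> \<oplus> F\<^sup>(\<^sup>d\<^sup>)\<close> is described by the list
  \<open>s\<close> of length \<open>d + 1\<close> whose entry \<open>s ! i\<close> lists the sizes of the full matrix algebras of which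
  \<open>F\<^sup>(\<^sup>i\<^sup>)\<close> is the direct sum.  The index \<open>(i, k, r)\<close> stands for row \<open>r\<close> of the \<open>k\<close>-th matrix
  summand of \<open>F\<^sup>(\<^sup>i\<^sup>)\<close>.
\<close>

type_synonym shape = "nat list list"

type_synonym index = "nat \<times> nat \<times> nat"

definition indices :: "shape \<Rightarrow> index set" where
  "indices s = {(i, k, r). i < length s \<and> k < length (s ! i) \<and> r < s ! i ! k}"

definition same_block :: "shape \<Rightarrow> index \<Rightarrow> index \<Rightarrow> bool" where
  "same_block s p q \<longleftrightarrow>
     p \<in> indices s \<and> q \<in> indices s \<and> fst p = fst q \<and> fst (snd p) = fst (snd q)"

definition entry ::
    "('i, 'k::complex_hilbert_space) ell2 op \<Rightarrow> 'i \<Rightarrow> 'i \<Rightarrow> 'k op" where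
  "entry T p q = ell2_coord p o\<^sub>L T o\<^sub>L ell2_single q"

text \<open>\<open>F \<otimes> B\<close>: block diagonal matrices with entries in \<open>B\<close>.\<close>

definition fd_tensor ::
    "shape \<Rightarrow> 'k::complex_hilbert_space op set \<Rightarrow> (index, 'k) ell2 op set" where
  "fd_tensor s B = {T \<in> bounded_ops. \<forall>p q.
     entry T p q \<in> B \<and> (\<not> same_block s p q \<longrightarrow> entry T p q = 0)}"

text \<open>\<open>F\<^sup>(\<^sup>i\<^sup>) \<otimes> B\<close>\<close>

definition fd_tensor_summand ::
    "shape \<Rightarrow> nat \<Rightarrow> 'k::complex_hilbert_space op set \<Rightarrow> (index, 'k) ell2 op set" where
  "fd_tensor_summand s i B = {T \<in> fd_tensor s B. \<forall>p q. entry T p q \<noteq> 0 \<longrightarrow> fst p = i}"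

text \<open>The part of a set of matrices that lies in \<open>D\<^sub>F \<otimes> B\<close>, respectively in \<open>D\<^sub>F\<close>.\<close>

definition diagonal_part ::
    "('i, 'k::complex_hilbert_space) ell2 op set \<Rightarrow> ('i, 'k) ell2 op set" where
  "diagonal_part M = {T \<in> M. \<forall>p q. p \<noteq> q \<longrightarrow> entry T p q = 0}"

text \<open>\<open>F\<close> and \<open>F\<^sup>(\<^sup>i\<^sup>)\<close> themselves are obtained for \<open>B = \<complex>\<close>, acting on the Hilbert space \<open>\<complex>\<close>.\<close>

abbreviation fd_algebra :: "shape \<Rightarrow> (index, complex) ell2 op set" where
  "fd_algebra s \<equiv> fd_tensor s bounded_ops"

abbreviation fd_summand :: "shape \<Rightarrow> nat \<Rightarrow> (index, complex) ell2 op set" where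
  "fd_summand s i \<equiv> fd_tensor_summand s i bounded_ops"

text \<open>The elementary tensor \<open>v \<otimes> b\<close> of \<open>v \<in> F\<close> and \<open>b \<in> B\<close>, with entries \<open>v\<^sub>p\<^sub>q b\<close>.\<close>

definition elem_tensor ::
    "shape \<Rightarrow> (index, complex) ell2 op \<Rightarrow> 'k::complex_hilbert_space op \<Rightarrow>
     (index, 'k) ell2 op" where
  "elem_tensor s v b = (\<Sum>p\<in>indices s. \<Sum>q\<in>indices s.
     ell2_single p o\<^sub>L op_scaleC (entry v p q 1) b o\<^sub>L ell2_coord q)"

definition matrix_unit :: "shape \<Rightarrow> nat \<Rightarrow> (index, complex) ell2 op \<Rightarrow> bool" where
  "matrix_unit s i v \<longleftrightarrow>
     v \<in> fd_summand s i \<and>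
     minimal_projection (diagonal_part (fd_summand s i)) (v o\<^sub>L adj v) \<and>
     minimal_projection (diagonal_part (fd_summand s i)) (adj v o\<^sub>L v)"


section \<open>Nuclearity, nuclear dimension and diagonal dimension\<close>

text \<open>
  Nuclearity is taken in the sense of the completely positive approximation property:
  the identity of \<open>A\<close> is a point-norm limit of completely positive contractions that
  factor through finite-dimensional C*-algebras.
\<close>

definition nuclear :: "'h::complex_hilbert_space op set \<Rightarrow> bool" where
  "nuclear A \<longleftrightarrow>
     (\<forall>X \<epsilon>. finite X \<and> X \<subseteq> A \<and> \<epsilon> > 0 \<longrightarrow>
       (\<exists>s \<psi> \<phi>.
          completely_positive A (fd_algebra s) \<psi> \<and> contractive_on A \<psi> \<and>
          completely_positive (fd_algebra s) A \<phi> \<and> contractive_on (fd_algebra s) \<phi> \<and>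
          (\<forall>a\<in>X. norm (\<phi> (\<psi> a) - a) < \<epsilon>)))"

definition dim_nuc_le :: "'h::complex_hilbert_space op set \<Rightarrow> nat \<Rightarrow> bool" where
  "dim_nuc_le A d \<longleftrightarrow>
     (\<forall>X \<epsilon>. finite X \<and> X \<subseteq> A \<and> \<epsilon> > 0 \<longrightarrow>
       (\<exists>s \<psi> \<phi>. length s = Suc d \<and>
          completely_positive A (fd_algebra s) \<psi> \<and>
          completely_positive (fd_algebra s) A \<phi> \<and>
          contractive_on A \<psi> \<and>
          (\<forall>a\<in>X. norm (\<phi> (\<psi> a) - a) < \<epsilon>) \<and>
          (\<forall>i\<le>d. contractive_on (fd_summand s i) \<phi> \<and> order_zero (fd_summand s i) A \<phi>)))"

definition dim_nuc :: "'h::complex_hilbert_space op set \<Rightarrow> enat" where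
  "dim_nuc A = Inf {enat d | d. dim_nuc_le A d}"

text \<open>
  In the last condition the strong operator limit exists for every approximate unit;
  the condition places it in the commutant of \<open>D\<close>.
\<close>

definition dim_diag_le ::
    "'h::complex_hilbert_space op set \<Rightarrow> 'h op set \<Rightarrow> 'k::complex_hilbert_space op set \<Rightarrow>
     nat \<Rightarrow> bool" where
  "dim_diag_le D A B d \<longleftrightarrow>
     (\<forall>X \<epsilon>. finite X \<and> X \<subseteq> A \<and> \<epsilon> > 0 \<longrightarrow>
       (\<exists>s \<psi> \<phi>. length s = Suc d \<and>
          completely_positive A (fd_tensor s B) \<psi> \<and>
          completely_positive (fd_tensor s B) A \<phi> \<and>
          contractive_on A \<psi> \<and>
          (\<forall>a\<in>X. norm (\<phi> (\<psi> a) - a) < \<epsilon>) \<and>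
          (\<forall>i\<le>d. contractive_on (fd_tensor_summand s i B) \<phi> \<and>
                  order_zero (fd_tensor_summand s i B) A \<phi>) \<and>
          \<psi> ` D \<subseteq> diagonal_part (fd_tensor s B) \<and>
          (\<forall>i\<le>d. \<phi> ` diagonal_part (fd_tensor_summand s i B) \<subseteq> normalisers A D \<and>
                  (\<forall>v. matrix_unit s i v \<longrightarrow>
                     (\<forall>b\<in>B. \<phi> (elem_tensor s v b) \<in> normalisers A D))) \<and>
          (\<forall>i\<le>d. \<forall>\<pi> U v.
             supporting_hom (fd_tensor_summand s i B) \<phi> \<pi> \<and> approximate_unit B U \<and>
             minimal_projection (diagonal_part (fd_summand s i)) v \<longrightarrow>
             (\<exists>T\<in>commutant D. \<forall>x. ((\<lambda>u. \<pi> (elem_tensor s v u) x) \<longlongrightarrow> T x) U))))"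

definition dim_diag ::
    "'h::complex_hilbert_space op set \<Rightarrow> 'h op set \<Rightarrow> 'k::complex_hilbert_space op set \<Rightarrow>
     enat" where
  "dim_diag D A B = Inf {enat d | d. dim_diag_le D A B d}"

end

theory Submission
  imports Defs
begin

text \<open>
  Let \<open>n\<close> and \<open>d\<close> be the dimensions of \<open>B\<close> and of the inclusion \<open>D \<subseteq> A\<close>.  Approximate the identity of
\<open>A\<close> through \<open>F \<otimes> B\<close> by \<open>\<psi>\<close> and \<open>\<phi>\<close>.  Only finitely many elements of \<open>B\<close> occur as entries of the
matrices \<open>\<psi> a\<close> that matter, so the identity of \<open>B\<close> may be replaced on them by \<open>\<phi>' \<circ> \<psi>'\<close>, which factors
through a finite-dimensional \<open>F'\<close>.  Then \<open>A \<rightarrow> F \<otimes> B \<rightarrow> F \<otimes> F' \<rightarrow> F \<otimes> B \<rightarrow> A\<close> approximates the identity of \<open>A\<close>, and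
\<open>F \<otimes> F'\<close> is the sum of the \<open>(n + 1) (d + 1)\<close> algebras \<open>F\<^sup>(\<^sup>i\<^sup>) \<otimes> F'\<^sup>(\<^sup>j\<^sup>)\<close>.  What has to be seen is that the
amplifications of \<open>\<psi>'\<close> and \<open>\<phi>'\<close> to matrices are still contractive and order zero.

Contractivity: for a positive contraction \<open>e\<close> the matrix with diagonal \<open>c e\<^sup>2\<close> and off-diagonal corner
\<open>e a e\<close> is positive whenever \<open>\<parallel>a\<parallel> \<le> c\<close>, for operator matrices \<open>a\<close> as well.  Complete positivity and
Cauchy-Schwarz bound the image of \<open>e a e\<close> (\<open>cp_compress_mbound\<close>), and approximate units
(\<open>cstar_approx_unit\<close>) remove \<open>e\<close> (\<open>cp_contractive_mbound\<close>).

Order zero: on a finite-dimensional algebra with unit \<open>1\<close>, the two Schwarz inequalities upgrade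
orthogonality on positive elements to \<open>\<phi> a \<phi> b = 0\<close> for all \<open>a b = 0\<close> (\<open>order_zero_disjoint\<close>).  Matrix algebras are
spanned by idempotents, and for an idempotent \<open>e\<close> the products \<open>(a e) ((1 - e) b)\<close> and \<open>(a (1 - e)) (e b)\<close>
vanish; this forces \<open>\<phi> a \<phi> b = \<phi> 1 \<phi> (a b)\<close> (\<open>order_zero_mult\<close>), the consequence of the structure theorem of
Winter and Zacharias that is used.  The identity passes to amplifications by multiplying matrices
(\<open>collapse_disjoint\<close>), and a composition of order zero maps has order zero.

Nuclearity asks for a contraction \<open>F \<rightarrow> A\<close>, while a map that is a sum of contractive order zero
maps is merely bounded.  With \<open>e\<close> an approximate unit of \<open>A\<close> and \<open>r\<^sup>2 = \<psi> (e\<^sup>2) + \<delta>\<close>, the maps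
\<open>a \<mapsto> r\<^sup>-\<^sup>1 \<psi> (e a e) r\<^sup>-\<^sup>1\<close> and \<open>x \<mapsto> \<phi> (r x r)\<close> compose to \<open>a \<mapsto> \<phi> (\<psi> (e a e))\<close>; the first is contractive and
the second has norm close to \<open>\<parallel>\<phi> (\<psi> (e\<^sup>2))\<parallel> \<le> 1\<close>, so that a scalar makes it contractive
(\<open>nuclear_if_dim_nuc_le\<close>).
\<close>

section \<open>Inner products and bounded operators\<close>

lemma cinner_add_left: "cinner (x + y) z = cinner x z + cinner y z"
  by (metis cinner_add_right cinner_commute complex_cnj_add)

lemma cinner_scaleC_left: "cinner (c *\<^sub>C x) y = cnj c * cinner x y"
  by (metis cinner_commute cinner_scaleC_right complex_cnj_mult)

lemma cinner_zero_right [simp]: "cinner x 0 = 0"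
  by (metis add_cancel_left_left cinner_add_right)

lemma cinner_zero_left [simp]: "cinner 0 x = 0"
  by (metis cinner_commute cinner_zero_right complex_cnj_zero)

lemma cinner_minus_right: "cinner x (- y) = - cinner x y"
  by (metis add.right_inverse add_eq_0_iff cinner_add_right cinner_zero_right)

lemma cinner_minus_left: "cinner (- x) y = - cinner x y"
  by (metis add.right_inverse add_eq_0_iff cinner_add_left cinner_zero_left)

lemma cinner_diff_right: "cinner x (y - z) = cinner x y - cinner x z"
  by (metis add_uminus_conv_diff cinner_add_right cinner_minus_right)

lemma cinner_diff_left: "cinner (x - y) z = cinner x z - cinner y z"
  by (metis add_uminus_conv_diff cinner_add_left cinner_minus_left)

lemma cinner_sum_right: "cinner x (sum f I) = (\<Sum>i\<in>I. cinner x (f i))"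
  by (induction I rule: infinite_finite_induct) (auto simp: cinner_add_right)

lemma scaleC_zero_left [simp]: "0 *\<^sub>C x = 0"
  by (metis of_real_0 scaleR_eq_scaleC scaleR_zero_left)

lemma scaleC_zero_right [simp]: "c *\<^sub>C (0::'a::complex_hilbert_space) = 0"
  by (metis add_cancel_left_left scaleC_add_right)

lemma Im_cinner: "Im (cinner x y) = inner x ((- \<i>) *\<^sub>C y)"
  by (simp add: inner_eq_Re_cinner cinner_scaleC_right)

lemma cmod_cinner_le_norm: "cmod (cinner x y) \<le> norm x * norm y"
proof (cases "cinner x y = 0")
  case False
  define u where "u = cnj (cinner x y) / cmod (cinner x y)"
  have u: "cmod u = 1" "u * cinner x y = complex_of_real (cmod (cinner x y))"
    using False by (auto simp: u_def norm_divide power2_eq_square mult.commute [of "cnj _"]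
            complex_norm_square [symmetric])
  have "cmod (cinner x y) = inner x (u *\<^sub>C y)"
    by (simp add: inner_eq_Re_cinner cinner_scaleC_right u)
  also have "\<dots> \<le> norm x * norm (u *\<^sub>C y)"
    by (rule norm_cauchy_schwarz)
  finally show ?thesis
    by (simp add: norm_scaleC u)
qed simp

lemma cinner_eqI: "(\<And>y. cinner x y = cinner x' y) \<Longrightarrow> x = x'"
proof -
  assume "\<And>y. cinner x y = cinner x' y"
  then have "cinner (x - x') (x - x') = 0" by (simp add: cinner_diff_left)
  then show ?thesis by (simp add: cinner_same)
qed

lemma norm_le_cinnerI:
  assumes "\<And>y. cmod (cinner y x) \<le> c * norm y" "0 \<le> c"
  shows "norm x \<le> c"
proof (cases "x = 0")
  case False
  have "norm x * norm x \<le> c * norm x"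
    using assms(1) [of x] by (simp add: cinner_same power2_eq_square flip: of_real_mult)
  then show ?thesis using False by simp
qed (use assms in simp)

lemma op_scaleC_apply [simp]: "blinfun_apply (op_scaleC c T) x = c *\<^sub>C T x"
  by (simp add: op_scaleC.rep_eq)

lemma op_scaleR: "r *\<^sub>R T = op_scaleC (complex_of_real r) T"
  by (rule blinfun_eqI) (simp add: scaleR_blinfun.rep_eq scaleR_eq_scaleC)

lemma bounded_opsD: "T \<in> bounded_ops \<Longrightarrow> T (c *\<^sub>C x) = c *\<^sub>C T x"
  by (simp add: bounded_ops_def)

lemma bounded_ops_zero [simp]: "0 \<in> bounded_ops"
  by (simp add: bounded_ops_def)
lemma bounded_ops_id [simp]: "id_blinfun \<in> bounded_ops"
  by (simp add: bounded_ops_def)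
lemma bounded_ops_add: "S \<in> bounded_ops \<Longrightarrow> T \<in> bounded_ops \<Longrightarrow> S + T \<in> bounded_ops"
  by (simp add: bounded_ops_def blinfun.add_left scaleC_add_right)
lemma bounded_ops_scaleC: "T \<in> bounded_ops \<Longrightarrow> op_scaleC c T \<in> bounded_ops"
  by (simp add: bounded_ops_def scaleC_scaleC mult.commute)
lemma bounded_ops_scaleR: "T \<in> bounded_ops \<Longrightarrow> r *\<^sub>R T \<in> bounded_ops"
  by (simp add: op_scaleR bounded_ops_scaleC)
lemma bounded_ops_minus: "T \<in> bounded_ops \<Longrightarrow> - T \<in> bounded_ops"
  using bounded_ops_scaleR[of T "-1"] by simp
lemma bounded_ops_diff: "S \<in> bounded_ops \<Longrightarrow> T \<in> bounded_ops \<Longrightarrow> S - T \<in> bounded_ops"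
  using bounded_ops_add bounded_ops_minus by fastforce
lemma bounded_ops_compose: "S \<in> bounded_ops \<Longrightarrow> T \<in> bounded_ops \<Longrightarrow> S o\<^sub>L T \<in> bounded_ops"
  by (simp add: bounded_ops_def)
lemma bounded_ops_sum: "(\<And>i. i \<in> I \<Longrightarrow> f i \<in> bounded_ops) \<Longrightarrow> sum f I \<in> bounded_ops"
  by (induction I rule: infinite_finite_induct) (auto simp: bounded_ops_add)

lemmas bounded_ops_intros = bounded_ops_zero bounded_ops_id bounded_ops_add bounded_ops_scaleC
  bounded_ops_scaleR bounded_ops_minus bounded_ops_diff bounded_ops_compose bounded_ops_sum

lemmas blinfun_lin = blinfun.add_left blinfun.add_right blinfun.diff_left blinfun.diff_right
  blinfun.minus_left blinfun.minus_right blinfun.scaleR_left blinfun.scaleR_right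
  blinfun.sum_left blinfun.sum_right blinfun.zero_left blinfun.zero_right

section \<open>Riesz representation and adjoints\<close>

text \<open>
  A functional \<open>f\<close> is represented by the minimiser of \<open>J x = \<langle>x, x\<rangle> - 2 f x\<close>: the parallelogram law makes
minimising sequences Cauchy, and the first variation of \<open>J\<close> vanishes at the limit.
\<close>

lemma riesz_real:
  fixes f :: "'a::{real_inner, banach} \<Rightarrow> real"
  assumes "bounded_linear f"
  shows "\<exists>z. \<forall>y. f y = inner z y"
proof -
  interpret f: bounded_linear f by fact
  obtain K where K: "\<And>x. norm (f x) \<le> norm x * K" "K > 0" using f.pos_bounded by auto
  define J where "J x = inner x x - 2 * f x" for x
  have J_lower: "- K\<^sup>2 \<le> J x" for x
  proof -
    have "f x \<le> norm x * K" using K(1) [of x] by simp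
    moreover have "0 \<le> (norm x - K)\<^sup>2" by simp
    ultimately show ?thesis
      by (simp add: J_def power2_norm_eq_inner [symmetric] power2_diff)
  qed
  define m where "m = Inf (range J)"
  have bdd: "bdd_below (range J)" using J_lower by (intro bdd_belowI2)
  have m_le: "m \<le> J x" for x unfolding m_def using bdd by (auto intro: cInf_lower)
  have "\<exists>x. J x < m + 1 / real (Suc n)" for n
  proof -
    have "Inf (range J) < m + 1 / real (Suc n)" by (simp add: m_def)
    then show ?thesis using cInf_lessD [of "range J"] by blast
  qed
  then obtain X where X: "\<And>n. J (X n) < m + 1 / real (Suc n)" by metis
  have par: "(norm (x - y))\<^sup>2 = 2 * J x + 2 * J y - 4 * J ((1/2) *\<^sub>R (x + y))" for x y
    by (simp add: J_def power2_norm_eq_inner f.add f.scaleR inner_add inner_diff inner_commute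
        add_divide_distrib)
  have "Cauchy X"
  proof (rule metric_CauchyI)
    fix e :: real assume "e > 0"
    then obtain N where N: "4 / e\<^sup>2 < real N" using reals_Archimedean2 by blast
    have N0: "0 < real N" using N \<open>e > 0\<close> by (smt (verit) divide_nonneg_pos zero_less_power)
    have "dist (X k) (X l) < e" if "k \<ge> N" "l \<ge> N" for k l
    proof -
      have "1 / real (Suc k) < 1 / real N" "1 / real (Suc l) < 1 / real N"
        using that N0 by (auto simp: field_simps)
      then have "(norm (X k - X l))\<^sup>2 < 4 / real N"
        unfolding par using X [of k] X [of l] m_le [of "(1/2) *\<^sub>R (X k + X l)"] by linarith
      also have "4 / real N < e\<^sup>2" using N N0 \<open>e > 0\<close> by (simp add: field_simps)
      finally show ?thesis using \<open>e > 0\<close> by (simp add: dist_norm power2_less_imp_less)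
    qed
    then show "\<exists>M. \<forall>m\<ge>M. \<forall>n\<ge>M. dist (X m) (X n) < e" by blast
  qed
  then obtain z where z: "X \<longlonglongrightarrow> z" using Cauchy_convergent convergent_def by blast
  have "(\<lambda>n. J (X n)) \<longlonglongrightarrow> J z" unfolding J_def
    by (intro tendsto_intros z f.tendsto)
  moreover have "(\<lambda>n. m + 1 / real (Suc n)) \<longlonglongrightarrow> m + 0"
    by (intro tendsto_intros LIMSEQ_Suc lim_1_over_n)
  ultimately have Jz: "J z \<le> m"
    using X by (intro LIMSEQ_le [of "\<lambda>n. J (X n)" "J z" "\<lambda>n. m + 1 / real (Suc n)" m]) (auto intro!: exI[of _ 0] less_imp_le)
  have "f y = inner z y" for y
  proof (rule ccontr)
    assume ne: "f y \<noteq> inner z y"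
    define g where "g = inner z y - f y"
    have gr: "0 \<le> t * (2 * g) + t\<^sup>2 * inner y y" for t
      using Jz m_le [of "z + t *\<^sub>R y"]
      by (simp add: J_def g_def f.add f.scaleR inner_add inner_commute algebra_simps power2_eq_square)
    have "y \<noteq> 0" using ne by (auto simp: f.zero)
    then have yy: "inner y y > 0" by simp
    \<comment> \<open>The quadratic polynomial in \<open>t\<close> is minimal at \<open>t = - g / \<langle>y, y\<rangle>\<close>.\<close>
    from gr [of "- g / inner y y"] have "0 \<le> - (g\<^sup>2 / inner y y)"
      using yy by (simp add: power2_eq_square field_simps)
    moreover have "g\<^sup>2 / inner y y > 0" using yy ne by (intro divide_pos_pos) (auto simp: g_def)
    ultimately show False by linarith
  qed
  then show ?thesis by blast
qed

text \<open>
  Riesz representation for the real inner product suffices: complex linearity of \<open>T\<close> recovers the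
imaginary part of \<open>cinner\<close>.  Hence the description by \<open>THE\<close> in the definition of the adjoint is met.
\<close>

lemma adj_exists:
  assumes T: "T \<in> bounded_ops"
  shows "\<exists>S :: 'a::complex_hilbert_space op. \<forall>x y. cinner (S x) y = cinner x (T y)"
proof -
  have "\<exists>z. \<forall>y. inner x (T y) = inner z y" for x
    by (rule riesz_real) (intro bounded_linear_intros)
  then obtain S where S: "\<And>x y. inner x (T y) = inner (S x) y" by metis
  have c: "cinner (S x) y = cinner x (T y)" for x y
    by (rule complex_eqI)
      (simp_all add: Im_cinner inner_eq_Re_cinner [symmetric] S [symmetric] bounded_opsD [OF T])
  have "bounded_linear S"
  proof (rule bounded_linear_intro)
    show "S (x + y) = S x + S y" for x y by (rule cinner_eqI) (simp add: c cinner_add_left)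
    show "S (r *\<^sub>R x) = r *\<^sub>R S x" for r x
      by (rule cinner_eqI) (simp add: c scaleR_eq_scaleC cinner_scaleC_left)
    show "norm (S x) \<le> norm x * norm T" for x
    proof (rule norm_le_cinnerI)
      fix y
      have "cmod (cinner y (S x)) = cmod (cinner x (T y))"
        by (metis c cinner_commute complex_mod_cnj)
      also have "\<dots> \<le> norm x * (norm T * norm y)"
        by (meson cmod_cinner_le_norm norm_blinfun mult_left_mono norm_ge_zero order_trans)
      finally show "cmod (cinner y (S x)) \<le> norm x * norm T * norm y" by (simp add: mult.assoc)
    qed simp
  qed
  then show ?thesis
    by (intro exI [of _ "Blinfun S"]) (simp add: bounded_linear_Blinfun_apply c)
qed

lemma adj_eqI:
  fixes S T :: "'a::complex_hilbert_space op"
  assumes "\<And>x y. cinner (S x) y = cinner x (T y)"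
  shows "adj T = S"
  unfolding adj_def
proof (rule the_equality)
  show "S' = S" if "\<forall>x y. cinner (S' x) y = cinner x (T y)" for S' :: "'a op"
    by (rule blinfun_eqI, rule cinner_eqI) (simp add: that assms)
qed (use assms in simp)

lemma cinner_adj_left: "T \<in> bounded_ops \<Longrightarrow> cinner (adj T x) y = cinner x (T y)"
  using adj_exists [of T] adj_eqI by metis

lemma cinner_adj_right: "T \<in> bounded_ops \<Longrightarrow> cinner x (adj T y) = cinner (T x) y"
  by (metis cinner_adj_left cinner_commute)

lemma adj_bounded_ops: assumes T: "T \<in> bounded_ops" shows "adj T \<in> bounded_ops"
proof -
  have "adj T (c *\<^sub>C x) = c *\<^sub>C adj T x" for c x
    by (rule cinner_eqI) (simp add: cinner_adj_left [OF T] cinner_scaleC_left)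
  then show ?thesis by (simp add: bounded_ops_def)
qed

lemma adj_adj: "T \<in> bounded_ops \<Longrightarrow> adj (adj T) = T"
  by (rule adj_eqI) (simp add: cinner_adj_right)

lemma adj_compose: "S \<in> bounded_ops \<Longrightarrow> T \<in> bounded_ops \<Longrightarrow> adj (S o\<^sub>L T) = adj T o\<^sub>L adj S"
  by (rule adj_eqI) (simp add: cinner_adj_left)

lemma adj_diff: "S \<in> bounded_ops \<Longrightarrow> T \<in> bounded_ops \<Longrightarrow> adj (S - T) = adj S - adj T"
  by (rule adj_eqI) (simp add: cinner_adj_left blinfun_lin cinner_diff_left cinner_diff_right)

lemma norm_adj_le: assumes T: "T \<in> bounded_ops" shows "norm (adj T) \<le> norm T"
proof (rule norm_blinfun_bound)
  fix x
  show "norm (adj T x) \<le> norm T * norm x"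
  proof (rule norm_le_cinnerI)
    fix y
    have "cmod (cinner y (adj T x)) \<le> norm (T y) * norm x"
      by (simp add: cinner_adj_right T cmod_cinner_le_norm)
    also have "\<dots> \<le> norm T * norm y * norm x"
      by (intro mult_right_mono norm_blinfun) simp
    finally show "cmod (cinner y (adj T x)) \<le> norm T * norm x * norm y" by (simp add: mult_ac)
  qed simp
qed simp

section \<open>Sesquilinear forms of operator matrices\<close>

text \<open>
  All statements about \<open>n \<times> n\<close> matrices over an algebra are phrased through the sesquilinear form
of a family of operators indexed by an arbitrary set.  Vectors are functions on that set, so that
passing to another index set, or regarding matrices of matrices as matrices, is a rearrangement of
finite sums.  \<open>mpos\<close> and \<open>mbound\<close> express positivity and a norm bound of the matrix.
\<close>

definition sform :: "'i set \<Rightarrow> 'j set \<Rightarrow> ('i \<Rightarrow> 'j \<Rightarrow> 'h::complex_hilbert_space op) \<Rightarrow>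
    ('i \<Rightarrow> 'h) \<Rightarrow> ('j \<Rightarrow> 'h) \<Rightarrow> complex" where
  "sform I J a x y = (\<Sum>i\<in>I. \<Sum>j\<in>J. cinner (x i) (a i j (y j)))"

definition mpos :: "'i set \<Rightarrow> ('i \<Rightarrow> 'i \<Rightarrow> 'h::complex_hilbert_space op) \<Rightarrow> bool" where
  "mpos I a \<longleftrightarrow> (\<forall>x. sform I I a x x \<in> \<real>\<^sub>\<ge>\<^sub>0)"

definition sqn :: "'i set \<Rightarrow> ('i \<Rightarrow> 'h::complex_hilbert_space) \<Rightarrow> real" where
  "sqn I x = (\<Sum>i\<in>I. (norm (x i))\<^sup>2)"

definition mbound :: "'i set \<Rightarrow> ('i \<Rightarrow> 'i \<Rightarrow> 'h::complex_hilbert_space op) \<Rightarrow> real \<Rightarrow> bool" where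
  "mbound I a c \<longleftrightarrow> (\<forall>x y. cmod (sform I I a x y) \<le> c * sqrt (sqn I x) * sqrt (sqn I y))"

text \<open>
  A complex \<open>2 \<times> 2\<close> matrix with nonnegative quadratic form is Hermitian with nonnegative determinant.
All Cauchy-Schwarz inequalities below are instances.
\<close>

lemma psd_2x2:
  fixes \<alpha> \<beta> \<gamma> \<delta> :: complex
  assumes "\<And>z w. cnj z * z * \<alpha> + cnj z * w * \<beta> + cnj w * z * \<gamma> + cnj w * w * \<delta> \<in> \<real>\<^sub>\<ge>\<^sub>0"
  shows "(cmod \<beta>)\<^sup>2 \<le> Re \<alpha> * Re \<delta>" and "\<gamma> = cnj \<beta>"
proof -
  have a: "Im \<alpha> = 0" "Re \<alpha> \<ge> 0" using assms [of 1 0] by (auto simp: complex_nonneg_Reals_iff)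
  have d: "Im \<delta> = 0" "Re \<delta> \<ge> 0" using assms [of 0 1] by (auto simp: complex_nonneg_Reals_iff)
  have "Im \<beta> + Im \<gamma> = 0" "Re \<beta> - Re \<gamma> = 0"
    using assms [of 1 1] assms [of 1 \<i>] a d by (auto simp: complex_nonneg_Reals_iff)
  then show g: "\<gamma> = cnj \<beta>" by (auto intro!: complex_eqI)
  \<comment> \<open>Test vectors \<open>(- t \<beta>, 1)\<close> with real \<open>t\<close> turn the claim into a discriminant condition.\<close>
  have key: "0 \<le> t\<^sup>2 * Re \<alpha> * (cmod \<beta>)\<^sup>2 - 2 * t * (cmod \<beta>)\<^sup>2 + Re \<delta>" for t :: real
  proof -
    have "Re (cnj (- t * \<beta>) * (- t * \<beta>) * \<alpha> + cnj (- t * \<beta>) * 1 * \<beta> + cnj 1 * (- t * \<beta>) * \<gamma> + cnj 1 * 1 * \<delta>) \<ge> 0"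
      using assms [of "- t * \<beta>" 1] by (simp only: complex_nonneg_Reals_iff)
    then show ?thesis unfolding g cmod_power2 using a d
      by (simp add: power2_eq_square algebra_simps)
  qed
  show "(cmod \<beta>)\<^sup>2 \<le> Re \<alpha> * Re \<delta>"
  proof (cases "Re \<alpha> = 0")
    case True
    have "cmod \<beta> = 0"
    proof (rule ccontr)
      assume "cmod \<beta> \<noteq> 0"
      then have "(Re \<delta> + 1) / (cmod \<beta>)\<^sup>2 * (cmod \<beta>)\<^sup>2 = Re \<delta> + 1" by simp
      then have "0 \<le> - 2 * (Re \<delta> + 1) + Re \<delta>"
        using key [of "(Re \<delta> + 1) / (cmod \<beta>)\<^sup>2"] True by (simp only: mult.assoc mult_zero_left mult_zero_right)
      then show False using d(2) by simp
    qed
    then show ?thesis using True by simp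
  next
    case False
    then have "Re \<alpha> > 0" using a by simp
    then show ?thesis using key [of "1 / Re \<alpha>"] by (simp add: field_simps power2_eq_square)
  qed
qed

section \<open>Cauchy-Schwarz and positive operators\<close>

lemma bounded_op_comb: "T \<in> bounded_ops \<Longrightarrow>
  cinner (z *\<^sub>C x + w *\<^sub>C y) (T (z *\<^sub>C x' + w *\<^sub>C y')) =
   cnj z * z * cinner x (T x') + cnj z * w * cinner x (T y') + cnj w * z * cinner y (T x')
   + cnj w * w * cinner y (T y')"
  by (simp add: blinfun_lin bounded_opsD cinner_add_left cinner_add_right cinner_scaleC_left
      cinner_scaleC_right algebra_simps)

lemma sform_comb:
  assumes "\<And>i j. i \<in> I \<Longrightarrow> j \<in> I \<Longrightarrow> a i j \<in> bounded_ops"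
  shows "sform I I a (\<lambda>i. z *\<^sub>C x i + w *\<^sub>C y i) (\<lambda>i. z *\<^sub>C x i + w *\<^sub>C y i) =
    cnj z * z * sform I I a x x + cnj z * w * sform I I a x y + cnj w * z * sform I I a y x
    + cnj w * w * sform I I a y y"
  unfolding sform_def sum_distrib_left sum.distrib [symmetric]
  by (intro sum.cong refl bounded_op_comb assms)

lemma mpos_cauchy_schwarz:
  assumes "mpos I a" "\<And>i j. i \<in> I \<Longrightarrow> j \<in> I \<Longrightarrow> a i j \<in> bounded_ops"
  shows "(cmod (sform I I a x y))\<^sup>2 \<le> Re (sform I I a x x) * Re (sform I I a y y)"
proof (rule psd_2x2(1) [where \<gamma> = "sform I I a y x"])
  fix z w
  show "cnj z * z * sform I I a x x + cnj z * w * sform I I a x y + cnj w * z * sform I I a y x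
    + cnj w * w * sform I I a y y \<in> \<real>\<^sub>\<ge>\<^sub>0"
    using assms(1) unfolding mpos_def by (subst sform_comb [symmetric]) (auto intro: assms(2))
qed

lemma op_pos_bounded: "op_pos T \<Longrightarrow> T \<in> bounded_ops"
  by (simp add: op_pos_def)

lemma op_pos_iff: "op_pos T \<longleftrightarrow> T \<in> bounded_ops \<and> (\<forall>x. Im (cinner x (T x)) = 0 \<and> 0 \<le> Re (cinner x (T x)))"
  by (auto simp: op_pos_def complex_nonneg_Reals_iff)

lemma op_pos_cauchy_schwarz:
  assumes "op_pos T"
  shows "(cmod (cinner x (T y)))\<^sup>2 \<le> Re (cinner x (T x)) * Re (cinner y (T y))"
  using mpos_cauchy_schwarz [of "{()}" "\<lambda>_ _. T" "\<lambda>_. x" "\<lambda>_. y"] assms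
  by (auto simp: mpos_def sform_def op_pos_def)

lemma op_pos_cinner_commute: assumes "op_pos T" shows "cinner x (T y) = cinner (T x) y"
proof -
  have "cinner y (T x) = cnj (cinner x (T y))"
  proof (rule psd_2x2(2) [where \<alpha> = "cinner x (T x)" and \<delta> = "cinner y (T y)"])
    show "cnj z * z * cinner x (T x) + cnj z * w * cinner x (T y) + cnj w * z * cinner y (T x)
    + cnj w * w * cinner y (T y) \<in> \<real>\<^sub>\<ge>\<^sub>0" for z w
      using assms unfolding op_pos_def by (subst bounded_op_comb [symmetric]) auto
  qed
  then show ?thesis by (metis cinner_commute complex_cnj_cnj)
qed

lemma op_pos_adj: "op_pos T \<Longrightarrow> adj T = T"
  by (rule adj_eqI) (simp add: op_pos_cinner_commute)

lemma op_pos_adj_compose: "T \<in> bounded_ops \<Longrightarrow> op_pos (adj T o\<^sub>L T)"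
  by (auto simp: op_pos_iff cinner_adj_right cinner_same bounded_ops_compose adj_bounded_ops)

lemma op_pos_compose_adj: "T \<in> bounded_ops \<Longrightarrow> op_pos (T o\<^sub>L adj T)"
  using op_pos_adj_compose [of "adj T"] by (simp add: adj_adj adj_bounded_ops)

lemma op_pos_norm_le:
  assumes "op_pos T" "\<And>x. Re (cinner x (T x)) \<le> c * (norm x)\<^sup>2" "0 \<le> c"
  shows "norm T \<le> c"
proof (rule norm_blinfun_bound)
  fix x
  show "norm (T x) \<le> c * norm x"
  proof (rule norm_le_cinnerI)
    fix y
    have "(cmod (cinner y (T x)))\<^sup>2 \<le> (c * (norm y)\<^sup>2) * (c * (norm x)\<^sup>2)"
      by (rule order_trans [OF op_pos_cauchy_schwarz [OF assms(1)]], rule mult_mono)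
        (use assms in \<open>auto simp: op_pos_iff\<close>)
    also have "\<dots> = (c * norm x * norm y)\<^sup>2" by (simp add: power2_eq_square)
    finally show "cmod (cinner y (T x)) \<le> c * norm x * norm y"
      by (rule power2_le_imp_le) (simp add: assms)
  qed (simp add: assms)
qed (rule assms)

lemma Re_cinner_le_norm: "Re (cinner x (T x)) \<le> norm T * (norm x)\<^sup>2"
  for T :: "'a::complex_hilbert_space op"
proof -
  have "Re (cinner x (T x)) \<le> norm x * norm (T x)"
    by (metis cmod_cinner_le_norm complex_Re_le_cmod order_trans)
  also have "\<dots> \<le> norm x * (norm T * norm x)"
    by (intro mult_left_mono norm_blinfun) simp
  finally show ?thesis by (simp add: power2_eq_square mult_ac)
qed

lemma cinner_adj_self: "T \<in> bounded_ops \<Longrightarrow> cinner x (adj T (T x)) = complex_of_real ((norm (T x))\<^sup>2)"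
  by (simp add: cinner_adj_right cinner_same)

section \<open>Approximate units\<close>

lemma cstar_algebraD:
  assumes "cstar_algebra A"
  shows "a \<in> A \<Longrightarrow> a \<in> bounded_ops" "0 \<in> A" "closed A"
    "a \<in> A \<Longrightarrow> b \<in> A \<Longrightarrow> a + b \<in> A" "a \<in> A \<Longrightarrow> b \<in> A \<Longrightarrow> a o\<^sub>L b \<in> A"
    "a \<in> A \<Longrightarrow> adj a \<in> A" "a \<in> A \<Longrightarrow> op_scaleC c a \<in> A"
    "a \<in> A \<Longrightarrow> r *\<^sub>R a \<in> A" "a \<in> A \<Longrightarrow> - a \<in> A" "a \<in> A \<Longrightarrow> b \<in> A \<Longrightarrow> a - b \<in> A"
proof -
  show s: "a \<in> A \<Longrightarrow> r *\<^sub>R a \<in> A" for a r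
    using assms by (simp add: op_scaleR cstar_algebra_def)
  show m: "a \<in> A \<Longrightarrow> - a \<in> A" for a using s [of a "-1"] by simp
  show "a \<in> A \<Longrightarrow> b \<in> A \<Longrightarrow> a - b \<in> A"
    using assms m [of b] by (metis cstar_algebra_def diff_conv_add_uminus)
qed (use assms in \<open>auto simp: cstar_algebra_def\<close>)

lemma cstar_algebra_sum:
  "cstar_algebra A \<Longrightarrow> (\<And>i. i \<in> I \<Longrightarrow> f i \<in> A) \<Longrightarrow> sum f I \<in> A"
  by (induction I rule: infinite_finite_induct) (auto simp: cstar_algebraD(2) intro: cstar_algebraD(4))

text \<open>
  Put \<open>k = \<Sum> b\<^sup>* b + b b\<^sup>*\<close> and \<open>e = k (k + \<delta>)\<^sup>-\<^sup>1\<close>.  Then \<open>1 - e = \<delta> (k + \<delta>)\<^sup>-\<^sup>1\<close>, and \<open>b\<^sup>* b \<le> k\<close> gives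
\<open>\<parallel>b (1 - e)\<parallel>\<^sup>2 \<le> \<delta> / 2\<close>; the summands \<open>b b\<^sup>*\<close> do the same on the other side.  Since \<open>A\<close> need not have a unit,
\<open>e\<close> is obtained directly inside \<open>A\<close>, as the solution of \<open>(k + \<delta>) e = k\<close>.
\<close>

lemma cstar_approx_unit:
  fixes A :: "'a::complex_hilbert_space op set"
  assumes A: "cstar_algebra A" and X: "finite X" "X \<subseteq> A" and "\<epsilon> > 0"
  shows "\<exists>e\<in>A. op_pos e \<and> norm e \<le> 1 \<and> (\<forall>a\<in>X. norm ((e o\<^sub>L a o\<^sub>L e) - a) < \<epsilon>)"
proof -
  define k where "k = (\<Sum>b\<in>X. (adj b o\<^sub>L b) + (b o\<^sub>L adj b))"
  have Xb: "b \<in> bounded_ops" if "b \<in> X" for b using that X A by (auto dest: cstar_algebraD(1))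
  have kA: "k \<in> A" unfolding k_def
    using A X(2) by (intro cstar_algebra_sum) (auto intro!: cstar_algebraD(4,5,6))
  have kb: "k \<in> bounded_ops" using kA A by (auto dest: cstar_algebraD(1))
  have kq: "cinner w (k w) = complex_of_real (\<Sum>b\<in>X. (norm (blinfun_apply b w))\<^sup>2 + (norm (adj b w))\<^sup>2)" for w
  proof -
    have "cinner w (((adj b o\<^sub>L b) + (b o\<^sub>L adj b)) w)
        = complex_of_real ((norm (blinfun_apply b w))\<^sup>2 + (norm (adj b w))\<^sup>2)" if "b \<in> X" for b
      using cinner_adj_self [of "adj b" w] Xb [OF that]
      by (simp add: blinfun_lin cinner_add_right cinner_adj_self adj_bounded_ops adj_adj)
    then show ?thesis
      unfolding k_def blinfun.sum_left cinner_sum_right of_real_sum by (intro sum.cong refl)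
  qed
  have kpos: "op_pos k" unfolding op_pos_iff kq by (auto simp: kb intro!: sum_nonneg)
  have kb_le: "(norm (blinfun_apply b w))\<^sup>2 \<le> Re (cinner w (k w))" "(norm (adj b w))\<^sup>2 \<le> Re (cinner w (k w))"
    if "b \<in> X" for b :: "'a op" and w
  proof -
    have "(norm (blinfun_apply b w))\<^sup>2 + (norm (adj b w))\<^sup>2 \<le> Re (cinner w (k w))"
      unfolding kq Re_complex_of_real using X(1) that
      by (intro member_le_sum [of b X "\<lambda>b :: 'a op. (norm (blinfun_apply b w))\<^sup>2 + (norm (adj b w))\<^sup>2"]) auto
    then show "(norm (blinfun_apply b w))\<^sup>2 \<le> Re (cinner w (k w))" "(norm (adj b w))\<^sup>2 \<le> Re (cinner w (k w))"
      by (smt (verit) zero_le_power2)+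
  qed
  \<comment> \<open>With this choice \<open>sqrt (\<delta> / 2) = \<epsilon> / 4\<close>.\<close>
  define \<delta> where "\<delta> = \<epsilon>\<^sup>2 / 8"
  have \<delta>: "\<delta> > 0" using \<open>\<epsilon> > 0\<close> by (simp add: \<delta>_def)
  define M where "M = norm k"
  have M: "0 \<le> M" "M < M + \<delta>" "0 < M + \<delta>" using \<delta> by (auto simp: M_def intro: add_nonneg_pos)
  have Mq: "cinner x ((M *\<^sub>R id_blinfun - k) x) = complex_of_real (M * (norm x)\<^sup>2) - cinner x (k x)" for x
    by (simp add: blinfun_lin cinner_diff_right scaleR_eq_scaleC cinner_scaleC_right cinner_same)
  have nMk: "norm (M *\<^sub>R id_blinfun - k) \<le> M"
  proof (rule op_pos_norm_le)
    have "M *\<^sub>R id_blinfun - k \<in> bounded_ops" by (intro bounded_ops_intros kb)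
    then show "op_pos (M *\<^sub>R id_blinfun - k)"
      using kpos Re_cinner_le_norm [of _ k] unfolding op_pos_iff Mq by (simp add: M_def)
    show "Re (cinner x ((M *\<^sub>R id_blinfun - k) x)) \<le> M * (norm x)\<^sup>2" for x
      using kpos unfolding op_pos_iff Mq by simp
  qed (rule M)
  \<comment> \<open>A contraction, because \<open>0 \<le> M - k \<le> M\<close>; its fixed point solves \<open>(k + \<delta>) e = k\<close>.\<close>
  define f where "f e = (1 / (M + \<delta>)) *\<^sub>R (k + (M *\<^sub>R e - (k o\<^sub>L e)))" for e
  have "\<exists>!e. e \<in> A \<and> f e = e"
  proof (rule Banach_fix)
    show "complete A" using A by (simp add: cstar_algebraD(3) complete_eq_closed)
    show "A \<noteq> {}" using kA by auto
    show "0 \<le> M / (M + \<delta>)" "M / (M + \<delta>) < 1" using M by auto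
    show "f ` A \<subseteq> A" unfolding f_def using kA by (auto intro!: cstar_algebraD(4,5,8,10) [OF A])
    fix x y :: "'a op"
    have "f x - f y = (1 / (M + \<delta>)) *\<^sub>R ((M *\<^sub>R id_blinfun - k) o\<^sub>L (x - y))"
      by (rule blinfun_eqI) (simp add: f_def blinfun_lin algebra_simps)
    then have "dist (f x) (f y) = norm ((M *\<^sub>R id_blinfun - k) o\<^sub>L (x - y)) / (M + \<delta>)"
      using M by (simp add: dist_norm)
    also have "\<dots> \<le> M * norm (x - y) / (M + \<delta>)"
      using M nMk by (intro divide_right_mono order_trans [OF norm_blinfun_compose] mult_right_mono) auto
    finally show "dist (f x) (f y) \<le> M / (M + \<delta>) * dist x y" by (simp add: dist_norm)
  qed
  then obtain e where e: "e \<in> A" "f e = e" by blast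
  have eb: "e \<in> bounded_ops" using e A by (auto dest: cstar_algebraD(1))
  have "(M + \<delta>) *\<^sub>R e = k + (M *\<^sub>R e - (k o\<^sub>L e))"
    using arg_cong [OF e(2), of "\<lambda>T. (M + \<delta>) *\<^sub>R T"] M by (simp add: f_def)
  then have keq: "\<delta> *\<^sub>R e = k - (k o\<^sub>L e)"
    by (simp add: algebra_simps)
  \<comment> \<open>The vector \<open>w\<close> is \<open>(k + \<delta>)\<^sup>-\<^sup>1 x\<close>; in terms of \<open>w\<close> all estimates for \<open>e\<close> are explicit.\<close>
  have key: "\<exists>w. x = k w + \<delta> *\<^sub>R w \<and> e x = k w \<and> x - e x = \<delta> *\<^sub>R w" for x
  proof (intro exI conjI)
    let ?w = "(1 / \<delta>) *\<^sub>R (x - e x)"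
    have "\<delta> *\<^sub>R e x = k x - k (e x)"
      using arg_cong [OF keq, of "\<lambda>T. T x"] by (simp add: blinfun_lin)
    then have "k (x - e x) = \<delta> *\<^sub>R e x" by (simp add: blinfun_lin)
    then have kw: "k ?w = e x" using \<delta> by (simp add: blinfun.scaleR_right)
    show "e x = k ?w" by (simp add: kw)
    show "x - e x = \<delta> *\<^sub>R ?w" using \<delta> by simp
    then show "x = k ?w + \<delta> *\<^sub>R ?w" by (simp add: kw)
  qed
  have nx: "(norm (k w + \<delta> *\<^sub>R w))\<^sup>2 = (norm (k w))\<^sup>2 + 2 * \<delta> * Re (cinner w (k w)) + \<delta>\<^sup>2 * (norm w)\<^sup>2" for w
    unfolding power2_norm_eq_inner inner_eq_Re_cinner [symmetric]
    by (simp add: inner_add inner_commute power2_eq_square algebra_simps)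
  have Rk: "0 \<le> Re (cinner w (k w))" for w using kpos by (simp add: op_pos_iff)
  have epos: "op_pos e"
    unfolding op_pos_iff
  proof (intro conjI allI eb)
    fix x
    obtain w where w: "x = k w + \<delta> *\<^sub>R w" "e x = k w" using key by blast
    have "cinner x (e x) = complex_of_real ((norm (k w))\<^sup>2) + complex_of_real \<delta> * cinner w (k w)"
      unfolding w(2) by (subst w(1)) (simp add: cinner_add_left scaleR_eq_scaleC cinner_scaleC_left cinner_same)
    then show "Im (cinner x (e x)) = 0" "0 \<le> Re (cinner x (e x))"
      using kpos \<delta> Rk [of w] by (auto simp: op_pos_iff simp flip: of_real_power)
  qed
  have en: "norm e \<le> 1"
  proof (rule norm_blinfun_bound)
    fix x
    obtain w where w: "x = k w + \<delta> *\<^sub>R w" "e x = k w" using key by blast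
    have "(norm (e x))\<^sup>2 \<le> (norm x)\<^sup>2" unfolding w(2) unfolding w(1) nx using \<delta> Rk [of w] by simp
    then show "norm (e x) \<le> 1 * norm x" by simp
  qed simp
  have be: "norm (b - (b o\<^sub>L e)) \<le> \<epsilon> / 4" if b: "\<And>w. (norm (blinfun_apply b w))\<^sup>2 \<le> Re (cinner w (k w))" for b :: "'a op"
  proof (rule norm_blinfun_bound)
    fix x
    obtain w where w: "x = k w + \<delta> *\<^sub>R w" "x - e x = \<delta> *\<^sub>R w" using key by blast
    have "(b - (b o\<^sub>L e)) x = b (x - e x)" by (simp add: blinfun_lin)
    then have "(norm ((b - (b o\<^sub>L e)) x))\<^sup>2 = \<delta>\<^sup>2 * (norm (blinfun_apply b w))\<^sup>2"
      unfolding w(2) by (simp add: blinfun_lin power_mult_distrib)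
    also have "\<dots> \<le> \<delta>\<^sup>2 * Re (cinner w (k w))" by (intro mult_left_mono b) simp
    also have "\<dots> = (\<delta> / 2) * (2 * \<delta> * Re (cinner w (k w)))" by (simp add: power2_eq_square)
    also have "\<dots> \<le> (\<delta> / 2) * (norm x)\<^sup>2" unfolding w(1) nx using \<delta> by (intro mult_left_mono) auto
    also have "\<dots> = (\<epsilon> / 4 * norm x)\<^sup>2" by (simp add: \<delta>_def power_mult_distrib power_divide)
    finally show "norm ((b - (b o\<^sub>L e)) x) \<le> \<epsilon> / 4 * norm x"
      by (rule power2_le_imp_le) (use \<open>\<epsilon> > 0\<close> in simp)
  qed (use \<open>\<epsilon> > 0\<close> in simp)
  have "norm ((e o\<^sub>L b o\<^sub>L e) - b) < \<epsilon>" if "b \<in> X" for b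
  proof -
    have bb: "b \<in> bounded_ops" using that by (rule Xb)
    have 1: "norm (b - (b o\<^sub>L e)) \<le> \<epsilon> / 4" by (rule be) (rule kb_le [OF that])
    have "norm (adj b - (adj b o\<^sub>L e)) \<le> \<epsilon> / 4" by (rule be) (rule kb_le [OF that])
    moreover have "adj (adj b - (adj b o\<^sub>L e)) = b - (e o\<^sub>L b)"
      using bb eb by (simp add: adj_diff adj_compose adj_adj bounded_ops_intros adj_bounded_ops op_pos_adj [OF epos])
    ultimately have 2: "norm (b - (e o\<^sub>L b)) \<le> \<epsilon> / 4"
      using norm_adj_le [of "adj b - (adj b o\<^sub>L e)"] bb eb
      by (simp add: bounded_ops_intros adj_bounded_ops)
    have "(e o\<^sub>L b o\<^sub>L e) - b = - ((b - (e o\<^sub>L b)) o\<^sub>L e) - (b - (b o\<^sub>L e))"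
      by (rule blinfun_eqI) (simp add: blinfun_lin)
    then have "norm ((e o\<^sub>L b o\<^sub>L e) - b) \<le> norm ((b - (e o\<^sub>L b)) o\<^sub>L e) + norm (b - (b o\<^sub>L e))"
      by (metis norm_minus_cancel norm_triangle_ineq4)
    also have "norm ((b - (e o\<^sub>L b)) o\<^sub>L e) \<le> \<epsilon> / 4 * 1"
      using 2 en \<open>\<epsilon> > 0\<close> by (intro order_trans [OF norm_blinfun_compose] mult_mono) auto
    finally show ?thesis using 1 \<open>\<epsilon> > 0\<close> by linarith
  qed
  then show ?thesis using e(1) epos en by blast
qed

section \<open>Completely positive maps and operator matrices\<close>

lemma sform_cong:
  assumes "\<And>i j. i \<in> I \<Longrightarrow> j \<in> J \<Longrightarrow> cinner (x i) (blinfun_apply (a i j) (y j)) = cinner (x' i) (blinfun_apply (a' i j) (y' j))"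
  shows "sform I J a x y = sform I J a' x' y'"
  unfolding sform_def by (intro sum.cong refl assms)

lemma sform_reindex:
  assumes "bij_betw h J I"
  shows "sform J J (\<lambda>i j. a (h i) (h j)) (\<lambda>i. x (h i)) (\<lambda>i. y (h i)) = sform I I a x y"
  unfolding sform_def by (simp add: sum.reindex_bij_betw [OF assms, symmetric])

lemma sqn_reindex: "bij_betw h J I \<Longrightarrow> sqn J (\<lambda>i. x (h i)) = sqn I x"
  unfolding sqn_def by (rule sum.reindex_bij_betw)

lemma sform_reindex_inv:
  assumes "bij_betw h J I"
  shows "sform J J (\<lambda>i j. a (h i) (h j)) x y
    = sform I I a (\<lambda>i. x (the_inv_into J h i)) (\<lambda>i. y (the_inv_into J h i))"
  unfolding sform_reindex [OF assms, symmetric]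
  using assms by (intro sform_cong) (simp add: bij_betw_def the_inv_into_f_f)

lemma sqn_reindex_inv: "bij_betw h J I \<Longrightarrow> sqn I (\<lambda>i. x (the_inv_into J h i)) = sqn J x"
  unfolding sqn_reindex [symmetric, of h J I]
  by (simp add: bij_betw_def the_inv_into_f_f sqn_def)

lemma mpos_reindex:
  assumes "bij_betw h J I"
  shows "mpos J (\<lambda>i j. a (h i) (h j)) \<longleftrightarrow> mpos I a"
  unfolding mpos_def by (metis sform_reindex_inv [OF assms] sform_reindex [OF assms])

lemma mbound_reindex:
  assumes "bij_betw h J I"
  shows "mbound J (\<lambda>i j. a (h i) (h j)) c \<longleftrightarrow> mbound I a c"
  unfolding mbound_def
proof safe
  fix x y assume *: "\<forall>x y. cmod (sform J J (\<lambda>i j. a (h i) (h j)) x y) \<le> c * sqrt (sqn J x) * sqrt (sqn J y)"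
  then show "cmod (sform I I a x y) \<le> c * sqrt (sqn I x) * sqrt (sqn I y)"
    using sform_reindex [OF assms, of a x y] sqn_reindex [OF assms, of x] sqn_reindex [OF assms, of y]
    by metis
next
  fix x y assume *: "\<forall>x y. cmod (sform I I a x y) \<le> c * sqrt (sqn I x) * sqrt (sqn I y)"
  then show "cmod (sform J J (\<lambda>i j. a (h i) (h j)) x y) \<le> c * sqrt (sqn J x) * sqrt (sqn J y)"
    unfolding sform_reindex_inv [OF assms] sqn_reindex_inv [OF assms, symmetric] by blast
qed

lemma mpos_cong:
  assumes "\<And>i j. i \<in> I \<Longrightarrow> j \<in> I \<Longrightarrow> a i j = b i j"
  shows "mpos I a \<longleftrightarrow> mpos I b"
proof -
  have "sform I I a x x = sform I I b x x" for x
    by (intro sform_cong) (simp add: assms)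
  then show ?thesis by (simp add: mpos_def)
qed

lemma matrix_pos_iff_mpos: "matrix_pos n a \<longleftrightarrow> mpos {..<n} a"
  by (simp add: matrix_pos_def mpos_def sform_def)

lemma completely_positiveD:
  assumes "completely_positive A B \<phi>"
  shows "a \<in> A \<Longrightarrow> \<phi> a \<in> B" "a \<in> A \<Longrightarrow> b \<in> A \<Longrightarrow> \<phi> (a + b) = \<phi> a + \<phi> b"
    "a \<in> A \<Longrightarrow> \<phi> (op_scaleC c a) = op_scaleC c (\<phi> a)"
  using assms unfolding completely_positive_def linear_on_alg_def by blast+

lemma cp_mpos:
  assumes cp: "completely_positive A B \<phi>" and I: "finite I"
    and a: "\<And>i j. i \<in> I \<Longrightarrow> j \<in> I \<Longrightarrow> a i j \<in> A" and pos: "mpos I a"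
  shows "mpos I (\<lambda>i j. \<phi> (a i j))"
proof -
  obtain h where "bij_betw h {0..<card I} I" using ex_bij_betw_nat_finite [OF I] by blast
  then have h: "bij_betw h {..<card I} I" by (simp add: atLeast0LessThan)
  have hI: "h i \<in> I" if "i < card I" for i using h that by (auto dest: bij_betwE)
  have "matrix_pos (card I) (\<lambda>i j. a (h i) (h j))"
    unfolding matrix_pos_iff_mpos mpos_reindex [OF h] by (rule pos)
  then have "matrix_pos (card I) (\<lambda>i j. \<phi> (a (h i) (h j)))"
    using cp a hI unfolding completely_positive_def by auto
  then show ?thesis
    unfolding matrix_pos_iff_mpos mpos_reindex [OF h, of "\<lambda>i j. \<phi> (a i j)"] .
qed

lemma cp_zero: "completely_positive A B \<phi> \<Longrightarrow> a \<in> A \<Longrightarrow> \<phi> 0 = 0"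
  using completely_positiveD(3) [of A B \<phi> a 0]
  by (metis blinfun_eqI op_scaleC_apply scaleC_zero_left zero_blinfun.rep_eq)

lemma cp_scaleR: "completely_positive A B \<phi> \<Longrightarrow> a \<in> A \<Longrightarrow> \<phi> (r *\<^sub>R a) = r *\<^sub>R \<phi> a"
  by (simp add: op_scaleR completely_positiveD(3))

lemma cp_diff:
  assumes "completely_positive A B \<phi>" "a \<in> A" "b \<in> A" "- b \<in> A"
  shows "\<phi> (a - b) = \<phi> a - \<phi> b"
  using completely_positiveD(2) [OF assms(1,2,4)] cp_scaleR [OF assms(1,3), of "-1"] by simp

lemma cp_sum:
  assumes "completely_positive A B \<phi>" "cstar_algebra A" "\<And>i. i \<in> I \<Longrightarrow> f i \<in> A"
  shows "\<phi> (sum f I) = (\<Sum>i\<in>I. \<phi> (f i))"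
  using assms(3)
proof (induction I rule: infinite_finite_induct)
  case (insert i I)
  then show ?case
    by (simp add: completely_positiveD(2) [OF assms(1)] cstar_algebra_sum [OF assms(2)])
qed (use cp_zero [OF assms(1)] cstar_algebraD(2) [OF assms(2)] in auto)

lemma cp_op_pos:
  assumes "completely_positive A B \<phi>" "B \<subseteq> bounded_ops" "a \<in> A" "op_pos a"
  shows "op_pos (\<phi> a)"
  using cp_mpos [OF assms(1), of "{()}" "\<lambda>_ _. a"] assms completely_positiveD(1) [OF assms(1)]
  by (auto simp: mpos_def sform_def op_pos_def)

definition block2 :: "('i \<Rightarrow> 'i \<Rightarrow> 'c) \<Rightarrow> ('i \<Rightarrow> 'j \<Rightarrow> 'c) \<Rightarrow> ('j \<Rightarrow> 'i \<Rightarrow> 'c) \<Rightarrow> ('j \<Rightarrow> 'j \<Rightarrow> 'c) \<Rightarrow>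
    'i + 'j \<Rightarrow> 'i + 'j \<Rightarrow> 'c" where
  "block2 P Q R S = case_sum (\<lambda>i. case_sum (P i) (Q i)) (\<lambda>j. case_sum (R j) (S j))"

lemma block2_simps [simp]:
  "block2 P Q R S (Inl i) (Inl i') = P i i'" "block2 P Q R S (Inl i) (Inr j) = Q i j"
  "block2 P Q R S (Inr j) (Inl i) = R j i" "block2 P Q R S (Inr j) (Inr j') = S j j'"
  by (auto simp: block2_def)

lemma sform_block:
  assumes "finite I" "finite J"
  shows "sform (I <+> J) (I <+> J) (block2 P Q R S) x y =
    sform I I P (\<lambda>i. x (Inl i)) (\<lambda>i. y (Inl i)) + sform I J Q (\<lambda>i. x (Inl i)) (\<lambda>i. y (Inr i))
    + sform J I R (\<lambda>i. x (Inr i)) (\<lambda>i. y (Inl i)) + sform J J S (\<lambda>i. x (Inr i)) (\<lambda>i. y (Inr i))"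
  by (simp add: sform_def sum.Plus assms sum.distrib)

text \<open>
  A completely positive map preserves positivity of the block matrix; Cauchy-Schwarz for the image,
applied to vectors supported in different summands, bounds the off-diagonal corner by the
diagonal.
\<close>

lemma cp_block_cauchy_schwarz:
  assumes cp: "completely_positive A B \<phi>" "B \<subseteq> bounded_ops" and fin: "finite I" "finite J"
    and mem: "\<And>i j. i \<in> I \<Longrightarrow> j \<in> I \<Longrightarrow> P i j \<in> A" "\<And>i j. i \<in> I \<Longrightarrow> j \<in> J \<Longrightarrow> Q i j \<in> A"
      "\<And>i j. i \<in> J \<Longrightarrow> j \<in> I \<Longrightarrow> R i j \<in> A" "\<And>i j. i \<in> J \<Longrightarrow> j \<in> J \<Longrightarrow> S i j \<in> A"
    and pos: "\<And>x y. sform I I P x x + sform I J Q x y + sform J I R y x + sform J J S y y \<in> \<real>\<^sub>\<ge>\<^sub>0"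
  shows "(cmod (sform I J (\<lambda>i j. \<phi> (Q i j)) x y))\<^sup>2
    \<le> Re (sform I I (\<lambda>i j. \<phi> (P i j)) x x) * Re (sform J J (\<lambda>i j. \<phi> (S i j)) y y)"
proof -
  have m: "p \<in> I <+> J \<Longrightarrow> q \<in> I <+> J \<Longrightarrow> block2 P Q R S p q \<in> A" for p q
    using mem by auto
  have "mpos (I <+> J) (\<lambda>p q. \<phi> (block2 P Q R S p q))"
  proof (rule cp_mpos [OF cp(1)])
    show "mpos (I <+> J) (block2 P Q R S)"
      unfolding mpos_def sform_block [OF fin] by (intro allI pos)
  qed (use fin m in auto)
  moreover have "(\<lambda>p q. \<phi> (block2 P Q R S p q)) = block2 (\<lambda>i j. \<phi> (P i j)) (\<lambda>i j. \<phi> (Q i j))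
      (\<lambda>i j. \<phi> (R i j)) (\<lambda>i j. \<phi> (S i j))"
    by (auto simp: block2_def fun_eq_iff split: sum.splits)
  ultimately have pos': "mpos (I <+> J) (block2 (\<lambda>i j. \<phi> (P i j)) (\<lambda>i j. \<phi> (Q i j))
      (\<lambda>i j. \<phi> (R i j)) (\<lambda>i j. \<phi> (S i j)))" by simp
  have z: "sform I' J' a (\<lambda>_. 0) y' = 0" "sform I' J' a x' (\<lambda>_. 0) = 0"
    for I' :: "'x set" and J' :: "'y set" and a x' y'
    by (simp_all add: sform_def)
  have "\<phi> (P i j) \<in> bounded_ops" if "i \<in> I" "j \<in> I" for i j
    using completely_positiveD(1) [OF cp(1) mem(1) [OF that]] cp(2) by blast
  moreover have "\<phi> (Q i j) \<in> bounded_ops" if "i \<in> I" "j \<in> J" for i j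
    using completely_positiveD(1) [OF cp(1) mem(2) [OF that]] cp(2) by blast
  moreover have "\<phi> (R i j) \<in> bounded_ops" if "i \<in> J" "j \<in> I" for i j
    using completely_positiveD(1) [OF cp(1) mem(3) [OF that]] cp(2) by blast
  moreover have "\<phi> (S i j) \<in> bounded_ops" if "i \<in> J" "j \<in> J" for i j
    using completely_positiveD(1) [OF cp(1) mem(4) [OF that]] cp(2) by blast
  ultimately have "block2 (\<lambda>i j. \<phi> (P i j)) (\<lambda>i j. \<phi> (Q i j))
      (\<lambda>i j. \<phi> (R i j)) (\<lambda>i j. \<phi> (S i j)) p q \<in> bounded_ops" if "p \<in> I <+> J" "q \<in> I <+> J" for p q
    using that by auto
  from mpos_cauchy_schwarz [OF pos' this, of "case_sum x (\<lambda>_. 0)" "case_sum (\<lambda>_. 0) y"]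
  show ?thesis
    by (simp add: sform_block fin z)
qed

lemma sform_diag:
  "finite I \<Longrightarrow> sform I I (\<lambda>i j. if i = j then T else 0) x y = (\<Sum>i\<in>I. cinner (x i) (T (y i)))"
  unfolding sform_def by (intro sum.cong refl) (simp add: if_distrib if_distribR sum.delta' cong: if_cong)

lemma sqn_nonneg: "0 \<le> sqn I x"
  by (simp add: sqn_def sum_nonneg)

text \<open>
  If \<open>a\<close> is bounded by \<open>c\<close>, then the block matrix with diagonal blocks \<open>c e\<^sup>2\<close> and corner \<open>e a e\<close> is
positive: its form at \<open>(z, w)\<close> is at least \<open>c (\<parallel>e z\<parallel> - \<parallel>e w\<parallel>)\<^sup>2\<close>.  The image of the diagonal is controlled by
\<open>\<kappa>\<close>, hence so is the image of the corner.  The element \<open>e\<close> replaces a unit.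
\<close>

lemma cp_compress_mbound:
  fixes \<phi> :: "'h::complex_hilbert_space op \<Rightarrow> 'k::complex_hilbert_space op" and a :: "'i \<Rightarrow> 'i \<Rightarrow> 'h op"
  assumes A: "cstar_algebra A" and cp: "completely_positive A B \<phi>" "B \<subseteq> bounded_ops"
    and I: "finite I" and a: "\<And>i j. i \<in> I \<Longrightarrow> j \<in> I \<Longrightarrow> a i j \<in> A"
    and e: "e \<in> A" "op_pos e" and \<kappa>: "norm (\<phi> (e o\<^sub>L e)) \<le> \<kappa>"
    and bnd: "mbound I a c" and c: "0 \<le> c"
  shows "mbound I (\<lambda>i j. \<phi> (e o\<^sub>L a i j o\<^sub>L e)) (\<kappa> * c)"
  unfolding mbound_def
proof (intro allI)
  fix x y :: "'i \<Rightarrow> 'k"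
  define P where "P i j = (if i = j then op_scaleC c (e o\<^sub>L e) else 0)" for i j :: 'i
  have ee: "e o\<^sub>L e \<in> A" "op_scaleC c (e o\<^sub>L e) \<in> A" using A e by (auto intro: cstar_algebraD)
  have Pm: "P i j \<in> A" for i j
    using A ee unfolding P_def by (auto intro: cstar_algebraD(2))
  have sfP: "sform I I P z z = complex_of_real (c * sqn I (\<lambda>i. e (z i)))" for z
    unfolding P_def sform_diag [OF I]
    by (simp add: sqn_def sum_distrib_left cinner_scaleC_right op_pos_cinner_commute [OF e(2)] cinner_same)
  define Q where "Q i j = e o\<^sub>L a i j o\<^sub>L e" for i j
  define R where "R i j = e o\<^sub>L adj (a j i) o\<^sub>L e" for i j
  have sfQ: "sform I I Q z w = sform I I a (\<lambda>i. e (z i)) (\<lambda>i. e (w i))" for z w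
    unfolding Q_def by (intro sform_cong) (simp add: op_pos_cinner_commute [OF e(2)])
  have sfR: "sform I I R w z = cnj (sform I I Q z w)" for z w
  proof -
    have "sform I I R w z = (\<Sum>j\<in>I. \<Sum>i\<in>I. cinner (w i) (R i j (z j)))"
      unfolding sform_def by (rule sum.swap)
    also have "\<dots> = (\<Sum>j\<in>I. \<Sum>i\<in>I. cnj (cinner (z j) (Q j i (w i))))"
    proof (intro sum.cong refl)
      fix i j assume "i \<in> I" "j \<in> I"
      then have b: "a j i \<in> bounded_ops" using a A by (auto dest: cstar_algebraD(1))
      have "cinner (w i) (R i j (z j)) = cinner (a j i (e (w i))) (e (z j))"
        by (simp add: R_def op_pos_cinner_commute [OF e(2)] cinner_adj_right [OF b])
      also have "\<dots> = cnj (cinner (z j) (Q j i (w i)))"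
        by (simp add: Q_def op_pos_cinner_commute [OF e(2)] cinner_commute [of "e (z j)"])
      finally show "cinner (w i) (R i j (z j)) = cnj (cinner (z j) (Q j i (w i)))" .
    qed
    finally show ?thesis by (simp add: sform_def)
  qed
  have CS: "(cmod (sform I I (\<lambda>i j. \<phi> (Q i j)) x y))\<^sup>2
    \<le> Re (sform I I (\<lambda>i j. \<phi> (P i j)) x x) * Re (sform I I (\<lambda>i j. \<phi> (P i j)) y y)"
  proof (rule cp_block_cauchy_schwarz [where R = R, OF cp I I Pm _ _ Pm])
    show "Q i j \<in> A" if "i \<in> I" "j \<in> I" for i j
      unfolding Q_def using A e a that by (auto intro!: cstar_algebraD(5))
    show "R i j \<in> A" if "i \<in> I" "j \<in> I" for i j
      unfolding R_def using A e a that by (auto intro!: cstar_algebraD(5,6))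
    fix z w :: "'i \<Rightarrow> 'h"
    define q where "q = sform I I Q z w"
    define s where "s = sqrt (sqn I (\<lambda>i. e (z i)))"
    define t where "t = sqrt (sqn I (\<lambda>i. e (w i)))"
    have "cmod q \<le> c * s * t"
      using bnd unfolding q_def sfQ s_def t_def mbound_def by blast
    then have 1: "- Re q \<le> c * s * t" using abs_Re_le_cmod [of q] by linarith
    have 2: "sqn I (\<lambda>i. e (z i)) = s\<^sup>2" "sqn I (\<lambda>i. e (w i)) = t\<^sup>2"
      by (auto simp: s_def t_def sqn_nonneg)
    have "0 \<le> c * (s - t)\<^sup>2" using c by simp
    then have "0 \<le> c * s\<^sup>2 + 2 * Re q + c * t\<^sup>2" using 1
      by (simp add: power2_diff algebra_simps)
    moreover have "sform I I P z z + sform I I Q z w + sform I I R w z + sform I I P w w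
        = complex_of_real (c * s\<^sup>2 + 2 * Re q + c * t\<^sup>2)"
      unfolding sfP sfR 2 q_def [symmetric] by (simp add: complex_eq_iff)
    ultimately show "sform I I P z z + sform I I Q z w + sform I I R w z + sform I I P w w \<in> \<real>\<^sub>\<ge>\<^sub>0"
      by (simp add: complex_nonneg_Reals_iff)
  qed
  have \<phi>P: "\<phi> (P i j) = (if i = j then op_scaleC c (\<phi> (e o\<^sub>L e)) else 0)" for i j
    using cp_zero [OF cp(1) ee(1)] completely_positiveD(3) [OF cp(1) ee(1)] by (simp add: P_def)
  have bP: "Re (sform I I (\<lambda>i j. \<phi> (P i j)) z z) \<le> \<kappa> * c * sqn I z" for z
  proof -
    have "Re (sform I I (\<lambda>i j. \<phi> (P i j)) z z) = (\<Sum>i\<in>I. c * Re (cinner (z i) (\<phi> (e o\<^sub>L e) (z i))))"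
      unfolding \<phi>P sform_diag [OF I] by (simp add: cinner_scaleC_right)
    also have "\<dots> \<le> (\<Sum>i\<in>I. c * (\<kappa> * (norm (z i))\<^sup>2))"
      using \<kappa> by (intro sum_mono mult_left_mono c order_trans [OF Re_cinner_le_norm] mult_right_mono) auto
    also have "\<dots> = \<kappa> * c * sqn I z" by (simp add: sqn_def sum_distrib_left mult_ac)
    finally show ?thesis .
  qed
  have \<kappa>0: "0 \<le> \<kappa>" using \<kappa> norm_ge_zero order_trans by blast
  have P0: "0 \<le> Re (sform I I (\<lambda>i j. \<phi> (P i j)) z z)" for z
  proof -
    have "op_pos (e o\<^sub>L e)" using op_pos_adj_compose [OF op_pos_bounded [OF e(2)]] by (simp add: op_pos_adj e)
    then have "op_pos (\<phi> (e o\<^sub>L e))" by (rule cp_op_pos [OF cp ee(1)])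
    then show ?thesis
      unfolding \<phi>P sform_diag [OF I] using c by (auto simp: cinner_scaleC_right op_pos_iff intro!: sum_nonneg)
  qed
  have "(cmod (sform I I (\<lambda>i j. \<phi> (Q i j)) x y))\<^sup>2 \<le> (\<kappa> * c * sqn I x) * (\<kappa> * c * sqn I y)"
    using \<kappa>0 c by (intro order_trans [OF CS] mult_mono bP P0) (auto intro!: mult_nonneg_nonneg sqn_nonneg)
  also have "\<dots> = (\<kappa> * c * sqrt (sqn I x) * sqrt (sqn I y))\<^sup>2"
    by (simp add: power_mult_distrib sqn_nonneg) (simp add: power2_eq_square)
  finally show "cmod (sform I I (\<lambda>i j. \<phi> (e o\<^sub>L a i j o\<^sub>L e)) x y) \<le> \<kappa> * c * sqrt (sqn I x) * sqrt (sqn I y)"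
    unfolding Q_def by (rule power2_le_imp_le) (use \<kappa>0 c in \<open>auto intro!: mult_nonneg_nonneg sqn_nonneg\<close>)
qed

text \<open>
  A completely positive contraction is completely contractive: compress the entries by an approximate
unit \<open>e\<close> of \<open>A\<close>, where \<open>\<parallel>\<phi> (e\<^sup>2)\<parallel> \<le> 1\<close>, and let \<open>e a e\<close> tend to \<open>a\<close>.
\<close>

lemma cp_contractive_mbound:
  fixes \<phi> :: "'h::complex_hilbert_space op \<Rightarrow> 'k::complex_hilbert_space op" and a :: "'i \<Rightarrow> 'i \<Rightarrow> 'h op"
  assumes A: "cstar_algebra A" and cp: "completely_positive A B \<phi>" "B \<subseteq> bounded_ops"
    and con: "contractive_on A \<phi>"
    and I: "finite I" and a: "\<And>i j. i \<in> I \<Longrightarrow> j \<in> I \<Longrightarrow> a i j \<in> A"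
    and bnd: "mbound I a c" and c: "0 \<le> c"
  shows "mbound I (\<lambda>i j. \<phi> (a i j)) c"
  unfolding mbound_def
proof (intro allI)
  fix x y :: "'i \<Rightarrow> 'k"
  define K where "K = (\<Sum>i\<in>I. \<Sum>j\<in>I. norm (x i) * norm (y j))"
  have K: "0 \<le> K" unfolding K_def by (intro sum_nonneg mult_nonneg_nonneg) auto
  show "cmod (sform I I (\<lambda>i j. \<phi> (a i j)) x y) \<le> c * sqrt (sqn I x) * sqrt (sqn I y)"
  proof (rule field_le_epsilon)
    fix \<xi> :: real assume \<xi>: "0 < \<xi>"
    define \<eta> where "\<eta> = \<xi> / (K + 1)"
    have \<eta>: "\<eta> > 0" "\<eta> * K \<le> \<xi>" using \<xi> K by (auto simp: \<eta>_def field_simps)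
    have "finite ((\<lambda>(i, j). a i j) ` (I \<times> I))" "(\<lambda>(i, j). a i j) ` (I \<times> I) \<subseteq> A"
      using I a by auto
    from cstar_approx_unit [OF A this \<eta>(1)]
    obtain e where e: "e \<in> A" "op_pos e" "norm e \<le> 1"
      and ea: "\<And>i j. i \<in> I \<Longrightarrow> j \<in> I \<Longrightarrow> norm ((e o\<^sub>L a i j o\<^sub>L e) - a i j) < \<eta>"
      by fastforce
    have "norm (e o\<^sub>L e) \<le> 1 * 1" using e by (intro order_trans [OF norm_blinfun_compose] mult_mono) auto
    moreover have "e o\<^sub>L e \<in> A" using A e by (auto intro: cstar_algebraD(5))
    ultimately have "norm (\<phi> (e o\<^sub>L e)) \<le> 1" using con unfolding contractive_on_def by force
    from cp_compress_mbound [OF A cp I a e(1,2) this bnd c]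
    have 1: "cmod (sform I I (\<lambda>i j. \<phi> (e o\<^sub>L a i j o\<^sub>L e)) x y) \<le> c * sqrt (sqn I x) * sqrt (sqn I y)"
      by (simp add: mbound_def)
    have "sform I I (\<lambda>i j. \<phi> (a i j)) x y - sform I I (\<lambda>i j. \<phi> (e o\<^sub>L a i j o\<^sub>L e)) x y
      = (\<Sum>i\<in>I. \<Sum>j\<in>I. cinner (x i) ((\<phi> (a i j) - \<phi> (e o\<^sub>L a i j o\<^sub>L e)) (y j)))"
      by (simp add: sform_def sum_subtractf blinfun_lin cinner_diff_right)
    also have "cmod \<dots> \<le> (\<Sum>i\<in>I. \<Sum>j\<in>I. \<eta> * (norm (x i) * norm (y j)))"
    proof (intro order_trans [OF norm_sum] sum_mono)
      fix i j assume ij: "i \<in> I" "j \<in> I"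
      have m: "a i j \<in> A" "e o\<^sub>L a i j o\<^sub>L e \<in> A" using A e a ij by (auto intro!: cstar_algebraD(5))
      have "norm (\<phi> (a i j) - \<phi> (e o\<^sub>L a i j o\<^sub>L e)) = norm (\<phi> (a i j - (e o\<^sub>L a i j o\<^sub>L e)))"
        using m A by (subst cp_diff [OF cp(1)]) (auto intro: cstar_algebraD(9))
      also have "\<dots> \<le> norm (a i j - (e o\<^sub>L a i j o\<^sub>L e))"
        using con m A by (auto simp: contractive_on_def intro: cstar_algebraD(10))
      also have "\<dots> \<le> \<eta>" using ea [OF ij] by (simp add: norm_minus_commute)
      finally have n: "norm (\<phi> (a i j) - \<phi> (e o\<^sub>L a i j o\<^sub>L e)) \<le> \<eta>" .
      have "cmod (cinner (x i) ((\<phi> (a i j) - \<phi> (e o\<^sub>L a i j o\<^sub>L e)) (y j)))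
        \<le> norm (x i) * (norm (\<phi> (a i j) - \<phi> (e o\<^sub>L a i j o\<^sub>L e)) * norm (y j))"
        by (intro order_trans [OF cmod_cinner_le_norm] mult_left_mono norm_blinfun) auto
      also have "\<dots> \<le> norm (x i) * (\<eta> * norm (y j))"
        using n by (intro mult_left_mono mult_right_mono) auto
      finally show "cmod (cinner (x i) ((\<phi> (a i j) - \<phi> (e o\<^sub>L a i j o\<^sub>L e)) (y j)))
        \<le> \<eta> * (norm (x i) * norm (y j))" by (simp add: mult_ac)
    qed
    also have "\<dots> = \<eta> * K" by (simp add: K_def sum_distrib_left)
    finally have 2: "cmod (sform I I (\<lambda>i j. \<phi> (a i j)) x y
        - sform I I (\<lambda>i j. \<phi> (e o\<^sub>L a i j o\<^sub>L e)) x y) \<le> \<xi>" using \<eta>(2) by linarith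
    show "cmod (sform I I (\<lambda>i j. \<phi> (a i j)) x y) \<le> c * sqrt (sqn I x) * sqrt (sqn I y) + \<xi>"
      using 1 2 norm_triangle_ineq2 [of "sform I I (\<lambda>i j. \<phi> (a i j)) x y"
          "sform I I (\<lambda>i j. \<phi> (e o\<^sub>L a i j o\<^sub>L e)) x y"] by linarith
  qed
qed

section \<open>Operators on square-summable families and their entries\<close>

lemma coord_single: "ell2_coord i (ell2_single j v) = (if i = j then v else 0)"
  by (simp add: ell2_coord.rep_eq ell2_single.rep_eq ell2_vec.rep_eq)

lemma compose_id [simp]: "T o\<^sub>L id_blinfun = T" "id_blinfun o\<^sub>L T = T"
  by (auto intro: blinfun_eqI)

lemma coord_scaleC: "ell2_coord i (c *\<^sub>C x) = c *\<^sub>C ell2_coord i x"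
  by (simp add: ell2_coord.rep_eq scaleC_ell2.rep_eq)

lemma ell2_coord_eqI: "(\<And>i. ell2_coord i x = ell2_coord i y) \<Longrightarrow> x = y"
  by (rule ell2_eqI) (simp add: ell2_coord.rep_eq)

lemma single_scaleC: "ell2_single i (c *\<^sub>C v) = c *\<^sub>C ell2_single i v"
  by (rule ell2_coord_eqI) (simp add: coord_single coord_scaleC)

lemma cinner_single_right: "cinner x (ell2_single q v) = cinner (ell2_coord q x) v"
proof -
  have "cinner x (ell2_single q v) = (\<Sum>\<^sub>\<infinity>i\<in>{q}. cinner (ell2_nth x i) (ell2_nth (ell2_single q v) i))"
    unfolding cinner_ell2_def
    by (rule infsum_cong_neutral) (auto simp: ell2_single.rep_eq ell2_vec.rep_eq)
  then show ?thesis by (simp add: ell2_coord.rep_eq ell2_single.rep_eq ell2_vec.rep_eq)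
qed

lemma cinner_single_left: "cinner (ell2_single q v) x = cinner v (ell2_coord q x)"
  by (metis cinner_single_right cinner_commute)

lemma entry_apply: "entry T p q v = ell2_coord p (T (ell2_single q v))"
  by (simp add: entry_def)

lemma entry_bounded_ops: "T \<in> bounded_ops \<Longrightarrow> entry T p q \<in> bounded_ops"
  by (simp add: bounded_ops_def entry_apply single_scaleC coord_scaleC)

text \<open>
  The entries
determine \<open>T\<close> on each coordinate vector, hence every coordinate of \<open>adj T x\<close>, hence \<open>T\<close>.
\<close>

lemma op_eqI_entry:
  assumes S: "S \<in> bounded_ops" and T: "T \<in> bounded_ops"
    and eq: "\<And>p q. entry S p q = entry T p q"
  shows "S = T"
proof -
  have s: "S (ell2_single q v) = T (ell2_single q v)" for q v
    using eq by (intro ell2_coord_eqI) (metis entry_apply)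
  have "adj S x = adj T x" for x
  proof (rule ell2_coord_eqI, rule cinner_eqI)
    show "cinner (ell2_coord i (adj S x)) y = cinner (ell2_coord i (adj T x)) y" for i y
      by (simp add: cinner_single_right [symmetric] cinner_adj_left S T s)
  qed
  then have "adj S = adj T" by (rule blinfun_eqI)
  then show ?thesis by (metis adj_adj S T)
qed

lemma norm_coord_le: "norm (ell2_coord p) \<le> 1"
  by (rule norm_blinfun_bound) (auto simp: ell2_coord.rep_eq ell2_norm_nth_le)

lemma norm_single_le: "norm (ell2_single p) \<le> 1"
  by (rule norm_blinfun_bound) (auto simp: ell2_single.rep_eq norm_ell2_vec)

lemma norm_compose3_le: "norm S \<le> 1 \<Longrightarrow> norm R \<le> 1 \<Longrightarrow> norm (S o\<^sub>L T o\<^sub>L R) \<le> norm T"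
  using norm_blinfun_compose [of "S o\<^sub>L T" R] norm_blinfun_compose [of S T]
  by (smt (verit, best) mult_left_le mult_left_le_one_le norm_ge_zero)

lemma entry_add: "entry (S + T) p q = entry S p q + entry T p q"
  by (rule blinfun_eqI) (simp add: entry_apply blinfun_lin)

lemma entry_diff: "entry (S - T) p q = entry S p q - entry T p q"
  by (rule blinfun_eqI) (simp add: entry_apply blinfun_lin)

lemma entry_zero [simp]: "entry 0 p q = 0"
  by (rule blinfun_eqI) (simp add: entry_apply)

lemma entry_scaleC: "entry (op_scaleC c T) p q = op_scaleC c (entry T p q)"
  by (rule blinfun_eqI) (simp add: entry_apply coord_scaleC)

lemma entry_sum: "entry (sum f I) p q = (\<Sum>i\<in>I. entry (f i) p q)"
  by (rule blinfun_eqI) (simp add: entry_apply blinfun_lin)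

lemma entry_adj: assumes "T \<in> bounded_ops" shows "entry (adj T) p q = adj (entry T q p)"
proof (rule adj_eqI [symmetric])
  show "cinner (entry (adj T) p q x) y = cinner x (entry T q p y)" for x y
    by (simp add: entry_apply cinner_single_right [symmetric] cinner_single_left [symmetric]
      cinner_adj_left assms)
qed

lemma continuous_entry: "continuous_on UNIV (\<lambda>T. entry T p q)"
  unfolding entry_def
  by (intro linear_continuous_on bounded_linear_compose [OF bounded_bilinear.bounded_linear_left [OF bounded_bilinear_blinfun_compose]]
      bounded_bilinear.bounded_linear_right [OF bounded_bilinear_blinfun_compose])

subsection \<open>Matrix operators\<close>

definition mat_op :: "'i set \<Rightarrow> ('i \<Rightarrow> 'i \<Rightarrow> 'k::complex_hilbert_space op) \<Rightarrow> ('i, 'k) ell2 op" where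
  "mat_op I m = (\<Sum>p\<in>I. \<Sum>q\<in>I. ell2_single p o\<^sub>L m p q o\<^sub>L ell2_coord q)"

lemma single_coord_bounded: "a \<in> bounded_ops \<Longrightarrow> ell2_single p o\<^sub>L a o\<^sub>L ell2_coord q \<in> bounded_ops"
  by (simp add: bounded_ops_def coord_scaleC single_scaleC)

lemma mat_op_bounded:
  "(\<And>p q. p \<in> I \<Longrightarrow> q \<in> I \<Longrightarrow> m p q \<in> bounded_ops) \<Longrightarrow> mat_op I m \<in> bounded_ops"
  unfolding mat_op_def by (intro bounded_ops_sum single_coord_bounded) auto

lemma entry_single_coord:
  "entry (ell2_single p o\<^sub>L a o\<^sub>L ell2_coord q) p' q' = (if p' = p \<and> q' = q then a else 0)"
  by (rule blinfun_eqI) (simp add: entry_apply coord_single)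

lemma entry_mat_op:
  assumes "finite I"
  shows "entry (mat_op I m) p q = (if p \<in> I \<and> q \<in> I then m p q else 0)"
proof -
  have "entry (mat_op I m) p q = (\<Sum>p'\<in>I. \<Sum>q'\<in>I. if q = q' then (if p = p' then m p' q' else 0) else 0)"
    unfolding mat_op_def entry_sum entry_single_coord
    by (intro sum.cong refl) auto
  then show ?thesis using assms by (cases "q \<in> I") (simp_all add: sum.delta sum.delta')
qed

lemma mat_op_entry:
  assumes T: "T \<in> bounded_ops" and I: "finite I" and z: "\<And>p q. \<not> (p \<in> I \<and> q \<in> I) \<Longrightarrow> entry T p q = 0"
  shows "mat_op I (entry T) = T"
  using z by (intro op_eqI_entry mat_op_bounded entry_bounded_ops T) (auto simp: entry_mat_op I)

lemma cinner_mat_op: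
  "cinner x (mat_op I m y) = sform I I m (\<lambda>i. ell2_coord i x) (\<lambda>i. ell2_coord i y)"
  by (simp add: mat_op_def blinfun_lin cinner_sum_right sform_def cinner_single_right)

definition finite_vec :: "'i set \<Rightarrow> ('i \<Rightarrow> 'k::complex_hilbert_space) \<Rightarrow> ('i, 'k) ell2" where
  "finite_vec I x = (\<Sum>i\<in>I. ell2_single i (x i))"

lemma coord_finite_vec: "finite I \<Longrightarrow> ell2_coord i (finite_vec I x) = (if i \<in> I then x i else 0)"
  by (simp add: finite_vec_def blinfun_lin coord_single)

lemma norm_finite_vec: assumes "finite I" shows "norm (finite_vec I x) = sqrt (sqn I x)"
proof -
  have "cinner (finite_vec I x) (finite_vec I x) = (\<Sum>i\<in>I. cinner (ell2_coord i (finite_vec I x)) (x i))"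
    by (subst (2) finite_vec_def) (simp add: cinner_sum_right cinner_single_right)
  also have "\<dots> = complex_of_real (sqn I x)"
    by (simp add: coord_finite_vec assms cinner_same sqn_def)
  finally have "(norm (finite_vec I x))\<^sup>2 = sqn I x"
    unfolding cinner_same of_real_eq_iff .
  then show ?thesis by (metis norm_ge_zero real_sqrt_abs abs_of_nonneg)
qed

lemma sform_coord_finite_vec:
  "finite I \<Longrightarrow> sform I I m (\<lambda>i. ell2_coord i (finite_vec I x)) (\<lambda>i. ell2_coord i (finite_vec I y)) = sform I I m x y"
  by (intro sform_cong) (simp add: coord_finite_vec)

lemma norm_mat_op_le:
  assumes I: "finite I" and c: "0 \<le> c"
  shows "norm (mat_op I m) \<le> c \<longleftrightarrow> mbound I m c"
proof
  assume n: "norm (mat_op I m) \<le> c"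
  show "mbound I m c"
    unfolding mbound_def
  proof (intro allI)
    fix x y
    have "cmod (sform I I m x y) = cmod (cinner (finite_vec I x) (mat_op I m (finite_vec I y)))"
      by (simp add: cinner_mat_op sform_coord_finite_vec I)
    also have "\<dots> \<le> norm (finite_vec I x) * (norm (mat_op I m) * norm (finite_vec I y))"
      by (intro order_trans [OF cmod_cinner_le_norm] mult_left_mono norm_blinfun) auto
    also have "\<dots> \<le> norm (finite_vec I x) * (c * norm (finite_vec I y))"
      using n by (intro mult_left_mono mult_right_mono) auto
    finally show "cmod (sform I I m x y) \<le> c * sqrt (sqn I x) * sqrt (sqn I y)"
      by (simp add: norm_finite_vec I mult_ac)
  qed
next
  assume b: "mbound I m c"
  have sq: "sqrt (sqn I (\<lambda>i. ell2_coord i x)) \<le> norm x" for x :: "('a, 'b) ell2"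
    using ell2_sum_le_norm [OF I, of x] by (intro real_le_lsqrt) (auto simp: sqn_def ell2_coord.rep_eq)
  show "norm (mat_op I m) \<le> c"
  proof (rule norm_blinfun_bound [OF c], rule norm_le_cinnerI)
    fix x y
    have "cmod (cinner y (mat_op I m x)) \<le> c * sqrt (sqn I (\<lambda>i. ell2_coord i y)) * sqrt (sqn I (\<lambda>i. ell2_coord i x))"
      using b by (simp add: cinner_mat_op mbound_def)
    also have "\<dots> \<le> c * norm y * norm x"
      using c by (intro mult_mono sq) (auto simp: sqn_nonneg)
    finally show "cmod (cinner y (mat_op I m x)) \<le> c * norm x * norm y" by (simp add: mult_ac)
  qed (use c in simp)
qed

lemma sum_Times: "(\<Sum>z\<in>J \<times> I. f z) = (\<Sum>i\<in>J. \<Sum>p\<in>I. f (i, p))"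
  by (simp add: sum.cartesian_product split_def)

text \<open>
  A matrix whose entries are themselves matrix operators has the same form as the matrix over the
product of the index sets; this and the next lemma translate vectors in both directions.
\<close>

lemma sform_nest:
  "sform J J (\<lambda>i j. mat_op I (b i j)) x y = sform (J \<times> I) (J \<times> I) (\<lambda>(i, p) (j, q). b i j p q)
    (\<lambda>(i, p). ell2_coord p (x i)) (\<lambda>(i, p). ell2_coord p (y i))"
proof -
  have "sform J J (\<lambda>i j. mat_op I (b i j)) x y =
    (\<Sum>i\<in>J. \<Sum>j\<in>J. \<Sum>p\<in>I. \<Sum>q\<in>I. cinner (ell2_coord p (x i)) (b i j p q (ell2_coord q (y j))))"
    by (subst sform_def) (simp add: cinner_mat_op sform_def)
  also have "\<dots> = (\<Sum>i\<in>J. \<Sum>p\<in>I. \<Sum>j\<in>J. \<Sum>q\<in>I. cinner (ell2_coord p (x i)) (b i j p q (ell2_coord q (y j))))"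
    by (intro sum.cong refl sum.swap)
  finally show ?thesis
    by (simp add: sform_def [of "J \<times> I"] sum_Times)
qed

lemma sform_nest_finite_vec:
  assumes "finite I"
  shows "sform (J \<times> I) (J \<times> I) (\<lambda>(i, p) (j, q). b i j p q) x y =
    sform J J (\<lambda>i j. mat_op I (b i j)) (\<lambda>i. finite_vec I (\<lambda>p. x (i, p))) (\<lambda>i. finite_vec I (\<lambda>p. y (i, p)))"
  unfolding sform_nest by (intro sform_cong) (auto simp: coord_finite_vec assms)

lemma mpos_nest:
  assumes "finite I"
  shows "mpos J (\<lambda>i j. mat_op I (b i j)) \<longleftrightarrow> mpos (J \<times> I) (\<lambda>(i, p) (j, q). b i j p q)"
proof
  show "mpos (J \<times> I) (\<lambda>(i, p) (j, q). b i j p q)" if "mpos J (\<lambda>i j. mat_op I (b i j))"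
    using that unfolding mpos_def sform_nest_finite_vec [OF assms] by blast
  show "mpos J (\<lambda>i j. mat_op I (b i j))" if "mpos (J \<times> I) (\<lambda>(i, p) (j, q). b i j p q)"
    using that unfolding mpos_def sform_nest by blast
qed

lemma mbound_nest:
  assumes I: "finite I" and J: "finite J" and c: "0 \<le> c"
  shows "mbound (J \<times> I) (\<lambda>(i, p) (j, q). b i j p q) c \<longleftrightarrow> mbound J (\<lambda>i j. mat_op I (b i j)) c"
proof
  have sq: "sqn J (\<lambda>i. finite_vec I (\<lambda>p. x (i, p))) = sqn (J \<times> I) x" for x :: "'b \<times> 'a \<Rightarrow> 'c"
    by (simp add: sqn_def [of J] norm_finite_vec I sqn_nonneg) (simp add: sqn_def sum_Times)
  show "mbound (J \<times> I) (\<lambda>(i, p) (j, q). b i j p q) c" if *: "mbound J (\<lambda>i j. mat_op I (b i j)) c"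
    unfolding mbound_def sform_nest_finite_vec [OF I]
    using * unfolding mbound_def by (simp add: sq [symmetric])
  have sq': "sqn (J \<times> I) (\<lambda>(i, p). ell2_coord p (x i)) \<le> sqn J x" for x :: "'b \<Rightarrow> ('a, 'c) ell2"
    unfolding sqn_def sum_Times by (auto intro!: sum_mono ell2_sum_le_norm I simp: ell2_coord.rep_eq)
  show "mbound J (\<lambda>i j. mat_op I (b i j)) c" if *: "mbound (J \<times> I) (\<lambda>(i, p) (j, q). b i j p q) c"
    unfolding mbound_def
  proof (intro allI)
    fix x y
    have "cmod (sform J J (\<lambda>i j. mat_op I (b i j)) x y)
      \<le> c * sqrt (sqn (J \<times> I) (\<lambda>(i, p). ell2_coord p (x i))) * sqrt (sqn (J \<times> I) (\<lambda>(i, p). ell2_coord p (y i)))"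
      using * unfolding mbound_def sform_nest by blast
    also have "\<dots> \<le> c * sqrt (sqn J x) * sqrt (sqn J y)"
      using c by (intro mult_mono real_sqrt_le_mono sq') (auto simp: sqn_nonneg)
    finally show "cmod (sform J J (\<lambda>i j. mat_op I (b i j)) x y) \<le> c * sqrt (sqn J x) * sqrt (sqn J y)" .
  qed
qed

subsection \<open>Block matrices\<close>

text \<open>
  Finite-dimensional algebras and their summands are treated uniformly: \<open>R\<close> says that two
indices belong to the same matrix block.  As a partial equivalence relation on \<open>I\<close> it may be restricted to the
indices of a summand, while the ambient index set stays the same.
\<close>

definition block_rel :: "'i set \<Rightarrow> ('i \<Rightarrow> 'i \<Rightarrow> bool) \<Rightarrow> bool" where
  "block_rel I R \<longleftrightarrow> finite I \<and> (\<forall>p q. R p q \<longrightarrow> p \<in> I \<and> q \<in> I \<and> R q p) \<and>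
     (\<forall>p q r. R p q \<longrightarrow> R q r \<longrightarrow> R p r)"

lemma block_relD:
  assumes "block_rel I R"
  shows "finite I" "R p q \<Longrightarrow> p \<in> I" "R p q \<Longrightarrow> q \<in> I" "R p q \<Longrightarrow> R q p"
    "R p q \<Longrightarrow> R q r \<Longrightarrow> R p r"
  using assms unfolding block_rel_def by blast+

definition block_ops :: "('i \<Rightarrow> 'i \<Rightarrow> bool) \<Rightarrow> 'k::complex_hilbert_space op set \<Rightarrow> ('i, 'k) ell2 op set" where
  "block_ops R B = {T \<in> bounded_ops. \<forall>p q. entry T p q \<in> B \<and> (\<not> R p q \<longrightarrow> entry T p q = 0)}"

lemma block_opsD:
  assumes "T \<in> block_ops R B"
  shows "T \<in> bounded_ops" "entry T p q \<in> B" "\<not> R p q \<Longrightarrow> entry T p q = 0"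
  using assms by (auto simp: block_ops_def)

lemma mat_op_entry_block:
  assumes "T \<in> block_ops R B" "block_rel I R"
  shows "mat_op I (entry T) = T"
  using block_opsD [OF assms(1)] block_relD(1-3) [OF assms(2)] by (intro mat_op_entry) blast+

lemma mat_op_block:
  assumes R: "block_rel I R" and B: "cstar_algebra B"
    and m: "\<And>p q. R p q \<Longrightarrow> m p q \<in> B" "\<And>p q. \<not> R p q \<Longrightarrow> m p q = 0"
  shows "mat_op I m \<in> block_ops R B"
proof -
  have mB: "m p q \<in> B" for p q using m [of p q] cstar_algebraD(2) [OF B] by (cases "R p q") auto
  moreover have "finite I" using R by (simp add: block_rel_def)
  ultimately show ?thesis
    using m(2) cstar_algebraD(1,2) [OF B]
    unfolding block_ops_def by (auto simp: entry_mat_op intro!: mat_op_bounded)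
qed

lemma entry_compose:
  assumes T: "T \<in> block_ops R B" and R: "block_rel I R"
  shows "entry (S o\<^sub>L T) p q = (\<Sum>m\<in>I. entry S p m o\<^sub>L entry T m q)"
proof (rule blinfun_eqI)
  have I: "finite I" using R by (simp add: block_rel_def)
  fix v
  have "T (ell2_single q v) = (\<Sum>m\<in>I. ell2_single m (entry T m q v))"
  proof (rule ell2_coord_eqI)
    fix i
    have "ell2_coord i (T (ell2_single q v)) = entry T i q v" by (simp add: entry_apply)
    also have "\<dots> = (if i \<in> I then entry T i q v else 0)"
      using block_opsD(3) [OF T, of i q] block_relD(2) [OF R, of i q] by (cases "R i q") auto
    finally show "ell2_coord i (T (ell2_single q v)) = ell2_coord i (\<Sum>m\<in>I. ell2_single m (entry T m q v))"
      by (simp add: blinfun_lin coord_single I)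
  qed
  then show "entry (S o\<^sub>L T) p q v = (\<Sum>m\<in>I. entry S p m o\<^sub>L entry T m q) v"
    by (simp add: entry_apply [of "S o\<^sub>L T"] entry_apply [of S] blinfun_lin)
qed

lemma adj_zero [simp]: "adj 0 = 0"
  by (rule adj_eqI) simp

lemma cstar_block_ops:
  assumes R: "block_rel I R" and B: "cstar_algebra B"
  shows "cstar_algebra (block_ops R B)"
  unfolding cstar_algebra_def
proof (intro conjI ballI allI)
  show "block_ops R B \<subseteq> bounded_ops" by (auto simp: block_ops_def)
  show "0 \<in> block_ops R B" using cstar_algebraD(2) [OF B] by (simp add: block_ops_def)
  have "bounded_ops = (\<Inter>c. \<Inter>x. {T :: ('a, 'b) ell2 op. T (c *\<^sub>C x) = c *\<^sub>C T x})"
    by (auto simp: bounded_ops_def)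
  moreover have "closed \<dots>"
    by (intro closed_INT ballI closed_Collect_eq continuous_intros
      bounded_linear.continuous_on [OF bounded_linear_scaleC])
  moreover have "block_ops R B = bounded_ops \<inter> (\<Inter>p. \<Inter>q. (\<lambda>T. entry T p q) -` (if R p q then B else {0}))"
  proof -
    have "entry T p q \<in> B \<and> (\<not> R p q \<longrightarrow> entry T p q = 0) \<longleftrightarrow> entry T p q \<in> (if R p q then B else {0})"
      for T :: "('a, 'b) ell2 op" and p q
      using cstar_algebraD(2) [OF B] by auto
    then show ?thesis unfolding block_ops_def by (simp add: set_eq_iff)
  qed
  moreover have "closed ((\<lambda>T. entry T p q) -` (if R p q then B else {0}))" for p q
    using cstar_algebraD(3) [OF B] by (intro closed_vimage continuous_entry) auto
  ultimately show "closed (block_ops R B)"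
    by (simp add: closed_Int closed_INT)
  fix S T assume S: "S \<in> block_ops R B" and T: "T \<in> block_ops R B"
  show "S + T \<in> block_ops R B"
    using S T by (auto simp: block_ops_def entry_add bounded_ops_add cstar_algebraD(4) [OF B])
  show "S o\<^sub>L T \<in> block_ops R B"
    unfolding block_ops_def mem_Collect_eq entry_compose [OF T R]
  proof (intro conjI allI impI)
    show "S o\<^sub>L T \<in> bounded_ops" using S T by (auto simp: block_ops_def bounded_ops_compose)
    show "(\<Sum>m\<in>I. entry S p m o\<^sub>L entry T m q) \<in> B" for p q
      using block_opsD(2) [OF S] block_opsD(2) [OF T]
      by (intro cstar_algebra_sum [OF B] cstar_algebraD(5) [OF B])
    fix p q assume n: "\<not> R p q"
    have "entry S p m o\<^sub>L entry T m q = 0" for m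
    proof -
      have "\<not> R p m \<or> \<not> R m q" using n block_relD(5) [OF R] by blast
      then have "entry S p m = 0 \<or> entry T m q = 0"
        using block_opsD(3) [OF S] block_opsD(3) [OF T] by blast
      then show ?thesis by auto
    qed
    then show "(\<Sum>m\<in>I. entry S p m o\<^sub>L entry T m q) = 0" by simp
  qed
next
  fix S assume S: "S \<in> block_ops R B"
  have "\<not> R p q \<Longrightarrow> \<not> R q p" for p q using block_relD(4) [OF R] by blast
  then show "adj S \<in> block_ops R B"
    using S cstar_algebraD(6) [OF B]
    by (auto simp: block_ops_def entry_adj adj_bounded_ops)
  show "op_scaleC c S \<in> block_ops R B" for c
    using S cstar_algebraD(7) [OF B]
    by (auto simp: block_ops_def entry_scaleC bounded_ops_scaleC intro!: blinfun_eqI)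
qed

lemma fd_tensor_block: "fd_tensor s B = block_ops (same_block s) B"
  by (simp add: fd_tensor_def block_ops_def)

lemma fd_summand_block: "fd_tensor_summand s i B = block_ops (\<lambda>p q. same_block s p q \<and> fst p = i) B"
  unfolding fd_tensor_summand_def fd_tensor_def block_ops_def by blast

lemma finite_indices: "finite (indices s)"
proof -
  have "indices s = (\<Union>i\<in>{..<length s}. \<Union>k\<in>{..<length (s ! i)}. (\<lambda>r. (i, k, r)) ` {..<s ! i ! k})"
    by (auto simp: indices_def)
  then show ?thesis by auto
qed

lemma block_rel_same_block: "block_rel (indices s) (same_block s)"
  unfolding block_rel_def same_block_def by (auto simp: finite_indices)

lemma block_rel_summand: "block_rel (indices s) (\<lambda>p q. same_block s p q \<and> fst p = i)"
  unfolding block_rel_def same_block_def by (auto simp: finite_indices)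

lemma cstar_bounded_ops: "cstar_algebra (bounded_ops :: 'a::complex_hilbert_space op set)"
proof -
  have "bounded_ops = (\<Inter>c. \<Inter>x. {T :: 'a op. T (c *\<^sub>C x) = c *\<^sub>C T x})"
    by (auto simp: bounded_ops_def)
  moreover have "closed \<dots>"
    by (intro closed_INT ballI closed_Collect_eq continuous_intros
      bounded_linear.continuous_on [OF bounded_linear_scaleC])
  ultimately show ?thesis
    by (auto simp: cstar_algebra_def bounded_ops_intros adj_bounded_ops)
qed

lemma cstar_fd_tensor: "cstar_algebra B \<Longrightarrow> cstar_algebra (fd_tensor s B)"
  unfolding fd_tensor_block by (rule cstar_block_ops [OF block_rel_same_block])

lemma fd_summand_subset: "fd_tensor_summand s i B \<subseteq> fd_tensor s B"
  by (auto simp: fd_tensor_summand_def)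

text \<open>
  The unit of the block algebra, acting as the projection onto the coordinates that belong to a block.
\<close>

definition block_unit :: "'i set \<Rightarrow> ('i \<Rightarrow> 'i \<Rightarrow> bool) \<Rightarrow> ('i, 'k::complex_hilbert_space) ell2 op" where
  "block_unit I R = mat_op I (\<lambda>p q. if p = q \<and> R p p then id_blinfun else 0)"

lemma block_unit:
  assumes R: "block_rel I R"
  shows "block_unit I R \<in> block_ops R bounded_ops"
    and "T \<in> block_ops R bounded_ops \<Longrightarrow> T o\<^sub>L block_unit I R = T"
    and "T \<in> block_ops R bounded_ops \<Longrightarrow> block_unit I R o\<^sub>L T = T"
proof -
  have I: "finite I" using R by (simp add: block_rel_def)
  have RI: "R p q \<Longrightarrow> p \<in> I \<and> q \<in> I \<and> R p p \<and> R q q" for p q using block_relD [OF R] by blast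
  show u: "block_unit I R \<in> block_ops R bounded_ops"
    unfolding block_unit_def by (intro mat_op_block [OF R cstar_bounded_ops]) auto
  have eu: "entry (block_unit I R) p q = (if p = q \<and> R p p then id_blinfun else 0)" for p q
    unfolding block_unit_def entry_mat_op [OF I] using RI by auto
  assume T: "T \<in> block_ops R bounded_ops"
  note C = cstar_block_ops [OF R cstar_bounded_ops]
  show "T o\<^sub>L block_unit I R = T"
  proof (rule op_eqI_entry)
    show "entry (T o\<^sub>L block_unit I R) p q = entry T p q" for p q
    proof -
      have "entry (T o\<^sub>L block_unit I R) p q = (\<Sum>m\<in>I. if m = q then (if R q q then entry T p q else 0) else 0)"
        unfolding entry_compose [OF u R] eu by (intro sum.cong refl) auto
      also have "\<dots> = entry T p q" using I RI block_opsD(3) [OF T, of p q] by (auto simp: sum.delta)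
      finally show ?thesis .
    qed
  qed (use T u in \<open>auto simp: block_ops_def intro: bounded_ops_compose\<close>)
  show "block_unit I R o\<^sub>L T = T"
  proof (rule op_eqI_entry)
    show "entry (block_unit I R o\<^sub>L T) p q = entry T p q" for p q
    proof -
      have "entry (block_unit I R o\<^sub>L T) p q = (\<Sum>m\<in>I. if m = p then (if R p p then entry T p q else 0) else 0)"
        unfolding entry_compose [OF T R] eu by (intro sum.cong refl) auto
      also have "\<dots> = entry T p q" using I RI block_opsD(3) [OF T, of p q] by (auto simp: sum.delta)
      finally show ?thesis .
    qed
  qed (use T u in \<open>auto simp: block_ops_def intro: bounded_ops_compose\<close>)
qed

section \<open>Order zero maps on finite-dimensional algebras\<close>

lemma compose_zero [simp]: "T o\<^sub>L 0 = 0" "0 o\<^sub>L T = (0 :: 'a::real_normed_vector \<Rightarrow>\<^sub>L 'b::real_normed_vector)"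
  by (auto intro!: blinfun_eqI simp: blinfun_lin)

lemma compose_diff_left: "(S - T) o\<^sub>L R = (S o\<^sub>L R) - (T o\<^sub>L R)"
  by (rule blinfun_eqI) (simp add: blinfun_lin)
lemma compose_diff_right: "R o\<^sub>L (S - T) = (R o\<^sub>L S) - (R o\<^sub>L T)"
  by (rule blinfun_eqI) (simp add: blinfun_lin)
lemma compose_add_left: "(S + T) o\<^sub>L R = (S o\<^sub>L R) + (T o\<^sub>L R)"
  by (rule blinfun_eqI) (simp add: blinfun_lin)
lemma compose_add_right: "R o\<^sub>L (S + T) = (R o\<^sub>L S) + (R o\<^sub>L T)"
  by (rule blinfun_eqI) (simp add: blinfun_lin)
lemma compose_sum_right: "R o\<^sub>L sum f I = (\<Sum>i\<in>I. R o\<^sub>L f i)"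
  by (rule blinfun_eqI) (simp add: blinfun_lin)
lemma compose_scaleC_left: "op_scaleC c S o\<^sub>L R = op_scaleC c (S o\<^sub>L R)"
  by (rule blinfun_eqI) simp
lemma compose_scaleC_right: "R \<in> bounded_ops \<Longrightarrow> R o\<^sub>L op_scaleC c S = op_scaleC c (R o\<^sub>L S)"
  by (rule blinfun_eqI) (simp add: bounded_opsD)

definition alg_unit :: "'h::complex_hilbert_space op set \<Rightarrow> 'h op \<Rightarrow> bool" where
  "alg_unit F u \<longleftrightarrow> u \<in> F \<and> (\<forall>a\<in>F. a o\<^sub>L u = a \<and> u o\<^sub>L a = a)"

lemma alg_unit_adj:
  assumes F: "cstar_algebra F" and u: "alg_unit F u"
  shows "adj u = u"
proof -
  have ub: "u \<in> bounded_ops" and uF: "u \<in> F"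
    using u cstar_algebraD(1) [OF F] by (auto simp: alg_unit_def)
  have 1: "adj u o\<^sub>L u = adj u" using u cstar_algebraD(6) [OF F] by (auto simp: alg_unit_def)
  have "adj (adj u o\<^sub>L u) = adj u o\<^sub>L u"
    by (simp add: adj_compose adj_adj ub adj_bounded_ops)
  then show ?thesis using 1 by (simp add: adj_adj ub)
qed

lemma alg_unit_pos:
  assumes F: "cstar_algebra F" and u: "alg_unit F u"
  shows "op_pos u"
proof -
  have "op_pos (adj u o\<^sub>L u)" using u cstar_algebraD(1) [OF F]
    by (intro op_pos_adj_compose) (auto simp: alg_unit_def)
  then show ?thesis using u alg_unit_adj [OF F u] by (simp add: alg_unit_def)
qed

lemma cinner_expand_square:
  "cinner (x + y) (x + y) = cinner x x + cinner x y + cinner y x + cinner y y"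
  by (simp add: cinner_add_left cinner_add_right)

text \<open>
  The Schwarz inequalities \<open>\<phi>(a)\<^sup>* \<phi>(a) \<le> \<parallel>\<phi>(1)\<parallel> \<phi>(a\<^sup>* a)\<close> and its mirror image, in the form of Cauchy-Schwarz
estimates.  They come from the positive block matrices \<open>[1, a; a\<^sup>*, a\<^sup>* a]\<close> and \<open>[a a\<^sup>*, a; a\<^sup>*, 1]\<close>,
whose forms at \<open>(x, y)\<close> are \<open>\<parallel>1 x + a y\<parallel>\<^sup>2\<close> and \<open>\<parallel>a\<^sup>* x + 1 y\<parallel>\<^sup>2\<close> for the projection \<open>1\<close>.
\<close>

lemma unital_schwarz:
  assumes F: "cstar_algebra F" and u: "alg_unit F u"
    and cp: "completely_positive F A \<phi>" "A \<subseteq> bounded_ops" and a: "a \<in> F"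
  shows "(cmod (cinner x (\<phi> a y)))\<^sup>2 \<le> Re (cinner x (\<phi> u x)) * Re (cinner y (\<phi> (adj a o\<^sub>L a) y))"
    and "(cmod (cinner x (\<phi> a y)))\<^sup>2 \<le> Re (cinner x (\<phi> (a o\<^sub>L adj a) x)) * Re (cinner y (\<phi> u y))"
proof -
  have ab: "a \<in> bounded_ops" and ad: "adj a \<in> F" and ub: "u \<in> bounded_ops" and uF: "u \<in> F"
    using u a cstar_algebraD(1,6) [OF F] by (auto simp: alg_unit_def)
  have au: "a (u x) = a x" "u (a x) = a x" "u (u x) = u x" for x
    using u a uF unfolding alg_unit_def by (metis blinfun_apply_blinfun_compose)+
  have us: "cinner x (u y) = cinner (u x) y" for x y
    using op_pos_cinner_commute [OF alg_unit_pos [OF F u]] .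
  have aa: "adj a o\<^sub>L a \<in> F" "a o\<^sub>L adj a \<in> F" using a ad by (auto intro: cstar_algebraD(5) [OF F])
  have 1: "cinner x (u x) + cinner x (a y) + cinner y (adj a x) + cinner y (adj a (a y)) \<in> \<real>\<^sub>\<ge>\<^sub>0" for x y
  proof -
    have "cinner x (u x) = cinner (u x) (u x)" by (metis us au(3))
    moreover have "cinner x (a y) = cinner (u x) (a y)" by (metis us au(2))
    moreover have "cinner y (adj a x) = cinner (a y) (u x)" by (metis us au(2) cinner_adj_right ab)
    ultimately have "cinner x (u x) + cinner x (a y) + cinner y (adj a x) + cinner y (adj a (a y))
      = cinner (u x + a y) (u x + a y)" by (simp only: cinner_expand_square cinner_adj_right [OF ab])
    then show ?thesis by (simp add: cinner_same complex_nonneg_Reals_iff flip: of_real_power)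
  qed
  have 2: "cinner x (a (adj a x)) + cinner x (a y) + cinner y (adj a x) + cinner y (u y) \<in> \<real>\<^sub>\<ge>\<^sub>0" for x y
  proof -
    have "cinner y (u y) = cinner (u y) (u y)" by (metis us au(3))
    moreover have "cinner x (a y) = cinner (adj a x) (u y)" by (metis au(1) cinner_adj_left ab)
    moreover have "cinner y (adj a x) = cinner (u y) (adj a x)" by (metis au(1) cinner_adj_right ab)
    moreover have "cinner x (a (adj a x)) = cinner (adj a x) (adj a x)" by (simp add: cinner_adj_left ab)
    ultimately have "cinner x (a (adj a x)) + cinner x (a y) + cinner y (adj a x) + cinner y (u y)
      = cinner (adj a x + u y) (adj a x + u y)" by (simp only: cinner_expand_square)
    then show ?thesis by (simp add: cinner_same complex_nonneg_Reals_iff flip: of_real_power)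
  qed
  show "(cmod (cinner x (\<phi> a y)))\<^sup>2 \<le> Re (cinner x (\<phi> u x)) * Re (cinner y (\<phi> (adj a o\<^sub>L a) y))"
    using cp_block_cauchy_schwarz [OF cp, of "{()}" "{()}" "\<lambda>_ _. u" "\<lambda>_ _. a" "\<lambda>_ _. adj a"
        "\<lambda>_ _. adj a o\<^sub>L a" "\<lambda>_. x" "\<lambda>_. y"] 1 uF a ad aa by (simp add: sform_def)
  show "(cmod (cinner x (\<phi> a y)))\<^sup>2 \<le> Re (cinner x (\<phi> (a o\<^sub>L adj a) x)) * Re (cinner y (\<phi> u y))"
    using cp_block_cauchy_schwarz [OF cp, of "{()}" "{()}" "\<lambda>_ _. a o\<^sub>L adj a" "\<lambda>_ _. a" "\<lambda>_ _. adj a"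
        "\<lambda>_ _. u" "\<lambda>_. x" "\<lambda>_. y"] 2 uF a ad aa by (simp add: sform_def)
qed

lemma cinner_zeroI: "(\<And>y. cinner y x = 0) \<Longrightarrow> x = 0"
  by (metis cinner_same norm_eq_zero of_real_eq_0_iff power_eq_0_iff)

text \<open>
  If \<open>S T = 0\<close>, the positive elements \<open>S\<^sup>* S\<close> and \<open>T T\<^sup>*\<close> are orthogonal, hence so are their images.
The first Schwarz inequality replaces \<open>\<phi> (S\<^sup>* S)\<close> by \<open>\<phi> S\<close>, the second replaces \<open>\<phi> (T T\<^sup>*)\<close> by \<open>\<phi> T\<close>.
\<close>

lemma order_zero_disjoint:
  assumes F: "cstar_algebra F" and u: "alg_unit F u"
    and oz: "order_zero F A \<phi>" and A: "A \<subseteq> bounded_ops" and S: "S \<in> F" and T: "T \<in> F"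
    and ST: "S o\<^sub>L T = 0"
  shows "\<phi> S o\<^sub>L \<phi> T = 0"
proof -
  have cp: "completely_positive F A \<phi>" using oz by (simp add: order_zero_def)
  have b: "S \<in> bounded_ops" "T \<in> bounded_ops" using S T cstar_algebraD(1) [OF F] by auto
  have ad: "adj S \<in> F" "adj T \<in> F" using S T cstar_algebraD(6) [OF F] by auto
  have mem: "adj S o\<^sub>L S \<in> F" "T o\<^sub>L adj T \<in> F" using S T ad by (auto intro: cstar_algebraD(5) [OF F])
  have "(adj S o\<^sub>L S) o\<^sub>L (T o\<^sub>L adj T) = adj S o\<^sub>L (S o\<^sub>L T) o\<^sub>L adj T"
    by (rule blinfun_eqI) simp
  then have "(adj S o\<^sub>L S) o\<^sub>L (T o\<^sub>L adj T) = 0" by (simp add: ST)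
  then have 0: "\<phi> (adj S o\<^sub>L S) o\<^sub>L \<phi> (T o\<^sub>L adj T) = 0"
    using oz mem op_pos_adj_compose [OF b(1)] op_pos_compose_adj [OF b(2)]
    unfolding order_zero_def by blast
  have 1: "\<phi> S (\<phi> (T o\<^sub>L adj T) z) = 0" for z
  proof (rule cinner_zeroI)
    fix x
    have "\<phi> (adj S o\<^sub>L S) (\<phi> (T o\<^sub>L adj T) z) = 0"
      using arg_cong [OF 0, of "\<lambda>R. R z"] by simp
    then show "cinner x (\<phi> S (\<phi> (T o\<^sub>L adj T) z)) = 0"
      using unital_schwarz(1) [OF F u cp A S, of x "\<phi> (T o\<^sub>L adj T) z"] by simp
  qed
  have \<phi>S: "\<phi> S \<in> bounded_ops" using completely_positiveD(1) [OF cp S] A by blast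
  show ?thesis
  proof (rule blinfun_eqI, simp, rule cinner_zeroI)
    fix y x
    have "cinner (adj (\<phi> S) x) (\<phi> (T o\<^sub>L adj T) (adj (\<phi> S) x)) = 0"
      by (simp add: cinner_adj_left \<phi>S 1)
    then have "cinner (adj (\<phi> S) x) (\<phi> T y) = 0"
      using unital_schwarz(2) [OF F u cp A T, of "adj (\<phi> S) x" y] by simp
    then show "cinner x (\<phi> S (\<phi> T y)) = 0" by (simp add: cinner_adj_left \<phi>S)
  qed
qed

lemma matrix_term_compose:
  "(ell2_single p o\<^sub>L a o\<^sub>L ell2_coord q) o\<^sub>L (ell2_single p' o\<^sub>L b o\<^sub>L ell2_coord q')
    = (if q = p' then ell2_single p o\<^sub>L (a o\<^sub>L b) o\<^sub>L ell2_coord q' else 0)"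
  by (rule blinfun_eqI) (simp add: coord_single blinfun_lin)

lemma matrix_term_block:
  assumes "R p q" "a \<in> B" "cstar_algebra B"
  shows "ell2_single p o\<^sub>L a o\<^sub>L ell2_coord q \<in> block_ops R B"
  using assms cstar_algebraD(1,2) [OF assms(3)]
  by (auto simp: block_ops_def entry_single_coord intro: single_coord_bounded)

lemma bounded_ops_complex:
  fixes T :: "complex op" assumes "T \<in> bounded_ops"
  shows "T = op_scaleC (T 1) id_blinfun"
proof (rule blinfun_eqI)
  fix x :: complex
  have "T (x *\<^sub>C 1) = x *\<^sub>C T 1" using assms by (rule bounded_opsD)
  then show "T x = op_scaleC (T 1) id_blinfun x" by (simp add: scaleC_complex_def mult.commute)
qed

text \<open>
  The bilinear map \<open>(a, d) \<mapsto> \<phi> a \<phi> d\<close> vanishes on pairs with \<open>a d = 0\<close>.  The elements that can be moved from one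
argument to the other form a linear space \<open>G\<close>.  It contains every idempotent, and the idempotents span:
an off-diagonal matrix unit is the difference of the idempotents \<open>E\<^sub>p\<^sub>p + E\<^sub>p\<^sub>q\<close> and \<open>E\<^sub>p\<^sub>p\<close>.
\<close>

lemma order_zero_mult:
  fixes \<phi> :: "('i, complex) ell2 op \<Rightarrow> 'h::complex_hilbert_space op"
  assumes R: "block_rel I R" and oz: "order_zero (block_ops R bounded_ops) A \<phi>" and A: "A \<subseteq> bounded_ops"
    and S: "S \<in> block_ops R bounded_ops" and T: "T \<in> block_ops R bounded_ops"
  shows "\<phi> S o\<^sub>L \<phi> T = \<phi> (block_unit I R) o\<^sub>L \<phi> (S o\<^sub>L T)"
proof -
  define F :: "('i, complex) ell2 op set" where "F = block_ops R bounded_ops"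
  define u :: "('i, complex) ell2 op" where "u = block_unit I R"
  have F: "cstar_algebra F" unfolding F_def by (rule cstar_block_ops [OF R cstar_bounded_ops])
  have u: "alg_unit F u" using block_unit [OF R] by (auto simp: alg_unit_def F_def u_def)
  have cp: "completely_positive F A \<phi>" using oz by (simp add: order_zero_def F_def)
  have oz: "order_zero F A \<phi>" using oz by (simp add: F_def)
  note Fc = cstar_algebraD(5,10,4,7) [OF F]
  have b: "\<phi> a \<in> bounded_ops" if "a \<in> F" for a using completely_positiveD(1) [OF cp that] A by blast
  have diff: "\<phi> (a - c) = \<phi> a - \<phi> c" if "a \<in> F" "c \<in> F" for a c
    by (rule cp_diff [OF cp that cstar_algebraD(9) [OF F that(2)]])
  define G where "G = {c \<in> F. \<forall>a\<in>F. \<forall>d\<in>F. \<phi> (a o\<^sub>L c) o\<^sub>L \<phi> d = \<phi> a o\<^sub>L \<phi> (c o\<^sub>L d)}"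
  have idem: "e \<in> G" if e: "e \<in> F" "e o\<^sub>L e = e" for e
  proof -
    have "\<phi> (a o\<^sub>L e) o\<^sub>L \<phi> d = \<phi> a o\<^sub>L \<phi> (e o\<^sub>L d)" if ad: "a \<in> F" "d \<in> F" for a d
    proof -
      have m: "a o\<^sub>L e \<in> F" "e o\<^sub>L d \<in> F" using e ad by (auto intro: Fc)
      have ee: "e (e x) = e x" for x using arg_cong [OF e(2), of "\<lambda>T. T x"] by simp
      have "(a o\<^sub>L e) o\<^sub>L (d - (e o\<^sub>L d)) = 0" "(a - (a o\<^sub>L e)) o\<^sub>L (e o\<^sub>L d) = 0"
        by (auto intro!: blinfun_eqI simp: blinfun_lin ee)
      then have "\<phi> (a o\<^sub>L e) o\<^sub>L \<phi> (d - (e o\<^sub>L d)) = 0" "\<phi> (a - (a o\<^sub>L e)) o\<^sub>L \<phi> (e o\<^sub>L d) = 0"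
        using m ad by (auto intro!: order_zero_disjoint [OF F u oz A] Fc(2))
      then show ?thesis using m ad by (simp add: diff compose_diff_left compose_diff_right)
    qed
    then show ?thesis using e by (simp add: G_def)
  qed
  have G_diff: "c - c' \<in> G" if "c \<in> G" "c' \<in> G" for c c'
    using that by (auto simp: G_def compose_diff_left compose_diff_right diff Fc)
  have G_add: "c + c' \<in> G" if "c \<in> G" "c' \<in> G" for c c'
    using that
    by (auto simp: G_def compose_add_left compose_add_right completely_positiveD(2) [OF cp] Fc)
  have G_scale: "op_scaleC z c \<in> G" if "c \<in> G" for c z
    using that cstar_algebraD(1) [OF F]
    by (auto simp: G_def compose_scaleC_left compose_scaleC_right completely_positiveD(3) [OF cp] Fc b)
  have G_zero: "0 \<in> G" by (rule idem) (use cstar_algebraD(2) [OF F] in auto)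
  have G_sum: "sum f J \<in> G" if "\<And>j. j \<in> J \<Longrightarrow> f j \<in> G" for f and J :: "'i set"
    using that by (induction J rule: infinite_finite_induct) (auto intro: G_zero G_add)
  define E where "E p q c = ell2_single p o\<^sub>L c o\<^sub>L ell2_coord q" for p q :: 'i and c :: "complex op"
  have EF: "E p q c \<in> F" if "R p q" "c \<in> bounded_ops" for p q c
    unfolding E_def F_def by (rule matrix_term_block [where R = R, OF that cstar_bounded_ops])
  have E_compose: "E p q c o\<^sub>L E p' q' c' = (if q = p' then E p q' (c o\<^sub>L c') else 0)" for p q p' q' c c'
    unfolding E_def by (rule matrix_term_compose)
  have Epp: "E p p id_blinfun \<in> G" if "R p p" for p
    by (rule idem [OF EF [OF that]]) (simp_all add: E_compose)
  have EG: "E p q (entry S p q) \<in> G" for p q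
  proof (cases "R p q")
    case True
    have Rpp: "R p p" using True block_relD(4,5) [OF R] by blast
    have c: "entry S p q \<in> bounded_ops" using block_opsD(2) [OF S] .
    show ?thesis
    proof (cases "p = q")
      case True
      have "E p q (entry S p q) = op_scaleC (entry S p q 1) (E p p id_blinfun)"
        unfolding True [symmetric] E_def
        by (subst bounded_ops_complex [OF c [folded True]], rule blinfun_eqI)
          (simp add: single_scaleC)
      then show ?thesis using G_scale [OF Epp [OF Rpp]] by simp
    next
      case False
      have "E p p id_blinfun + E p q (entry S p q) \<in> G"
      proof (rule idem)
        show "E p p id_blinfun + E p q (entry S p q) \<in> F"
          by (intro Fc EF Rpp \<open>R p q\<close> c bounded_ops_id)
        show "(E p p id_blinfun + E p q (entry S p q)) o\<^sub>L (E p p id_blinfun + E p q (entry S p q))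
          = E p p id_blinfun + E p q (entry S p q)"
          using False by (simp add: compose_add_left compose_add_right E_compose)
      qed
      from G_diff [OF this Epp [OF Rpp]] show ?thesis by simp
    qed
  next
    case False
    then show ?thesis using block_opsD(3) [OF S] G_zero by (simp add: E_def)
  qed
  have "S = (\<Sum>p\<in>I. \<Sum>q\<in>I. E p q (entry S p q))"
    using mat_op_entry_block [OF S R] by (simp add: mat_op_def E_def)
  also have "\<dots> \<in> G" by (intro G_sum EG)
  finally have "S \<in> G" .
  moreover have "u \<in> F" "T \<in> F" "u o\<^sub>L S = S" using u S T by (auto simp: alg_unit_def F_def)
  ultimately show ?thesis unfolding G_def u_def [symmetric] by force
qed

section \<open>Tensor products of block algebras\<close>

lemma cp_compose:
  assumes "completely_positive A B \<phi>" "completely_positive B C \<theta>"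
  shows "completely_positive A C (\<lambda>a. \<theta> (\<phi> a))"
  using assms unfolding completely_positive_def linear_on_alg_def image_subset_iff by simp

lemma mat_op_add: "mat_op I (\<lambda>p q. m p q + m' p q) = mat_op I m + mat_op I m'"
  by (rule blinfun_eqI) (simp add: mat_op_def blinfun_lin sum.distrib)

lemma scaleC_sum: "c *\<^sub>C sum f I = (\<Sum>i\<in>I. c *\<^sub>C (f i :: 'a::complex_hilbert_space))"
  by (induction I rule: infinite_finite_induct) (auto simp: scaleC_add_right)

lemma mat_op_scaleC:
  "mat_op I (\<lambda>p q. op_scaleC c (m p q)) = op_scaleC c (mat_op I m)"
  by (rule blinfun_eqI) (simp add: mat_op_def blinfun_lin single_scaleC scaleC_sum)

lemma mat_op_cong:
  "(\<And>p q. p \<in> I \<Longrightarrow> q \<in> I \<Longrightarrow> m p q = m' p q) \<Longrightarrow> mat_op I m = mat_op I m'"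
  unfolding mat_op_def by (intro sum.cong refl) simp

lemma mbound_cong:
  assumes "\<And>i j. i \<in> I \<Longrightarrow> j \<in> I \<Longrightarrow> a i j = b i j"
  shows "mbound I a c \<longleftrightarrow> mbound I b c"
proof -
  have "sform I I a x y = sform I I b x y" for x y
    by (intro sform_cong) (simp add: assms)
  then show ?thesis by (simp add: mbound_def)
qed

text \<open>
  An index set \<open>K\<close> identified by \<open>\<sigma>\<close> with \<open>I \<times> J\<close> so that the blocks over \<open>K\<close> are the products of the blocks
over \<open>I\<close> and \<open>J\<close>.  The block algebra over \<open>K\<close> is then the tensor product of the other two.  Both the full
algebras and their summands are instances.
\<close>

locale block_product =
  fixes I :: "'i set" and J :: "'j set" and K :: "'l set" and \<sigma> :: "'i \<times> 'j \<Rightarrow> 'l"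
    and R :: "'i \<Rightarrow> 'i \<Rightarrow> bool" and S :: "'j \<Rightarrow> 'j \<Rightarrow> bool" and T :: "'l \<Rightarrow> 'l \<Rightarrow> bool"
  assumes R: "block_rel I R" and S: "block_rel J S" and T: "block_rel K T"
    and \<sigma>: "bij_betw \<sigma> (I \<times> J) K"
    and T_iff: "\<And>p q p' q'. p \<in> I \<Longrightarrow> q \<in> I \<Longrightarrow> p' \<in> J \<Longrightarrow> q' \<in> J \<Longrightarrow>
      T (\<sigma> (p, p')) (\<sigma> (q, q')) \<longleftrightarrow> R p q \<and> S p' q'"
begin

lemma finI: "finite I" and finJ: "finite J" and finK: "finite K"
  using R S T by (auto simp: block_rel_def)

definition left_index :: "'l \<Rightarrow> 'i" where "left_index m = fst (the_inv_into (I \<times> J) \<sigma> m)"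
definition right_index :: "'l \<Rightarrow> 'j" where "right_index m = snd (the_inv_into (I \<times> J) \<sigma> m)"

lemma index_\<sigma>: "p \<in> I \<Longrightarrow> p' \<in> J \<Longrightarrow> left_index (\<sigma> (p, p')) = p \<and> right_index (\<sigma> (p, p')) = p'"
  using \<sigma> by (simp add: left_index_def right_index_def bij_betw_def the_inv_into_f_f)

lemma \<sigma>_in: "p \<in> I \<Longrightarrow> p' \<in> J \<Longrightarrow> \<sigma> (p, p') \<in> K"
  using \<sigma> bij_betwE by fastforce

lemma K_cases:
  assumes "m \<in> K"
  obtains p p' where "p \<in> I" "p' \<in> J" "m = \<sigma> (p, p')"
  using assms \<sigma> by (force simp: bij_betw_def)

text \<open>
  An element of the algebra over \<open>K\<close> is an \<open>I \<times> I\<close> matrix with entries \<open>slice X p q\<close> in the algebra over \<open>J\<close>.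
In this picture \<open>collapse \<phi>\<close> and \<open>expand \<psi>\<close> are \<open>id \<otimes> \<phi>\<close> and \<open>id \<otimes> \<psi>\<close>.
\<close>

definition slice :: "('l, complex) ell2 op \<Rightarrow> 'i \<Rightarrow> 'i \<Rightarrow> ('j, complex) ell2 op" where
  "slice X p q = mat_op J (\<lambda>p' q'. entry X (\<sigma> (p, p')) (\<sigma> (q, q')))"

definition collapse :: "(('j, complex) ell2 op \<Rightarrow> 'k::complex_hilbert_space op) \<Rightarrow>
    ('l, complex) ell2 op \<Rightarrow> ('i, 'k) ell2 op" where
  "collapse \<phi> X = mat_op I (\<lambda>p q. \<phi> (slice X p q))"

definition expand :: "('k::complex_hilbert_space op \<Rightarrow> ('j, complex) ell2 op) \<Rightarrow>
    ('i, 'k) ell2 op \<Rightarrow> ('l, complex) ell2 op" where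
  "expand \<psi> Y = mat_op K (\<lambda>m m'. entry (\<psi> (entry Y (left_index m) (left_index m'))) (right_index m) (right_index m'))"

lemma entry_slice: "entry (slice X p q) p' q' =
    (if p' \<in> J \<and> q' \<in> J then entry X (\<sigma> (p, p')) (\<sigma> (q, q')) else 0)"
  unfolding slice_def by (rule entry_mat_op [OF finJ])

lemma slice_bounded: "X \<in> bounded_ops \<Longrightarrow> slice X p q \<in> bounded_ops"
  unfolding slice_def by (intro mat_op_bounded entry_bounded_ops)

lemma slice_block:
  assumes X: "X \<in> block_ops T bounded_ops" and p: "p \<in> I" "q \<in> I"
  shows "slice X p q \<in> block_ops S bounded_ops"
  unfolding block_ops_def mem_Collect_eq entry_slice
  using block_opsD [OF X] T_iff [OF p] slice_bounded [of X p q] by auto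

lemma slice_zero:
  assumes X: "X \<in> block_ops T bounded_ops" and p: "p \<in> I" "q \<in> I" "\<not> R p q"
  shows "slice X p q = 0"
proof (rule op_eqI_entry)
  show "entry (slice X p q) p' q' = entry 0 p' q'" for p' q'
    unfolding entry_slice using block_opsD(3) [OF X] T_iff [OF p(1,2)] p(3) by auto
qed (use slice_bounded block_opsD(1) [OF X] in auto)

lemma slice_add: "slice (X + Y) p q = slice X p q + slice Y p q"
  by (simp add: slice_def entry_add mat_op_add)

lemma slice_scaleC: "slice (op_scaleC c X) p q = op_scaleC c (slice X p q)"
  by (simp add: slice_def entry_scaleC mat_op_scaleC)

lemma collapse_block:
  assumes X: "X \<in> block_ops T bounded_ops" and cp: "completely_positive (block_ops S bounded_ops) B \<phi>"
    and B: "cstar_algebra B"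
  shows "collapse \<phi> X \<in> block_ops R B"
proof -
  have m: "\<phi> (slice X p q) \<in> B" if "p \<in> I" "q \<in> I" for p q
    using completely_positiveD(1) [OF cp slice_block [OF X that]] .
  have z: "\<phi> (slice X p q) = 0" if "p \<in> I" "q \<in> I" "\<not> R p q" for p q
    using slice_zero [OF X that] cp_zero [OF cp slice_block [OF X that(1,2)]] by simp
  have "collapse \<phi> X \<in> bounded_ops"
    unfolding collapse_def using m cstar_algebraD(1) [OF B] by (intro mat_op_bounded) auto
  then show ?thesis
    unfolding block_ops_def mem_Collect_eq collapse_def entry_mat_op [OF finI]
    using m z cstar_algebraD(2) [OF B] by auto
qed

lemma mpos_slice:
  assumes "\<And>i j. i \<in> N \<Longrightarrow> j \<in> N \<Longrightarrow> X i j \<in> block_ops T bounded_ops"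
  shows "mpos N X \<longleftrightarrow> mpos (N \<times> I) (\<lambda>(i, p) (j, q). slice (X i j) p q)"
proof -
  let ?h = "\<lambda>((i, p), p'). (i, \<sigma> (p, p'))"
  have h: "bij_betw ?h ((N \<times> I) \<times> J) (N \<times> K)"
  proof (rule bij_betw_byWitness [where f' = "\<lambda>(i, m). ((i, left_index m), right_index m)"])
    show "\<forall>a'\<in>N \<times> K. ?h ((\<lambda>(i, m). ((i, left_index m), right_index m)) a') = a'"
      by (auto elim!: K_cases simp: index_\<sigma>)
    show "(\<lambda>(i, m). ((i, left_index m), right_index m)) ` (N \<times> K) \<subseteq> (N \<times> I) \<times> J"
      by (auto elim!: K_cases simp: index_\<sigma>)
  qed (auto simp: index_\<sigma> \<sigma>_in)
  have "mpos N X \<longleftrightarrow> mpos N (\<lambda>i j. mat_op K (entry (X i j)))"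
    by (intro mpos_cong) (simp add: mat_op_entry_block [OF assms T])
  also have "\<dots> \<longleftrightarrow> mpos (N \<times> K) (\<lambda>(i, m) (j, m'). entry (X i j) m m')"
    by (rule mpos_nest [OF finK])
  also have "\<dots> \<longleftrightarrow> mpos ((N \<times> I) \<times> J) (\<lambda>x y. (\<lambda>(i, m) (j, m'). entry (X i j) m m') (?h x) (?h y))"
    by (rule mpos_reindex [OF h, symmetric])
  also have "\<dots> \<longleftrightarrow> mpos ((N \<times> I) \<times> J) (\<lambda>(x, p') (y, q').
      entry (X (fst x) (fst y)) (\<sigma> (snd x, p')) (\<sigma> (snd y, q')))"
    by (intro mpos_cong) auto
  also have "\<dots> \<longleftrightarrow> mpos (N \<times> I) (\<lambda>x y. mat_op J (\<lambda>p' q'.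
      entry (X (fst x) (fst y)) (\<sigma> (snd x, p')) (\<sigma> (snd y, q'))))"
    by (rule mpos_nest [OF finJ, symmetric])
  also have "\<dots> \<longleftrightarrow> mpos (N \<times> I) (\<lambda>(i, p) (j, q). slice (X i j) p q)"
    by (intro mpos_cong) (auto simp: slice_def)
  finally show ?thesis .
qed

lemma mbound_slice:
  assumes X: "X \<in> block_ops T bounded_ops" and c: "0 \<le> c"
  shows "norm X \<le> c \<longleftrightarrow> mbound I (slice X) c"
proof -
  have "norm X \<le> c \<longleftrightarrow> norm (mat_op K (entry X)) \<le> c"
    by (simp add: mat_op_entry_block [OF X T])
  also have "\<dots> \<longleftrightarrow> mbound K (entry X) c" by (rule norm_mat_op_le [OF finK c])
  also have "\<dots> \<longleftrightarrow> mbound (I \<times> J) (\<lambda>x y. entry X (\<sigma> x) (\<sigma> y)) c"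
    by (rule mbound_reindex [OF \<sigma>, symmetric])
  also have "\<dots> \<longleftrightarrow> mbound (I \<times> J) (\<lambda>(p, p') (q, q'). entry X (\<sigma> (p, p')) (\<sigma> (q, q'))) c"
    by (intro mbound_cong) auto
  also have "\<dots> \<longleftrightarrow> mbound I (slice X) c"
    unfolding slice_def by (rule mbound_nest [OF finJ finI c])
  finally show ?thesis .
qed

lemma mpos_entry:
  assumes "\<And>i j. i \<in> N \<Longrightarrow> j \<in> N \<Longrightarrow> Y i j \<in> block_ops R B"
  shows "mpos N Y \<longleftrightarrow> mpos (N \<times> I) (\<lambda>(i, p) (j, q). entry (Y i j) p q)"
  unfolding mpos_nest [OF finI, symmetric]
  by (intro mpos_cong) (simp add: mat_op_entry_block [OF assms R])

lemma cp_collapse: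
  assumes cp: "completely_positive (block_ops S bounded_ops) B \<phi>" and B: "cstar_algebra B"
  shows "completely_positive (block_ops T bounded_ops) (block_ops R B) (collapse \<phi>)"
  unfolding completely_positive_def linear_on_alg_def matrix_pos_iff_mpos
proof (intro conjI ballI allI impI)
  fix X Y :: "('l, complex) ell2 op" and c
  assume X: "X \<in> block_ops T bounded_ops"
  show "collapse \<phi> (op_scaleC c X) = op_scaleC c (collapse \<phi> X)"
    unfolding collapse_def mat_op_scaleC [symmetric] slice_scaleC
    by (intro mat_op_cong completely_positiveD(3) [OF cp] slice_block [OF X])
  assume Y: "Y \<in> block_ops T bounded_ops"
  show "collapse \<phi> (X + Y) = collapse \<phi> X + collapse \<phi> Y"
    unfolding collapse_def mat_op_add [symmetric] slice_add
    by (intro mat_op_cong completely_positiveD(2) [OF cp] slice_block [OF X] slice_block [OF Y])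
next
  show "collapse \<phi> ` block_ops T bounded_ops \<subseteq> block_ops R B"
    using collapse_block [OF _ cp B] by blast
next
  fix n and X :: "nat \<Rightarrow> nat \<Rightarrow> ('l, complex) ell2 op"
  assume "(\<forall>i<n. \<forall>j<n. X i j \<in> block_ops T bounded_ops) \<and> mpos {..<n} X"
  then have X: "\<And>i j. i \<in> {..<n} \<Longrightarrow> j \<in> {..<n} \<Longrightarrow> X i j \<in> block_ops T bounded_ops"
    and pos: "mpos {..<n} X" by auto
  let ?N = "{..<n}"
  have "mpos (?N \<times> I) (\<lambda>x y. \<phi> ((\<lambda>(i, p) (j, q). slice (X i j) p q) x y))"
  proof (rule cp_mpos [OF cp])
    show "mpos (?N \<times> I) (\<lambda>(i, p) (j, q). slice (X i j) p q)"
      using pos mpos_slice [of ?N X, OF X] by blast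
  qed (use finI slice_block [OF X] in auto)
  also have "mpos (?N \<times> I) (\<lambda>x y. \<phi> ((\<lambda>(i, p) (j, q). slice (X i j) p q) x y))
    \<longleftrightarrow> mpos (?N \<times> I) (\<lambda>(i, p) (j, q). entry (collapse \<phi> (X i j)) p q)"
    by (intro mpos_cong) (auto simp: collapse_def entry_mat_op [OF finI])
  also have "\<dots> \<longleftrightarrow> mpos ?N (\<lambda>i j. collapse \<phi> (X i j))"
    by (rule mpos_entry [symmetric]) (rule collapse_block [OF X cp B])
  finally show "mpos ?N (\<lambda>i j. collapse \<phi> (X i j))" .
qed

lemma expand_block:
  assumes Y: "Y \<in> block_ops R B" and cp: "completely_positive B (block_ops S bounded_ops) \<psi>"
    and B: "cstar_algebra B"
  shows "expand \<psi> Y \<in> block_ops T bounded_ops"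
    and "p \<in> I \<Longrightarrow> q \<in> I \<Longrightarrow> slice (expand \<psi> Y) p q = \<psi> (entry Y p q)"
proof -
  have m: "\<psi> (entry Y p q) \<in> block_ops S bounded_ops" for p q
    using completely_positiveD(1) [OF cp block_opsD(2) [OF Y]] .
  have e: "entry (expand \<psi> Y) (\<sigma> (p, p')) (\<sigma> (q, q')) = entry (\<psi> (entry Y p q)) p' q'"
    if "p \<in> I" "q \<in> I" "p' \<in> J" "q' \<in> J" for p q p' q'
    using that by (simp add: expand_def entry_mat_op [OF finK] \<sigma>_in index_\<sigma>)
  have b: "expand \<psi> Y \<in> bounded_ops"
    unfolding expand_def by (intro mat_op_bounded block_opsD(2) [OF m])
  have "entry (expand \<psi> Y) k k' = 0" if "\<not> T k k'" for k k'
  proof (cases "k \<in> K \<and> k' \<in> K")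
    case True
    then obtain p p' q q' where kk: "p \<in> I" "p' \<in> J" "k = \<sigma> (p, p')" "q \<in> I" "q' \<in> J" "k' = \<sigma> (q, q')"
      by (metis K_cases)
    then have "\<not> R p q \<or> \<not> S p' q'" using that T_iff by blast
    then have "entry (\<psi> (entry Y p q)) p' q' = 0"
      using block_opsD(3) [OF Y, of p q] block_opsD(3) [OF m, of p' q' p q]
        cp_zero [OF cp cstar_algebraD(2) [OF B]] by (cases "R p q") auto
    then show ?thesis using e kk by simp
  qed (auto simp: expand_def entry_mat_op [OF finK])
  then show "expand \<psi> Y \<in> block_ops T bounded_ops"
    unfolding block_ops_def using b entry_bounded_ops by auto
  assume pq: "p \<in> I" "q \<in> I"
  have "slice (expand \<psi> Y) p q = mat_op J (entry (\<psi> (entry Y p q)))"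
    unfolding slice_def by (intro mat_op_cong e pq)
  then show "slice (expand \<psi> Y) p q = \<psi> (entry Y p q)"
    by (simp add: mat_op_entry_block [OF m S])
qed

lemma cp_expand:
  assumes cp: "completely_positive B (block_ops S bounded_ops) \<psi>" and B: "cstar_algebra B"
  shows "completely_positive (block_ops R B) (block_ops T bounded_ops) (expand \<psi>)"
  unfolding completely_positive_def linear_on_alg_def matrix_pos_iff_mpos
proof (intro conjI ballI allI impI)
  fix X Y :: "('i, 'a) ell2 op" and c
  assume X: "X \<in> block_ops R B"
  show "expand \<psi> (op_scaleC c X) = op_scaleC c (expand \<psi> X)"
    unfolding expand_def mat_op_scaleC [symmetric]
    by (intro mat_op_cong) (simp add: entry_scaleC completely_positiveD(3) [OF cp] block_opsD(2) [OF X])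
  assume Y: "Y \<in> block_ops R B"
  show "expand \<psi> (X + Y) = expand \<psi> X + expand \<psi> Y"
    unfolding expand_def mat_op_add [symmetric]
    by (intro mat_op_cong) (simp add: entry_add completely_positiveD(2) [OF cp] block_opsD(2) [OF X] block_opsD(2) [OF Y])
next
  show "expand \<psi> ` block_ops R B \<subseteq> block_ops T bounded_ops"
    using expand_block(1) [OF _ cp B] by blast
next
  fix n and Y :: "nat \<Rightarrow> nat \<Rightarrow> ('i, 'a) ell2 op"
  assume "(\<forall>i<n. \<forall>j<n. Y i j \<in> block_ops R B) \<and> mpos {..<n} Y"
  then have Y: "\<And>i j. i \<in> {..<n} \<Longrightarrow> j \<in> {..<n} \<Longrightarrow> Y i j \<in> block_ops R B"
    and pos: "mpos {..<n} Y" by auto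
  let ?N = "{..<n}"
  have "mpos (?N \<times> I) (\<lambda>x y. \<psi> ((\<lambda>(i, p) (j, q). entry (Y i j) p q) x y))"
  proof (rule cp_mpos [OF cp])
    show "mpos (?N \<times> I) (\<lambda>(i, p) (j, q). entry (Y i j) p q)"
      using pos mpos_entry [of ?N Y, OF Y] by blast
  qed (use finI block_opsD(2) [OF Y] in auto)
  also have "mpos (?N \<times> I) (\<lambda>x y. \<psi> ((\<lambda>(i, p) (j, q). entry (Y i j) p q) x y))
    \<longleftrightarrow> mpos (?N \<times> I) (\<lambda>(i, p) (j, q). slice (expand \<psi> (Y i j)) p q)"
    by (intro mpos_cong) (auto simp: expand_block(2) [OF Y cp B])
  also have "\<dots> \<longleftrightarrow> mpos ?N (\<lambda>i j. expand \<psi> (Y i j))"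
    by (rule mpos_slice [symmetric]) (rule expand_block(1) [OF Y cp B])
  finally show "mpos ?N (\<lambda>i j. expand \<psi> (Y i j))" .
qed

lemma norm_block_le:
  "Y \<in> block_ops R B \<Longrightarrow> 0 \<le> c \<Longrightarrow> norm Y \<le> c \<longleftrightarrow> mbound I (entry Y) c"
  using norm_mat_op_le [OF finI, of c "entry Y"] by (simp add: mat_op_entry_block [OF _ R])

lemma block_ops_bounded: "block_ops S bounded_ops \<subseteq> bounded_ops"
  by (auto simp: block_ops_def)

lemma contractive_expand:
  assumes cp: "completely_positive B (block_ops S bounded_ops) \<psi>" and B: "cstar_algebra B"
    and con: "contractive_on B \<psi>"
  shows "contractive_on (block_ops R B) (expand \<psi>)"
  unfolding contractive_on_def
proof
  fix Y assume Y: "Y \<in> block_ops R B"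
  have "mbound I (entry Y) (norm Y)" using norm_block_le [OF Y, of "norm Y"] by simp
  then have "mbound I (\<lambda>p q. \<psi> (entry Y p q)) (norm Y)"
    using cp_contractive_mbound [OF B cp block_ops_bounded con finI] block_opsD(2) [OF Y] by simp
  also have "mbound I (\<lambda>p q. \<psi> (entry Y p q)) (norm Y) \<longleftrightarrow> mbound I (slice (expand \<psi> Y)) (norm Y)"
    by (intro mbound_cong) (simp add: expand_block(2) [OF Y cp B])
  finally show "norm (expand \<psi> Y) \<le> norm Y"
    using mbound_slice [OF expand_block(1) [OF Y cp B]] by simp
qed

lemma contractive_collapse:
  assumes cp: "completely_positive (block_ops S bounded_ops) B \<phi>" and B: "cstar_algebra B"
    and con: "contractive_on (block_ops S bounded_ops) \<phi>"
  shows "contractive_on (block_ops T bounded_ops) (collapse \<phi>)"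
  unfolding contractive_on_def
proof
  fix X :: "('l, complex) ell2 op" assume X: "X \<in> block_ops T bounded_ops"
  have Bb: "B \<subseteq> bounded_ops" using cstar_algebraD(1) [OF B] by blast
  have "mbound I (slice X) (norm X)" using mbound_slice [OF X, of "norm X"] by simp
  then have "mbound I (\<lambda>p q. \<phi> (slice X p q)) (norm X)"
    using cp_contractive_mbound [OF cstar_block_ops [OF S cstar_bounded_ops] cp Bb con finI] slice_block [OF X] by simp
  then show "norm (collapse \<phi> X) \<le> norm X"
    unfolding collapse_def by (subst norm_mat_op_le [OF finI]) auto
qed

lemma slice_compose:
  assumes X: "X \<in> block_ops T bounded_ops" and Y: "Y \<in> block_ops T bounded_ops" and pq: "p \<in> I" "q \<in> I"
  shows "slice (X o\<^sub>L Y) p q = (\<Sum>m\<in>I. slice X p m o\<^sub>L slice Y m q)"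
proof (rule op_eqI_entry)
  have b: "X \<in> bounded_ops" "Y \<in> bounded_ops" using block_opsD(1) X Y by auto
  show "slice (X o\<^sub>L Y) p q \<in> bounded_ops" "(\<Sum>m\<in>I. slice X p m o\<^sub>L slice Y m q) \<in> bounded_ops"
    using b by (auto intro!: slice_bounded bounded_ops_intros)
  show "entry (slice (X o\<^sub>L Y) p q) p' q' = entry (\<Sum>m\<in>I. slice X p m o\<^sub>L slice Y m q) p' q'" for p' q'
  proof (cases "p' \<in> J \<and> q' \<in> J")
    case True
    have "entry (slice (X o\<^sub>L Y) p q) p' q' = (\<Sum>k\<in>K. entry X (\<sigma> (p, p')) k o\<^sub>L entry Y k (\<sigma> (q, q')))"
      using True by (simp add: entry_slice entry_compose [OF Y T])
    also have "\<dots> = (\<Sum>x\<in>I \<times> J. entry X (\<sigma> (p, p')) (\<sigma> x) o\<^sub>L entry Y (\<sigma> x) (\<sigma> (q, q')))"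
      by (rule sum.reindex_bij_betw [OF \<sigma>, symmetric])
    also have "\<dots> = (\<Sum>m\<in>I. \<Sum>m'\<in>J. entry X (\<sigma> (p, p')) (\<sigma> (m, m')) o\<^sub>L entry Y (\<sigma> (m, m')) (\<sigma> (q, q')))"
      by (rule sum_Times)
    also have "\<dots> = entry (\<Sum>m\<in>I. slice X p m o\<^sub>L slice Y m q) p' q'"
      unfolding entry_sum
    proof (intro sum.cong refl)
      fix m assume m: "m \<in> I"
      show "(\<Sum>m'\<in>J. entry X (\<sigma> (p, p')) (\<sigma> (m, m')) o\<^sub>L entry Y (\<sigma> (m, m')) (\<sigma> (q, q')))
        = entry (slice X p m o\<^sub>L slice Y m q) p' q'"
        unfolding entry_compose [OF slice_block [OF Y m pq(2)] S] using True
        by (intro sum.cong refl) (simp add: entry_slice)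
    qed
    finally show ?thesis .
  next
    case False
    have "entry (slice X p m o\<^sub>L slice Y m q) p' q' = 0" if m: "m \<in> I" for m
      unfolding entry_compose [OF slice_block [OF Y m pq(2)] S] using False
      by (auto simp: entry_slice)
    then have "entry (\<Sum>m\<in>I. slice X p m o\<^sub>L slice Y m q) p' q' = 0"
      unfolding entry_sum by simp
    moreover have "entry (slice (X o\<^sub>L Y) p q) p' q' = 0" using False by (auto simp: entry_slice)
    ultimately show ?thesis by simp
  qed
qed

text \<open>
  Amplifications preserve zero products: each entry of the product is a sum of terms
\<open>\<phi> (slice X p m) \<phi> (slice Y m q) = \<phi> 1 \<phi> (slice X p m \<cdot> slice Y m q)\<close>, and the sum is \<open>\<phi> 1 \<phi> (slice (X Y) p q)\<close>.
\<close>

lemma collapse_disjoint: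
  assumes oz: "order_zero (block_ops S bounded_ops) B \<phi>" and B: "cstar_algebra B"
    and X: "X \<in> block_ops T bounded_ops" and Y: "Y \<in> block_ops T bounded_ops" and XY: "X o\<^sub>L Y = 0"
  shows "collapse \<phi> X o\<^sub>L collapse \<phi> Y = 0"
proof (rule op_eqI_entry)
  have cp: "completely_positive (block_ops S bounded_ops) B \<phi>" using oz by (simp add: order_zero_def)
  have Bb: "B \<subseteq> bounded_ops" using cstar_algebraD(1) [OF B] by blast
  note cX = collapse_block [OF X cp B] and cY = collapse_block [OF Y cp B]
  note F = cstar_block_ops [OF S cstar_bounded_ops]
  show "collapse \<phi> X o\<^sub>L collapse \<phi> Y \<in> bounded_ops"
    using block_opsD(1) [OF cX] block_opsD(1) [OF cY] by (rule bounded_ops_compose)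
  show "entry (collapse \<phi> X o\<^sub>L collapse \<phi> Y) p q = entry 0 p q" for p q
  proof (cases "p \<in> I \<and> q \<in> I")
    case True
    have "entry (collapse \<phi> X o\<^sub>L collapse \<phi> Y) p q = (\<Sum>m\<in>I. \<phi> (slice X p m) o\<^sub>L \<phi> (slice Y m q))"
      unfolding entry_compose [OF cY R] using True
      by (intro sum.cong refl) (simp add: collapse_def entry_mat_op [OF finI])
    also have "\<dots> = (\<Sum>m\<in>I. \<phi> (block_unit J S) o\<^sub>L \<phi> (slice X p m o\<^sub>L slice Y m q))"
      using True by (intro sum.cong refl order_zero_mult [OF S oz Bb] slice_block [OF X] slice_block [OF Y]) auto
    also have "\<dots> = \<phi> (block_unit J S) o\<^sub>L \<phi> (\<Sum>m\<in>I. slice X p m o\<^sub>L slice Y m q)"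
      using True by (subst cp_sum [OF cp F])
        (auto simp: compose_sum_right intro!: cstar_algebraD(5) [OF F] slice_block [OF X] slice_block [OF Y])
    also have "(\<Sum>m\<in>I. slice X p m o\<^sub>L slice Y m q) = slice 0 p q"
      using slice_compose [OF X Y, of p q] True XY by simp
    also have "slice 0 p q = 0" by (rule op_eqI_entry) (auto simp: entry_slice slice_bounded)
    finally show ?thesis using cp_zero [OF cp cstar_algebraD(2) [OF F]] by simp
  next
    case False
    then show ?thesis
      unfolding entry_compose [OF cY R] by (auto simp: collapse_def entry_mat_op [OF finI])
  qed
qed simp

lemma entry_collapse_expand:
  assumes "Y \<in> block_ops R B" "completely_positive B (block_ops S bounded_ops) \<psi>" "cstar_algebra B"
    "p \<in> I" "q \<in> I"
  shows "entry (collapse \<phi> (expand \<psi> Y)) p q = \<phi> (\<psi> (entry Y p q))"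
  using assms by (simp add: collapse_def entry_mat_op [OF finI] expand_block(2))

end

section \<open>Tensor products of shapes\<close>

text \<open>
  The shape of \<open>F \<otimes> F'\<close>.  Pairs of summands, pairs of blocks and pairs of rows are each numbered
lexicographically; division with remainder recovers the two components.
\<close>

definition prod_shape :: "shape \<Rightarrow> shape \<Rightarrow> shape" where
  "prod_shape s t = map (\<lambda>m. map (\<lambda>\<kappa>.
       s ! (m div length t) ! (\<kappa> div length (t ! (m mod length t)))
       * t ! (m mod length t) ! (\<kappa> mod length (t ! (m mod length t))))
     [0..<length (s ! (m div length t)) * length (t ! (m mod length t))])
   [0..<length s * length t]"

fun pair_index :: "shape \<Rightarrow> index \<times> index \<Rightarrow> index" where
  "pair_index t ((i, k, r), (j, l, r')) =
     (i * length t + j, k * length (t ! j) + l, r * (t ! j ! l) + r')"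

definition unpair_index :: "shape \<Rightarrow> index \<Rightarrow> index \<times> index" where
  "unpair_index t = (\<lambda>(m, \<kappa>, \<rho>).
     let j = m mod length t; l = \<kappa> mod length (t ! j)
     in ((m div length t, \<kappa> div length (t ! j), \<rho> div (t ! j ! l)), (j, l, \<rho> mod (t ! j ! l))))"

lemma length_prod_shape [simp]: "length (prod_shape s t) = length s * length t"
  by (simp add: prod_shape_def)

lemma digits:
  fixes i j N :: nat
  assumes "j < N"
  shows "(i * N + j) div N = i" "(i * N + j) mod N = j" "i < M \<Longrightarrow> i * N + j < M * N"
proof -
  show "(i * N + j) div N = i" "(i * N + j) mod N = j" using assms by auto
  assume "i < M"
  then have "Suc i * N \<le> M * N" by (intro mult_right_mono) auto
  then show "i * N + j < M * N" using assms by simp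
qed

lemma digits_eq:
  fixes i j N :: nat
  assumes "j < N" "j' < N"
  shows "i * N + j = i' * N + j' \<longleftrightarrow> i = i' \<and> j = j'"
  using digits(1,2) assms by metis

lemma indices_iff: "(i, k, r) \<in> indices s \<longleftrightarrow> i < length s \<and> k < length (s ! i) \<and> r < s ! i ! k"
  by (simp add: indices_def)

lemma pair_index_in:
  assumes "p \<in> indices s" "q \<in> indices t"
  shows "pair_index t (p, q) \<in> indices (prod_shape s t)"
proof -
  obtain i k r j l r' where [simp]: "p = (i, k, r)" "q = (j, l, r')" by (metis prod_cases3)
  have 1: "i < length s" "k < length (s ! i)" "r < s ! i ! k"
    "j < length t" "l < length (t ! j)" "r' < t ! j ! l"
    using assms by (auto simp: indices_iff)
  show ?thesis
    using digits(1,2) [OF 1(4), of i] digits(3) [OF 1(4), of i "length s"]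
      digits(1,2) [OF 1(5), of k] digits(3) [OF 1(5), of k "length (s ! i)"]
      digits(3) [OF 1(6), of r "s ! i ! k"] 1
    by (simp add: indices_iff prod_shape_def)
qed

lemma unpair_index:
  assumes "m \<in> indices (prod_shape s t)"
  shows "unpair_index t m \<in> indices s \<times> indices t" "pair_index t (unpair_index t m) = m"
proof -
  obtain a \<kappa> \<rho> where [simp]: "m = (a, \<kappa>, \<rho>)" by (metis prod_cases3)
  define i j where "i = a div length t" and "j = a mod length t"
  define k l where "k = \<kappa> div length (t ! j)" and "l = \<kappa> mod length (t ! j)"
  have a: "a < length s * length t" using assms by (simp add: indices_iff)
  then have \<kappa>: "\<kappa> < length (s ! i) * length (t ! j)"
    using assms by (simp add: indices_iff prod_shape_def i_def j_def)
  then have \<rho>: "\<rho> < s ! i ! k * t ! j ! l"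
    using assms a by (simp add: indices_iff prod_shape_def i_def j_def k_def l_def)
  have nz: "0 < length t" "0 < length (t ! j)" "0 < t ! j ! l"
    using a \<kappa> \<rho> by (auto intro: Nat.gr0I)
  have "i < length s" "k < length (s ! i)" "\<rho> div (t ! j ! l) < s ! i ! k"
    using less_mult_imp_div_less a \<kappa> \<rho> by (auto simp: i_def k_def)
  moreover have "j < length t" "l < length (t ! j)" "\<rho> mod (t ! j ! l) < t ! j ! l"
    using nz by (auto simp: j_def l_def)
  ultimately show "unpair_index t m \<in> indices s \<times> indices t"
    by (simp add: unpair_index_def Let_def indices_iff i_def [symmetric] j_def [symmetric]
        k_def [symmetric] l_def [symmetric])
  show "pair_index t (unpair_index t m) = m"
    using div_mult_mod_eq [of \<rho> "t ! j ! l"]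
    by (simp add: unpair_index_def Let_def j_def l_def)
qed

lemma unpair_pair:
  assumes "p \<in> indices s" "q \<in> indices t"
  shows "unpair_index t (pair_index t (p, q)) = (p, q)"
proof -
  obtain i k r j l r' where [simp]: "p = (i, k, r)" "q = (j, l, r')" by (metis prod_cases3)
  show ?thesis
    using assms digits(1,2) [of j "length t" i] digits(1,2) [of l "length (t ! j)" k]
      digits(1,2) [of r' "t ! j ! l" r]
    by (simp add: indices_iff unpair_index_def)
qed

lemma bij_pair_index:
  "bij_betw (pair_index t) (indices s \<times> indices t) (indices (prod_shape s t))"
proof (rule bij_betw_byWitness [where f' = "unpair_index t"])
  show "\<forall>a\<in>indices s \<times> indices t. unpair_index t (pair_index t a) = a"
    using unpair_pair by auto
  show "\<forall>a'\<in>indices (prod_shape s t). pair_index t (unpair_index t a') = a'"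
    using unpair_index(2) by blast
  show "pair_index t ` (indices s \<times> indices t) \<subseteq> indices (prod_shape s t)"
    using pair_index_in by auto
  show "unpair_index t ` indices (prod_shape s t) \<subseteq> indices s \<times> indices t"
    using unpair_index(1) by blast
qed

lemma same_block_pair:
  assumes "p \<in> indices s" "q \<in> indices s" "p' \<in> indices t" "q' \<in> indices t"
  shows "same_block (prod_shape s t) (pair_index t (p, p')) (pair_index t (q, q'))
    \<longleftrightarrow> same_block s p q \<and> same_block t p' q'"
proof -
  obtain i k r i2 k2 r2 j l z j2 l2 z2 where [simp]: "p = (i, k, r)" "q = (i2, k2, r2)"
    "p' = (j, l, z)" "q' = (j2, l2, z2)" by (metis prod_cases3)
  have m: "pair_index t (p, p') \<in> indices (prod_shape s t)" "pair_index t (q, q') \<in> indices (prod_shape s t)"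
    using pair_index_in assms by auto
  have e: "i * length t + j = i2 * length t + j2 \<longleftrightarrow> i = i2 \<and> j = j2"
    using assms by (intro digits_eq) (auto simp: indices_iff)
  have "k * length (t ! j) + l = k2 * length (t ! j) + l2 \<longleftrightarrow> k = k2 \<and> l = l2" if "j = j2"
    using assms that by (intro digits_eq) (auto simp: indices_iff)
  then show ?thesis using m assms e by (auto simp: same_block_def)
qed

lemma fst_pair_index: "fst (pair_index t (p, p')) = fst p * length t + fst p'"
  by (cases p; cases p') auto

lemma block_product_full:
  "block_product (indices s) (indices t) (indices (prod_shape s t)) (pair_index t)
     (same_block s) (same_block t) (same_block (prod_shape s t))"
  by unfold_locales (auto intro: block_rel_same_block bij_pair_index simp: same_block_pair simp del: pair_index.simps)

lemma block_product_summand: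
  assumes "j < length t"
  shows "block_product (indices s) (indices t) (indices (prod_shape s t)) (pair_index t)
     (\<lambda>p q. same_block s p q \<and> fst p = i) (\<lambda>p q. same_block t p q \<and> fst p = j)
     (\<lambda>p q. same_block (prod_shape s t) p q \<and> fst p = i * length t + j)"
proof unfold_locales
  fix p q p' q' assume m: "p \<in> indices s" "q \<in> indices s" "p' \<in> indices t" "q' \<in> indices t"
  have "fst p' < length t" using m by (auto simp: indices_def)
  then have "fst p * length t + fst p' = i * length t + j \<longleftrightarrow> fst p = i \<and> fst p' = j"
    using assms by (rule digits_eq)
  then show "same_block (prod_shape s t) (pair_index t (p, p')) (pair_index t (q, q')) \<and>
       fst (pair_index t (p, p')) = i * length t + j \<longleftrightarrow>
       (same_block s p q \<and> fst p = i) \<and> same_block t p' q' \<and> fst p' = j"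
    using same_block_pair [OF m] by (auto simp: fst_pair_index)
qed (rule block_rel_summand bij_pair_index)+

section \<open>The dimension estimate\<close>

text \<open>
  Although \<open>\<phi>\<close> is contractive only on the summands, it is bounded on the whole algebra, with a crude bound
that suffices because the tolerance for \<open>B\<close> is chosen after the shape \<open>s\<close>.
\<close>

lemma norm_le_entries:
  assumes cp: "completely_positive (fd_tensor s B) A \<phi>" and B: "cstar_algebra B"
    and con: "\<And>i. i < length s \<Longrightarrow> contractive_on (fd_tensor_summand s i B) \<phi>"
    and Z: "Z \<in> fd_tensor s B"
  shows "norm (\<phi> Z) \<le> (\<Sum>p\<in>indices s. \<Sum>q\<in>indices s. norm (entry Z p q))"
proof -
  let ?E = "\<lambda>p q. ell2_single p o\<^sub>L entry Z p q o\<^sub>L ell2_coord q"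
  note F = cstar_fd_tensor [OF B, of s]
  have Z': "Z \<in> block_ops (same_block s) B" using Z by (simp add: fd_tensor_block)
  have E: "?E p q \<in> fd_tensor s B \<and> norm (\<phi> (?E p q)) \<le> norm (entry Z p q)" for p q
  proof (cases "same_block s p q")
    case True
    have "?E p q \<in> fd_tensor_summand s (fst p) B"
      unfolding fd_summand_block
      by (rule matrix_term_block [OF _ block_opsD(2) [OF Z'] B]) (use True in simp)
    moreover have "fst p < length s" using True by (auto simp: same_block_def indices_def)
    moreover have "norm (?E p q) \<le> norm (entry Z p q)"
      by (intro norm_compose3_le norm_coord_le norm_single_le)
    ultimately show ?thesis
      using con [of "fst p"] fd_summand_subset [of s "fst p" B] unfolding contractive_on_def by force
  next
    case False
    then show ?thesis
      using block_opsD(3) [OF Z'] cstar_algebraD(2) [OF F] cp_zero [OF cp Z] by simp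
  qed
  have "Z = (\<Sum>p\<in>indices s. \<Sum>q\<in>indices s. ?E p q)"
    using mat_op_entry_block [OF Z' block_rel_same_block] by (simp add: mat_op_def)
  then have "\<phi> Z = \<phi> (\<Sum>p\<in>indices s. \<Sum>q\<in>indices s. ?E p q)" by simp
  also have "\<dots> = (\<Sum>p\<in>indices s. \<phi> (\<Sum>q\<in>indices s. ?E p q))"
    by (intro cp_sum [OF cp F] cstar_algebra_sum [OF F]) (use E in blast)
  also have "\<dots> = (\<Sum>p\<in>indices s. \<Sum>q\<in>indices s. \<phi> (?E p q))"
    by (intro sum.cong refl cp_sum [OF cp F]) (use E in blast)
  finally show ?thesis using E by (auto intro!: sum_norm_le)
qed

text \<open>
  The composition \<open>A \<rightarrow> F \<otimes> B \<rightarrow> F \<otimes> F' \<rightarrow> F \<otimes> B \<rightarrow> A\<close>.  The summand with number \<open>m = i (n + 1) + j\<close> of \<open>F \<otimes> F'\<close> is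
\<open>F\<^sup>(\<^sup>i\<^sup>) \<otimes> F'\<^sup>(\<^sup>j\<^sup>)\<close>; there the second half is the amplification of \<open>\<phi>'\<close> on \<open>F'\<^sup>(\<^sup>j\<^sup>)\<close> followed by \<open>\<phi>\<close> on
\<open>F\<^sup>(\<^sup>i\<^sup>) \<otimes> B\<close>.
\<close>

lemma dim_nuc_le_tensor:
  fixes A D :: "'h::complex_hilbert_space op set" and B :: "'k::complex_hilbert_space op set"
  assumes A: "cstar_algebra A" and B: "cstar_algebra B"
    and nB: "dim_nuc_le B n" and dA: "dim_diag_le D A B d" and N: "Suc N = Suc n * Suc d"
  shows "dim_nuc_le A N"
  unfolding dim_nuc_le_def
proof (intro allI impI)
  fix X and \<epsilon> :: real assume X: "finite X \<and> X \<subseteq> A \<and> 0 < \<epsilon>"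
  then have "finite X \<and> X \<subseteq> A \<and> 0 < \<epsilon> / 2" by simp
  from dA [unfolded dim_diag_le_def, rule_format, OF this]
  obtain s \<psi> \<phi> where s: "length s = Suc d"
    and \<psi>: "completely_positive A (fd_tensor s B) \<psi>" "contractive_on A \<psi>"
    and \<phi>: "completely_positive (fd_tensor s B) A \<phi>"
      "\<And>i. i \<le> d \<Longrightarrow> contractive_on (fd_tensor_summand s i B) \<phi>"
      "\<And>i. i \<le> d \<Longrightarrow> order_zero (fd_tensor_summand s i B) A \<phi>"
    and app: "\<And>a. a \<in> X \<Longrightarrow> norm (\<phi> (\<psi> a) - a) < \<epsilon> / 2"
    by auto
  let ?I = "indices s"
  define k where "k = real (card ?I) * real (card ?I)"
  define \<eta> where "\<eta> = \<epsilon> / (2 * (k + 1))"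
  have k0: "0 \<le> k" by (simp add: k_def)
  have \<eta>: "0 < \<eta>" "k * \<eta> \<le> \<epsilon> / 2" using X k0 by (auto simp: \<eta>_def field_simps)
  define Y where "Y = (\<Union>a\<in>X. \<Union>p\<in>?I. \<Union>q\<in>?I. {entry (\<psi> a) p q})"
  have \<psi>a: "\<psi> a \<in> block_ops (same_block s) B" if "a \<in> A" for a
    using completely_positiveD(1) [OF \<psi>(1) that] by (simp add: fd_tensor_block)
  have "finite Y \<and> Y \<subseteq> B \<and> 0 < \<eta>"
    using X \<eta> block_opsD(2) [OF \<psi>a] finite_indices by (auto simp: Y_def)
  from nB [unfolded dim_nuc_le_def, rule_format, OF this]
  obtain t \<psi>' \<phi>' where t: "length t = Suc n"
    and \<psi>': "completely_positive B (fd_algebra t) \<psi>'" "contractive_on B \<psi>'"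
    and \<phi>': "completely_positive (fd_algebra t) B \<phi>'"
      "\<And>i. i \<le> n \<Longrightarrow> contractive_on (fd_summand t i) \<phi>'"
      "\<And>i. i \<le> n \<Longrightarrow> order_zero (fd_summand t i) B \<phi>'"
    and app': "\<And>b. b \<in> Y \<Longrightarrow> norm (\<phi>' (\<psi>' b) - b) < \<eta>"
    by auto
  let ?u = "prod_shape s t"
  interpret P: block_product ?I "indices t" "indices ?u" "pair_index t" "same_block s" "same_block t"
    "same_block ?u" by (rule block_product_full)
  define \<Psi> where "\<Psi> = P.expand \<psi>'"
  define \<Phi> :: "(index, complex) ell2 op \<Rightarrow> (index, 'k) ell2 op" where "\<Phi> = P.collapse \<phi>'"
  have \<Psi>: "completely_positive (fd_tensor s B) (fd_algebra ?u) \<Psi>" "contractive_on (fd_tensor s B) \<Psi>"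
    unfolding \<Psi>_def fd_tensor_block
    using P.cp_expand [OF _ B] P.contractive_expand [OF _ B] \<psi>' by (simp_all add: fd_tensor_block)
  have \<Phi>: "completely_positive (fd_algebra ?u) (fd_tensor s B) \<Phi>"
    unfolding \<Phi>_def fd_tensor_block
    using P.cp_collapse [OF _ B] \<phi>' by (simp add: fd_tensor_block)
  have 1: "completely_positive A (fd_algebra ?u) (\<lambda>a. \<Psi> (\<psi> a))"
    by (rule cp_compose [OF \<psi>(1) \<Psi>(1)])
  have 2: "completely_positive (fd_algebra ?u) A (\<lambda>x. \<phi> (\<Phi> x))"
    by (rule cp_compose [OF \<Phi> \<phi>(1)])
  have 3: "contractive_on A (\<lambda>a. \<Psi> (\<psi> a))"
    unfolding contractive_on_def
  proof
    fix a assume a: "a \<in> A"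
    have "norm (\<Psi> (\<psi> a)) \<le> norm (\<psi> a)"
      using \<Psi>(2) completely_positiveD(1) [OF \<psi>(1) a] unfolding contractive_on_def by blast
    also have "\<dots> \<le> norm a" using \<psi>(2) a unfolding contractive_on_def by blast
    finally show "norm (\<Psi> (\<psi> a)) \<le> norm a" .
  qed
  have 4: "norm (\<phi> (\<Phi> (\<Psi> (\<psi> a))) - a) < \<epsilon>" if a: "a \<in> X" for a
  proof -
    have aA: "a \<in> A" using a X by blast
    note F = cstar_fd_tensor [OF B, of s]
    have m: "\<psi> a \<in> fd_tensor s B" "\<Phi> (\<Psi> (\<psi> a)) \<in> fd_tensor s B"
      using completely_positiveD(1) [OF \<psi>(1) aA] completely_positiveD(1) [OF \<Phi>] completely_positiveD(1) [OF \<Psi>(1)]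
      by auto
    have "norm (\<phi> (\<Phi> (\<Psi> (\<psi> a))) - \<phi> (\<psi> a)) = norm (\<phi> (\<Phi> (\<Psi> (\<psi> a)) - \<psi> a))"
      using cp_diff [OF \<phi>(1) m(2) m(1) cstar_algebraD(9) [OF F m(1)]] by simp
    also have "\<dots> \<le> (\<Sum>p\<in>?I. \<Sum>q\<in>?I. norm (entry (\<Phi> (\<Psi> (\<psi> a)) - \<psi> a) p q))"
      using \<phi>(2) s by (intro norm_le_entries [OF \<phi>(1) B] cstar_algebraD(10) [OF F] m) auto
    also have "\<dots> \<le> (\<Sum>p\<in>?I. \<Sum>q\<in>?I. \<eta>)"
    proof (intro sum_mono)
      fix p q assume pq: "p \<in> ?I" "q \<in> ?I"
      have "entry (\<Phi> (\<Psi> (\<psi> a))) p q = \<phi>' (\<psi>' (entry (\<psi> a) p q))"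
        unfolding \<Phi>_def \<Psi>_def
        by (rule P.entry_collapse_expand [OF \<psi>a [OF aA] _ B pq]) (use \<psi>' in \<open>simp add: fd_tensor_block\<close>)
      moreover have "entry (\<psi> a) p q \<in> Y" using a pq by (auto simp: Y_def)
      ultimately show "norm (entry (\<Phi> (\<Psi> (\<psi> a)) - \<psi> a) p q) \<le> \<eta>"
        using app' by (simp add: entry_diff less_imp_le)
    qed
    also have "\<dots> = k * \<eta>" by (simp add: k_def)
    finally have "norm (\<phi> (\<Phi> (\<Psi> (\<psi> a))) - \<phi> (\<psi> a)) \<le> \<epsilon> / 2" using \<eta> by linarith
    moreover have "norm (\<phi> (\<psi> a) - a) < \<epsilon> / 2" by (rule app [OF a])
    ultimately show ?thesis
      using norm_triangle_ineq [of "\<phi> (\<Phi> (\<Psi> (\<psi> a))) - \<phi> (\<psi> a)" "\<phi> (\<psi> a) - a"] by simp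
  qed
  have 5: "contractive_on (fd_summand ?u m) (\<lambda>x. \<phi> (\<Phi> x)) \<and> order_zero (fd_summand ?u m) A (\<lambda>x. \<phi> (\<Phi> x))"
    if m: "m \<le> N" for m
  proof -
    define i j where "i = m div Suc n" and "j = m mod Suc n"
    have mij: "m = i * length t + j" unfolding i_def j_def t by (rule div_mult_mod_eq [symmetric])
    have j: "j \<le> n" "j < length t" by (simp_all add: j_def t less_Suc_eq_le [symmetric])
    have "m < Suc d * Suc n" using m N by (simp add: mult.commute)
    then have i: "i \<le> d" using less_mult_imp_div_less [of m "Suc d" "Suc n"] by (simp add: i_def)
    interpret Q: block_product ?I "indices t" "indices ?u" "pair_index t"
      "\<lambda>p q. same_block s p q \<and> fst p = i" "\<lambda>p q. same_block t p q \<and> fst p = j"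
      "\<lambda>p q. same_block ?u p q \<and> fst p = m"
      unfolding mij by (rule block_product_summand [OF j(2)])
    have cpj: "completely_positive (fd_summand t j) B \<phi>'" using \<phi>'(3) [OF j(1)] by (simp add: order_zero_def)
    have q1: "completely_positive (fd_summand ?u m) (fd_tensor_summand s i B) \<Phi>"
      unfolding \<Phi>_def fd_summand_block by (rule Q.cp_collapse [OF cpj [unfolded fd_summand_block] B])
    have q2: "contractive_on (fd_summand ?u m) \<Phi>"
      unfolding \<Phi>_def fd_summand_block
      by (rule Q.contractive_collapse [OF cpj [unfolded fd_summand_block] B \<phi>'(2) [OF j(1), unfolded fd_summand_block]])
    have "contractive_on (fd_summand ?u m) (\<lambda>x. \<phi> (\<Phi> x))"
      unfolding contractive_on_def
    proof
      fix x assume x: "x \<in> fd_summand ?u m"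
      have "norm (\<phi> (\<Phi> x)) \<le> norm (\<Phi> x)"
        using \<phi>(2) [OF i] completely_positiveD(1) [OF q1 x] unfolding contractive_on_def by blast
      also have "\<dots> \<le> norm x" using q2 x unfolding contractive_on_def by blast
      finally show "norm (\<phi> (\<Phi> x)) \<le> norm x" .
    qed
    moreover have "order_zero (fd_summand ?u m) A (\<lambda>x. \<phi> (\<Phi> x))"
      unfolding order_zero_def
    proof (intro conjI ballI impI)
      show "completely_positive (fd_summand ?u m) A (\<lambda>x. \<phi> (\<Phi> x))"
        using \<phi>(3) [OF i] by (intro cp_compose [OF q1]) (simp add: order_zero_def)
      fix x y assume x: "x \<in> fd_summand ?u m" and y: "y \<in> fd_summand ?u m"
        and xy: "op_pos x \<and> op_pos y \<and> x o\<^sub>L y = 0"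
      have b: "fd_tensor_summand s i B \<subseteq> bounded_ops" by (auto simp: fd_summand_block block_ops_def)
      have "\<Phi> x o\<^sub>L \<Phi> y = 0"
        unfolding \<Phi>_def using x y xy
        by (intro Q.collapse_disjoint [OF \<phi>'(3) [OF j(1), unfolded fd_summand_block] B])
          (auto simp: fd_summand_block)
      moreover have "op_pos (\<Phi> x)" "op_pos (\<Phi> y)"
        using cp_op_pos [OF q1 b] x y xy by auto
      ultimately show "\<phi> (\<Phi> x) o\<^sub>L \<phi> (\<Phi> y) = 0"
        using \<phi>(3) [OF i] completely_positiveD(1) [OF q1 x] completely_positiveD(1) [OF q1 y]
        unfolding order_zero_def by blast
    qed
    ultimately show ?thesis by blast
  qed
  show "\<exists>s \<psi> \<phi>. length s = Suc N \<and>
          completely_positive A (fd_algebra s) \<psi> \<and>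
          completely_positive (fd_algebra s) A \<phi> \<and>
          contractive_on A \<psi> \<and>
          (\<forall>a\<in>X. norm (\<phi> (\<psi> a) - a) < \<epsilon>) \<and>
          (\<forall>i\<le>N. contractive_on (fd_summand s i) \<phi> \<and> order_zero (fd_summand s i) A \<phi>)"
    using 1 2 3 4 5 N s t
    by (intro exI [of _ ?u] exI [of _ "\<lambda>a. \<Psi> (\<psi> a)"] exI [of _ "\<lambda>x. \<phi> (\<Phi> x)"]) (simp add: mult.commute)
qed

section \<open>Nuclearity\<close>

lemma alg_unit_projection:
  assumes F: "cstar_algebra F" and u: "alg_unit F u"
  shows "cinner x (u x) = complex_of_real ((norm (u x))\<^sup>2)" "norm (u x) \<le> norm x"
proof -
  have "u o\<^sub>L u = u" using u by (auto simp: alg_unit_def)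
  then have "cinner x (u x) = cinner x (u (u x))" by (metis blinfun_apply_blinfun_compose)
  also have "\<dots> = cinner (u x) (u x)" by (rule op_pos_cinner_commute [OF alg_unit_pos [OF F u]])
  finally show eq: "cinner x (u x) = complex_of_real ((norm (u x))\<^sup>2)" by (simp add: cinner_same)
  have "norm (u x) * norm (u x) \<le> norm x * norm (u x)"
    using cmod_cinner_le_norm [of x "u x"] eq by (simp add: power2_eq_square norm_mult)
  then show "norm (u x) \<le> norm x"
    by (metis mult_right_le_imp_le norm_ge_zero order_le_less)
qed

text \<open>
  Square root and inverse square root of \<open>k \<ge> \<delta>\<close> without functional calculus.  After scaling, \<open>k / M = 1 - t\<close> with
\<open>0 \<le> t \<le> 1 - \<delta> / M\<close>, and \<open>(1 - y)\<^sup>2 = 1 - t\<close> is the fixed point equation \<open>y = (t + y\<^sup>2) / 2\<close>, a contraction on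
the ball of radius \<open>\<rho> < 1\<close>.  The inverse of \<open>1 - y\<close> is the fixed point of \<open>z \<mapsto> 1 + y z\<close>.
\<close>

lemma positive_sqrt_inverse:
  fixes F :: "'h::complex_hilbert_space op set"
  assumes F: "cstar_algebra F" and u: "alg_unit F u" and k: "k \<in> F" "op_pos k" and \<delta>: "0 < \<delta>"
    and lower: "\<And>x. \<delta> * Re (cinner x (u x)) \<le> Re (cinner x (k x))"
  shows "\<exists>r\<in>F. \<exists>r'\<in>F. adj r = r \<and> adj r' = r' \<and> r o\<^sub>L r = k \<and> r o\<^sub>L r' = u \<and> r' o\<^sub>L r = u"
proof -
  have uF: "u \<in> F" and uu: "u o\<^sub>L u = u" and unit: "\<And>a. a \<in> F \<Longrightarrow> a o\<^sub>L u = a" "\<And>a. a \<in> F \<Longrightarrow> u o\<^sub>L a = a"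
    using u by (auto simp: alg_unit_def)
  have upos: "op_pos u" and uadj: "adj u = u" using alg_unit_pos [OF F u] alg_unit_adj [OF F u] .
  note C = cstar_algebraD(4,5,6,8,10) [OF F] and Cb = cstar_algebraD(1) [OF F]
  have ux: "cinner x (u x) = complex_of_real ((norm (u x))\<^sup>2)" for x
    by (rule alg_unit_projection(1) [OF F u])
  have nu: "(norm (u x))\<^sup>2 \<le> (norm x)\<^sup>2" for x
    by (simp add: power_mono alg_unit_projection(2) [OF F u])
  define M where "M = norm k + \<delta>"
  have M: "0 < M" "\<delta> \<le> M" using \<delta> by (auto simp: M_def intro: add_nonneg_pos)
  define t where "t = u - (1 / M) *\<^sub>R k"
  have tF: "t \<in> F" unfolding t_def by (intro C uF k)
  have tq: "cinner x (t x) = cinner x (u x) - complex_of_real (1 / M) * cinner x (k x)" for x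
    by (simp add: t_def blinfun_lin cinner_diff_right scaleR_eq_scaleC cinner_scaleC_right)
  have ku: "Re (cinner x (k x)) \<le> M * (norm (u x))\<^sup>2" for x
  proof -
    have kuu: "u (k (u x)) = k x" using arg_cong [OF unit(1) [OF k(1)], of "\<lambda>T. T x"]
        arg_cong [OF unit(2) [OF k(1)], of "\<lambda>T. T (u x)"] by simp
    have "cinner x (k x) = cinner (u x) (k (u x))"
      by (subst kuu [symmetric]) (rule op_pos_cinner_commute [OF upos])
    then have "Re (cinner x (k x)) \<le> norm k * (norm (u x))\<^sup>2" by (simp add: Re_cinner_le_norm)
    also have "\<dots> \<le> M * (norm (u x))\<^sup>2" using \<delta> by (intro mult_right_mono) (auto simp: M_def)
    finally show ?thesis .
  qed
  have tpos: "op_pos t"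
    using ku M k(2) unfolding op_pos_iff tq ux by (auto simp: Cb [OF tF] field_simps)
  have dM: "0 \<le> \<delta> / M" "\<delta> / M \<le> 1" using M \<delta> by auto
  have tn: "norm t \<le> 1 - \<delta> / M"
  proof (rule op_pos_norm_le [OF tpos])
    fix x
    have "\<delta> * (norm (u x))\<^sup>2 \<le> Re (cinner x (k x))" using lower [of x] by (simp add: ux)
    then have "\<delta> / M * (norm (u x))\<^sup>2 \<le> 1 / M * Re (cinner x (k x))"
      using M by (simp add: field_simps)
    then have "Re (cinner x (t x)) \<le> (1 - \<delta> / M) * (norm (u x))\<^sup>2"
      unfolding tq ux by (simp add: algebra_simps)
    also have "\<dots> \<le> (1 - \<delta> / M) * (norm x)\<^sup>2" using dM nu by (intro mult_left_mono) auto
    finally show "Re (cinner x (t x)) \<le> (1 - \<delta> / M) * (norm x)\<^sup>2" .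
  qed (use dM in simp)
  \<comment> \<open>The radius is mapped to itself: \<open>(1 - \<delta> / M + \<rho>\<^sup>2) / 2 = \<rho>\<close>.\<close>
  define \<rho> where "\<rho> = 1 - sqrt (\<delta> / M)"
  have \<rho>: "0 \<le> \<rho>" "\<rho> < 1" using dM M \<delta> by (auto simp: \<rho>_def)
  have \<rho>_eq: "1 - \<delta> / M + \<rho> * \<rho> = 2 * \<rho>"
  proof -
    have "sqrt (\<delta> / M) * sqrt (\<delta> / M) = \<delta> / M"
      using real_sqrt_pow2 [OF dM(1)] by (simp only: power2_eq_square)
    then show ?thesis unfolding \<rho>_def by (simp only: algebra_simps)
  qed
  define f where "f y = (1 / 2) *\<^sub>R (t + (y o\<^sub>L y))" for y
  have fY: "\<exists>!y. y \<in> F \<inter> cball 0 \<rho> \<and> f y = y"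
  proof (rule Banach_fix [OF _ _ \<rho>])
    show "complete (F \<inter> cball 0 \<rho>)"
      using cstar_algebraD(3) [OF F] by (simp add: complete_eq_closed closed_Int)
    show "F \<inter> cball 0 \<rho> \<noteq> {}" using cstar_algebraD(2) [OF F] \<rho> by force
    show "f ` (F \<inter> cball 0 \<rho>) \<subseteq> F \<inter> cball 0 \<rho>"
    proof safe
      fix y assume y: "y \<in> F" "y \<in> cball 0 \<rho>"
      show "f y \<in> F" unfolding f_def by (intro C tF y)
      have "norm (y o\<^sub>L y) \<le> \<rho> * \<rho>"
        using y \<rho> by (intro order_trans [OF norm_blinfun_compose] mult_mono) auto
      then have "norm (t + (y o\<^sub>L y)) \<le> 2 * \<rho>"
        using norm_triangle_ineq [of t "y o\<^sub>L y"] tn \<rho>_eq by linarith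
      then show "f y \<in> cball 0 \<rho>" by (simp add: f_def)
    qed
    fix y z assume y: "y \<in> F \<inter> cball 0 \<rho>" and z: "z \<in> F \<inter> cball 0 \<rho>"
    have "f y - f z = (1 / 2) *\<^sub>R ((y o\<^sub>L (y - z)) + ((y - z) o\<^sub>L z))"
      by (simp add: f_def compose_diff_left compose_diff_right scaleR_diff_right scaleR_add_right)
    then have "dist (f y) (f z) = norm ((y o\<^sub>L (y - z)) + ((y - z) o\<^sub>L z)) / 2"
      by (simp add: dist_norm)
    moreover have "norm (y o\<^sub>L (y - z)) \<le> \<rho> * norm (y - z)"
      using y by (intro order_trans [OF norm_blinfun_compose] mult_right_mono) auto
    moreover have "norm ((y - z) o\<^sub>L z) \<le> \<rho> * norm (y - z)"
      using z by (subst mult.commute, intro order_trans [OF norm_blinfun_compose] mult_left_mono) auto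
    moreover note norm_triangle_ineq [of "y o\<^sub>L (y - z)" "(y - z) o\<^sub>L z"]
    ultimately show "dist (f y) (f z) \<le> \<rho> * dist y z"
      unfolding dist_norm [of y z] by linarith
  qed
  then obtain y where y: "y \<in> F" "norm y \<le> \<rho>" "f y = y" by auto
  have yb: "y \<in> bounded_ops" using Cb [OF y(1)] .
  \<comment> \<open>The fixed point is unique, so it is self-adjoint.\<close>
  have "f (adj y) = adj (f y)"
    unfolding f_def
    by (rule adj_eqI [symmetric])
      (simp add: blinfun_lin scaleR_eq_scaleC cinner_scaleC_left cinner_scaleC_right cinner_add_left cinner_add_right
        cinner_adj_left yb op_pos_cinner_commute [OF tpos])
  then have "f (adj y) = adj y" using y by simp
  moreover have "adj y \<in> F \<inter> cball 0 \<rho>" using y C(3) norm_adj_le [OF yb] by auto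
  ultimately have yadj: "adj y = y" using fY y by auto
  have "\<exists>!z. z \<in> F \<and> u + (y o\<^sub>L z) = z"
  proof (rule Banach_fix [OF _ _ \<rho>])
    show "complete F" using cstar_algebraD(3) [OF F] by (simp add: complete_eq_closed)
    show "F \<noteq> {}" using uF by auto
    show "(\<lambda>z. u + (y o\<^sub>L z)) ` F \<subseteq> F" using uF y by (auto intro!: C)
    show "dist (u + (y o\<^sub>L z)) (u + (y o\<^sub>L w)) \<le> \<rho> * dist z w" for z w
    proof -
      have "dist (u + (y o\<^sub>L z)) (u + (y o\<^sub>L w)) = norm (y o\<^sub>L (z - w))"
        by (simp add: dist_norm compose_diff_right)
      also have "\<dots> \<le> \<rho> * norm (z - w)"
        using y by (intro order_trans [OF norm_blinfun_compose] mult_right_mono) auto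
      finally show ?thesis by (simp add: dist_norm)
    qed
  qed
  then obtain z where z: "z \<in> F" "u + (y o\<^sub>L z) = z" by auto
  define v where "v = u - y"
  have vF: "v \<in> F" unfolding v_def by (intro C uF y)
  have vadj: "adj v = v" using Cb [OF uF] yb by (simp add: v_def adj_diff uadj yadj)
  have vz: "v o\<^sub>L z = u" using z(2) unit(2) [OF z(1)] by (simp add: v_def compose_diff_left) (metis add_diff_cancel_right')
  have bz: "z \<in> bounded_ops" "v \<in> bounded_ops" using Cb z vF by auto
  have zv: "adj z o\<^sub>L v = u" using arg_cong [OF vz, of adj] by (simp add: adj_compose bz vadj uadj)
  have "adj z = adj z o\<^sub>L (v o\<^sub>L z)" unfolding vz using unit(1) [OF C(3) [OF z(1)]] by simp
  also have "\<dots> = (adj z o\<^sub>L v) o\<^sub>L z" by (rule blinfun_eqI) simp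
  also have "\<dots> = z" unfolding zv by (rule unit(2) [OF z(1)])
  finally have zadj: "adj z = z" .
  have vv: "v o\<^sub>L v = (1 / M) *\<^sub>R k"
  proof -
    have "t + (y o\<^sub>L y) = 2 *\<^sub>R y" using arg_cong [OF y(3), of "\<lambda>T. 2 *\<^sub>R T"] by (simp add: f_def)
    then have "y o\<^sub>L y = 2 *\<^sub>R y - t" by (simp add: algebra_simps)
    then show ?thesis
      by (simp add: v_def compose_diff_left compose_diff_right uu unit [OF y(1)] t_def scaleR_2)
  qed
  define r where "r = sqrt M *\<^sub>R v"
  define r' where "r' = (1 / sqrt M) *\<^sub>R z"
  have adjR: "adj (c *\<^sub>R T) = c *\<^sub>R T" if "adj T = T" "T \<in> bounded_ops" for c and T :: "'h op"
  proof (rule adj_eqI)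
    have "cinner (T x) y = cinner x (T y)" for x y
      using cinner_adj_left [OF that(2), of x y] that(1) by simp
    then show "cinner ((c *\<^sub>R T) x) y = cinner x ((c *\<^sub>R T) y)" for x y
      by (simp add: blinfun.scaleR_left scaleR_eq_scaleC cinner_scaleC_left cinner_scaleC_right)
  qed
  have comp: "(c *\<^sub>R T) o\<^sub>L (c' *\<^sub>R T') = (c * c') *\<^sub>R (T o\<^sub>L T')" for c c' and T T' :: "'h op"
    by (rule blinfun_eqI) (simp add: blinfun_lin)
  have sM: "sqrt M * sqrt M = M" "sqrt M \<noteq> 0" using M by auto
  have "r \<in> F" "r' \<in> F" unfolding r_def r'_def by (intro C vF z)+
  moreover have "adj r = r" "adj r' = r'" unfolding r_def r'_def by (intro adjR vadj zadj bz)+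
  moreover have "r o\<^sub>L r = k" unfolding r_def comp sM(1) vv using M by simp
  moreover have "r o\<^sub>L r' = u" "r' o\<^sub>L r = u"
    unfolding r_def r'_def comp using sM(2) vz zv zadj by auto
  ultimately show ?thesis by blast
qed

lemma cp_compress_norm:
  fixes a :: "'h::complex_hilbert_space op"
  assumes A: "cstar_algebra A" and cp: "completely_positive A B \<phi>" "B \<subseteq> bounded_ops"
    and a: "a \<in> A" and e: "e \<in> A" "op_pos e" and \<kappa>: "norm (\<phi> (e o\<^sub>L e)) \<le> \<kappa>"
  shows "norm (\<phi> (e o\<^sub>L a o\<^sub>L e)) \<le> \<kappa> * norm a"
proof -
  have "mbound {()} (\<lambda>_ _. a) (norm a)"
    unfolding mbound_def
  proof (intro allI)
    fix x y :: "unit \<Rightarrow> 'h"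
    have "cmod (cinner (x ()) (a (y ()))) \<le> norm (x ()) * (norm a * norm (y ()))"
      by (intro order_trans [OF cmod_cinner_le_norm] mult_left_mono norm_blinfun) auto
    then show "cmod (sform {()} {()} (\<lambda>_ _. a) x y) \<le> norm a * sqrt (sqn {()} x) * sqrt (sqn {()} y)"
      by (simp add: sform_def sqn_def mult_ac)
  qed
  from cp_compress_mbound [OF A cp _ a e \<kappa> this norm_ge_zero]
  have m: "mbound {()} (\<lambda>_ _. \<phi> (e o\<^sub>L a o\<^sub>L e)) (\<kappa> * norm a)" by simp
  have c: "0 \<le> \<kappa> * norm a" using \<kappa> norm_ge_zero order_trans by (metis mult_nonneg_nonneg)
  show ?thesis
  proof (rule norm_blinfun_bound [OF c], rule norm_le_cinnerI)
    fix x y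
    have "cmod (sform {()} {()} (\<lambda>_ _. \<phi> (e o\<^sub>L a o\<^sub>L e)) (\<lambda>_. y) (\<lambda>_. x))
        \<le> \<kappa> * norm a * sqrt (sqn {()} (\<lambda>_. y)) * sqrt (sqn {()} (\<lambda>_. x))"
      using m unfolding mbound_def by blast
    then show "cmod (cinner y (\<phi> (e o\<^sub>L a o\<^sub>L e) x)) \<le> \<kappa> * norm a * norm x * norm y"
      by (simp add: sform_def sqn_def mult_ac)
  qed (use c in simp)
qed

lemma cp_conjugate:
  assumes F: "cstar_algebra F" and r: "r \<in> F" "adj r = r"
  shows "completely_positive F F (\<lambda>x. r o\<^sub>L x o\<^sub>L r)"
  unfolding completely_positive_def linear_on_alg_def
proof (intro conjI ballI allI impI)
  have rb: "r \<in> bounded_ops" using r cstar_algebraD(1) [OF F] by blast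
  have rr: "cinner x (r y) = cinner (r x) y" for x y using cinner_adj_left [OF rb, of x y] r by simp
  show "(\<lambda>x. r o\<^sub>L x o\<^sub>L r) ` F \<subseteq> F" using r by (auto intro!: cstar_algebraD(5) [OF F])
  show "r o\<^sub>L a + b o\<^sub>L r = (r o\<^sub>L a o\<^sub>L r) + (r o\<^sub>L b o\<^sub>L r)" for a b
    by (rule blinfun_eqI) (simp add: blinfun_lin)
  show "r o\<^sub>L op_scaleC c a o\<^sub>L r = op_scaleC c (r o\<^sub>L a o\<^sub>L r)" for a c
    by (rule blinfun_eqI) (simp add: bounded_opsD [OF rb])
  fix n a assume "(\<forall>i<n. \<forall>j<n. a i j \<in> F) \<and> matrix_pos n a"
  then have *: "\<And>x. (\<Sum>i<n. \<Sum>j<n. cinner (x i) (a i j (x j))) \<in> \<real>\<^sub>\<ge>\<^sub>0" by (simp add: matrix_pos_def)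
  show "matrix_pos n (\<lambda>i j. r o\<^sub>L a i j o\<^sub>L r)"
    unfolding matrix_pos_def using * [of "\<lambda>i. r (x i)" for x] by (simp add: rr)
qed

lemma cp_scale_nonneg:
  assumes cp: "completely_positive F B \<phi>" and B: "cstar_algebra B" and c: "0 \<le> c"
  shows "completely_positive F B (\<lambda>x. c *\<^sub>R \<phi> x)"
  unfolding completely_positive_def linear_on_alg_def
proof (intro conjI ballI allI impI)
  show "(\<lambda>x. c *\<^sub>R \<phi> x) ` F \<subseteq> B"
    using completely_positiveD(1) [OF cp] cstar_algebraD(8) [OF B] by auto
  show "c *\<^sub>R \<phi> (a + b) = c *\<^sub>R \<phi> a + c *\<^sub>R \<phi> b" if "a \<in> F" "b \<in> F" for a b
    using completely_positiveD(2) [OF cp that] by (simp add: scaleR_add_right)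
  show "c *\<^sub>R \<phi> (op_scaleC z a) = op_scaleC z (c *\<^sub>R \<phi> a)" if "a \<in> F" for a z
    by (rule blinfun_eqI)
      (simp add: completely_positiveD(3) [OF cp that] blinfun_lin scaleR_eq_scaleC scaleC_scaleC mult.commute)
  fix n a assume "(\<forall>i<n. \<forall>j<n. a i j \<in> F) \<and> matrix_pos n a"
  then have "matrix_pos n (\<lambda>i j. \<phi> (a i j))" using cp by (simp add: completely_positive_def)
  then show "matrix_pos n (\<lambda>i j. c *\<^sub>R \<phi> (a i j))"
    unfolding matrix_pos_def
    using c by (auto simp: blinfun_lin scaleR_eq_scaleC cinner_scaleC_right complex_nonneg_Reals_iff
        sum_distrib_left [symmetric])
qed

text \<open>
  Renormalisation by \<open>r\<^sup>2 = \<psi> (e\<^sup>2) + \<delta>\<close>.  The factors \<open>r\<close> and \<open>r' = r\<^sup>-\<^sup>1\<close> cancel in the composition, which remains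
\<open>\<phi> (\<psi> (e a e))\<close> up to the scalar \<open>c\<close>.  The map \<open>\<psi>'\<close> is contractive as \<open>r' \<psi> (e\<^sup>2) r' \<le> 1\<close>, and \<open>\<phi>'\<close> is contractive
as \<open>\<phi>' 1 = c \<phi> (\<psi> (e\<^sup>2) + \<delta>)\<close>, where \<open>\<phi> (\<psi> (e\<^sup>2))\<close> is close to \<open>e\<^sup>2\<close>.
\<close>

lemma nuclear_if_dim_nuc_le:
  fixes A :: "'h::complex_hilbert_space op set"
  assumes A: "cstar_algebra A" and dim: "dim_nuc_le A N"
  shows "nuclear A"
  unfolding nuclear_def
proof (intro allI impI)
  fix X and \<epsilon> :: real assume X: "finite X \<and> X \<subseteq> A \<and> 0 < \<epsilon>"
  then have "finite X" "X \<subseteq> A" "0 < \<epsilon> / 4" by auto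
  from cstar_approx_unit [OF A this]
  obtain e where e: "e \<in> A" "op_pos e" "norm e \<le> 1"
    and ea: "\<And>a. a \<in> X \<Longrightarrow> norm ((e o\<^sub>L a o\<^sub>L e) - a) < \<epsilon> / 4" by blast
  define M where "M = (\<Sum>a\<in>X. norm a)"
  have M: "0 \<le> M" "\<And>a. a \<in> X \<Longrightarrow> norm a \<le> M"
    using X by (auto simp: M_def intro: sum_nonneg member_le_sum)
  define \<eta> where "\<eta> = min 1 (\<epsilon> / (4 * (M + 2)))"
  have \<eta>: "0 < \<eta>" "\<eta> \<le> 1" "\<eta> * (4 * (M + 2)) \<le> \<epsilon>"
  proof -
    have "0 < 4 * (M + 2)" using M(1) by simp
    moreover have "\<eta> \<le> \<epsilon> / (4 * (M + 2))" by (simp add: \<eta>_def)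
    ultimately show "\<eta> * (4 * (M + 2)) \<le> \<epsilon>" by (simp only: pos_le_divide_eq)
  qed (use X M(1) in \<open>auto simp: \<eta>_def\<close>)
  have eA: "e o\<^sub>L e \<in> A" "a \<in> A \<Longrightarrow> e o\<^sub>L a o\<^sub>L e \<in> A" for a
    using e by (auto intro!: cstar_algebraD(5) [OF A])
  have nee: "norm (e o\<^sub>L e) \<le> 1"
    using e mult_mono [of "norm e" 1 "norm e" 1] by (intro order_trans [OF norm_blinfun_compose]) auto
  define X' where "X' = insert (e o\<^sub>L e) ((\<lambda>a. e o\<^sub>L a o\<^sub>L e) ` X)"
  have "finite X' \<and> X' \<subseteq> A \<and> 0 < \<eta>" using X \<eta> eA by (auto simp: X'_def)
  from dim [unfolded dim_nuc_le_def, rule_format, OF this]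
  obtain s \<psi> \<phi> where \<psi>: "completely_positive A (fd_algebra s) \<psi>" "contractive_on A \<psi>"
    and \<phi>: "completely_positive (fd_algebra s) A \<phi>"
    and app: "\<And>a. a \<in> X' \<Longrightarrow> norm (\<phi> (\<psi> a) - a) < \<eta>"
    by blast
  define F where "F = fd_algebra s"
  have F: "cstar_algebra F" unfolding F_def by (rule cstar_fd_tensor [OF cstar_bounded_ops])
  note Fb = cstar_algebraD(1) [OF F] and FC = cstar_algebraD(4,5,6,8,10) [OF F]
  have \<psi>: "completely_positive A F \<psi>" "contractive_on A \<psi>" and \<phi>: "completely_positive F A \<phi>"
    using \<psi> \<phi> by (simp_all add: F_def)
  have Fsub: "F \<subseteq> bounded_ops" and Asub: "A \<subseteq> bounded_ops" using Fb cstar_algebraD(1) [OF A] by auto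
  obtain u where u: "alg_unit F u"
    using block_unit [OF block_rel_same_block [of s]] by (auto simp: F_def fd_tensor_block alg_unit_def)
  have uF: "u \<in> F" and unit: "\<And>a. a \<in> F \<Longrightarrow> a o\<^sub>L u = a" "\<And>a. a \<in> F \<Longrightarrow> u o\<^sub>L a = a"
    using u by (auto simp: alg_unit_def)
  have upos: "op_pos u" by (rule alg_unit_pos [OF F u])
  \<comment> \<open>The norm of \<open>\<phi>\<close> on the unit is not controlled by \<open>\<eta>\<close>, hence \<open>\<delta>\<close> is chosen last.\<close>
  define \<delta> where "\<delta> = \<eta> / (norm (\<phi> u) + 1)"
  have \<delta>: "0 < \<delta>" "\<delta> * norm (\<phi> u) \<le> \<eta>"
  proof -
    have p: "0 < norm (\<phi> u) + 1" by (simp add: add_nonneg_pos)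
    show \<delta>: "0 < \<delta>" unfolding \<delta>_def using \<eta>(1) p by (rule divide_pos_pos)
    have "\<delta> * norm (\<phi> u) \<le> \<delta> * (norm (\<phi> u) + 1)" using \<delta> by (intro mult_left_mono) auto
    also have "\<dots> = \<eta>" using p by (simp add: \<delta>_def)
    finally show "\<delta> * norm (\<phi> u) \<le> \<eta>" .
  qed
  define w where "w = \<psi> (e o\<^sub>L e)"
  have wF: "w \<in> F" unfolding w_def by (rule completely_positiveD(1) [OF \<psi>(1) eA(1)])
  have "op_pos (e o\<^sub>L e)"
    using op_pos_adj_compose [OF op_pos_bounded [OF e(2)]] by (simp add: op_pos_adj e)
  then have wpos: "op_pos w" unfolding w_def by (rule cp_op_pos [OF \<psi>(1) Fsub eA(1)])
  define k where "k = w + \<delta> *\<^sub>R u"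
  have kF: "k \<in> F" unfolding k_def by (intro FC wF uF)
  have kq: "cinner x (k x) = cinner x (w x) + complex_of_real \<delta> * cinner x (u x)" for x
    by (simp add: k_def blinfun_lin cinner_add_right scaleR_eq_scaleC cinner_scaleC_right)
  have kpos: "op_pos k" using wpos upos \<delta> by (auto simp: op_pos_iff kq Fb [OF kF])
  have "\<delta> * Re (cinner x (u x)) \<le> Re (cinner x (k x))" for x
    using wpos by (simp add: kq op_pos_iff)
  from positive_sqrt_inverse [OF F u kF kpos \<delta>(1) this]
  obtain r r' where r: "r \<in> F" "r' \<in> F" "adj r = r" "adj r' = r'"
    and rr: "r o\<^sub>L r = k" "r o\<^sub>L r' = u" "r' o\<^sub>L r = u" by blast
  \<comment> \<open>The denominator bounds the norm of \<open>\<phi> k\<close>: 1 from \<open>e\<^sup>2\<close>, and \<open>\<eta>\<close> each from the approximation and from \<open>\<delta>\<close>.\<close>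
  define c where "c = 1 / (1 + 2 * \<eta>)"
  have c: "0 \<le> c" "c * (1 + 2 * \<eta>) = 1" "c \<le> 1" "1 - c \<le> 2 * \<eta>"
    using \<eta> by (auto simp: c_def field_simps)
  define \<psi>' where "\<psi>' a = r' o\<^sub>L \<psi> (e o\<^sub>L a o\<^sub>L e) o\<^sub>L r'" for a
  define \<phi>' where "\<phi>' x = c *\<^sub>R \<phi> (r o\<^sub>L x o\<^sub>L r)" for x
  have cpr': "completely_positive A F (\<lambda>a. r' o\<^sub>L \<psi> a o\<^sub>L r')"
    by (rule cp_compose [OF \<psi>(1) cp_conjugate [OF F r(2,4)]])
  have 1: "completely_positive A F \<psi>'"
    unfolding \<psi>'_def by (rule cp_compose [OF cp_conjugate [OF A e(1) op_pos_adj [OF e(2)]] cpr'])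
  have 2: "completely_positive F A \<phi>'"
    unfolding \<phi>'_def by (rule cp_scale_nonneg [OF cp_compose [OF cp_conjugate [OF F r(1,3)] \<phi>] A c(1)])
  have 3: "contractive_on A \<psi>'"
    unfolding contractive_on_def
  proof
    fix a assume a: "a \<in> A"
    have r'b: "r' \<in> bounded_ops" using Fb r by blast
    have r'c: "cinner x (r' y) = cinner (r' x) y" for x y
      using cinner_adj_left [OF r'b, of x y] r by simp
    have "norm (r' o\<^sub>L w o\<^sub>L r') \<le> 1"
    proof (rule op_pos_norm_le)
      have q: "cinner x ((r' o\<^sub>L w o\<^sub>L r') x) = cinner (r' x) (w (r' x))" for x by (simp add: r'c)
      show "op_pos (r' o\<^sub>L w o\<^sub>L r')"
        using wpos unfolding op_pos_iff q by (auto intro!: bounded_ops_compose r'b Fb [OF wF])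
      fix x
      have "r' (k (r' x)) = u x"
      proof -
        have "r' o\<^sub>L k o\<^sub>L r' = (r' o\<^sub>L r) o\<^sub>L (r o\<^sub>L r')"
          unfolding rr(1) [symmetric] by (rule blinfun_eqI) simp
        also have "\<dots> = u" unfolding rr by (rule unit(1) [OF uF])
        finally show ?thesis using arg_cong [of _ _ "\<lambda>T. T x"] by force
      qed
      then have "Re (cinner (r' x) (k (r' x))) = Re (cinner x (u x))" by (simp add: r'c [symmetric])
      moreover have "Re (cinner (r' x) (w (r' x))) \<le> Re (cinner (r' x) (k (r' x)))"
        using upos \<delta> by (simp add: kq op_pos_iff)
      moreover have "Re (cinner x (u x)) \<le> 1 * (norm x)\<^sup>2"
        using alg_unit_projection [OF F u, of x] by (simp add: power_mono)
      ultimately show "Re (cinner x ((r' o\<^sub>L w o\<^sub>L r') x)) \<le> 1 * (norm x)\<^sup>2" unfolding q by linarith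
    qed simp
    then have "norm (r' o\<^sub>L \<psi> (e o\<^sub>L e) o\<^sub>L r') \<le> 1" by (simp add: w_def)
    from cp_compress_norm [OF A cpr' Fsub a e(1,2) this]
    show "norm (\<psi>' a) \<le> norm a" by (simp add: \<psi>'_def)
  qed
  have 4: "contractive_on F \<phi>'"
    unfolding contractive_on_def
  proof
    fix x assume x: "x \<in> F"
    have "norm (\<phi> k) \<le> norm (\<phi> w) + \<delta> * norm (\<phi> u)"
      using norm_triangle_ineq [of "\<phi> w" "\<delta> *\<^sub>R \<phi> u"] \<delta>(1)
      by (simp add: k_def completely_positiveD(2) [OF \<phi> wF FC(4) [OF uF]] cp_scaleR [OF \<phi> uF])
    moreover have "norm (\<phi> w - (e o\<^sub>L e)) < \<eta>" using app by (simp add: X'_def w_def)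
    ultimately have "norm (\<phi> k) \<le> 1 + 2 * \<eta>"
      using nee \<delta>(2) norm_triangle_ineq [of "\<phi> w - (e o\<^sub>L e)" "e o\<^sub>L e"] by simp
    then have "c * norm (\<phi> k) \<le> 1" using mult_left_mono [OF _ c(1)] c(2) by metis
    moreover have "\<phi>' (u o\<^sub>L u) = c *\<^sub>R \<phi> k"
      unfolding \<phi>'_def unit(1) [OF uF] unit(1) [OF r(1)] rr(1) ..
    ultimately have "norm (\<phi>' (u o\<^sub>L u)) \<le> 1" using c(1) by simp
    from cp_compress_norm [OF F 2 Asub x uF upos this]
    show "norm (\<phi>' x) \<le> norm x" by (simp add: unit x)
  qed
  have 5: "norm (\<phi>' (\<psi>' a) - a) < \<epsilon>" if a: "a \<in> X" for a
  proof -
    define b where "b = e o\<^sub>L a o\<^sub>L e"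
    have aA: "a \<in> A" using a X by blast
    have bA: "b \<in> A" unfolding b_def by (rule eA(2) [OF aA])
    have \<psi>b: "\<psi> b \<in> F" by (rule completely_positiveD(1) [OF \<psi>(1) bA])
    have "r o\<^sub>L (r' o\<^sub>L \<psi> b o\<^sub>L r') o\<^sub>L r = (r o\<^sub>L r') o\<^sub>L \<psi> b o\<^sub>L (r' o\<^sub>L r)"
      by (rule blinfun_eqI) simp
    also have "\<dots> = \<psi> b" unfolding rr by (simp add: unit \<psi>b)
    finally have eq: "\<phi>' (\<psi>' a) = c *\<^sub>R \<phi> (\<psi> b)" by (simp add: \<phi>'_def \<psi>'_def b_def)
    have "norm b \<le> norm a"
    proof -
      have "norm b \<le> norm (e o\<^sub>L a) * norm e" unfolding b_def by (rule norm_blinfun_compose)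
      also have "\<dots> \<le> norm (e o\<^sub>L a) * 1" using e by (intro mult_left_mono) auto
      also have "\<dots> \<le> norm e * norm a" by (simp add: norm_blinfun_compose)
      also have "\<dots> \<le> 1 * norm a" using e by (intro mult_right_mono) auto
      finally show ?thesis by simp
    qed
    then have bM: "norm b \<le> M" using M(2) [OF a] by linarith
    have ap: "norm (\<phi> (\<psi> b) - b) < \<eta>" using app a by (simp add: X'_def b_def)
    have nb: "norm (\<phi> (\<psi> b)) \<le> M + 1"
      using norm_triangle_ineq [of "\<phi> (\<psi> b) - b" b] ap bM \<eta>(2) by simp
    have "norm (c *\<^sub>R \<phi> (\<psi> b) - \<phi> (\<psi> b)) = (1 - c) * norm (\<phi> (\<psi> b))"
    proof -
      have "c *\<^sub>R \<phi> (\<psi> b) - \<phi> (\<psi> b) = (c - 1) *\<^sub>R \<phi> (\<psi> b)" by (simp add: scaleR_diff_left)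
      then show ?thesis using c(3) by simp
    qed
    also have "\<dots> \<le> 2 * \<eta> * (M + 1)" using c nb \<eta> by (intro mult_mono) auto
    finally have n1: "norm (c *\<^sub>R \<phi> (\<psi> b) - \<phi> (\<psi> b)) \<le> 2 * \<eta> * (M + 1)" .
    have n2: "norm (b - a) < \<epsilon> / 4" unfolding b_def by (rule ea [OF a])
    have "norm (\<phi>' (\<psi>' a) - a) \<le> norm (c *\<^sub>R \<phi> (\<psi> b) - \<phi> (\<psi> b)) + (norm (\<phi> (\<psi> b) - b) + norm (b - a))"
      unfolding eq
      using norm_triangle_ineq [of "c *\<^sub>R \<phi> (\<psi> b) - \<phi> (\<psi> b)" "(\<phi> (\<psi> b) - b) + (b - a)"]
        norm_triangle_ineq [of "\<phi> (\<psi> b) - b" "b - a"] by simp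
    also have "\<dots> < 2 * \<eta> * (M + 1) + (\<eta> + \<epsilon> / 4)" using n1 n2 ap by linarith
    also have "\<dots> \<le> \<epsilon>"
    proof -
      have "\<eta> * M \<ge> 0" using \<eta> M by simp
      then show ?thesis using \<eta> X by (simp add: algebra_simps)
    qed
    finally show ?thesis .
  qed
  show "\<exists>s \<psi> \<phi>. completely_positive A (fd_algebra s) \<psi> \<and> contractive_on A \<psi> \<and>
          completely_positive (fd_algebra s) A \<phi> \<and> contractive_on (fd_algebra s) \<phi> \<and>
          (\<forall>a\<in>X. norm (\<phi> (\<psi> a) - a) < \<epsilon>)"
    using 1 2 3 4 5 unfolding F_def by blast
qed

section \<open>The estimate for the least dimensions\<close>

lemma Inf_enat_attained:
  assumes "Inf {enat d |d. P d} < \<infinity>"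
  shows "\<exists>d. P d \<and> Inf {enat d |d. P d} = enat d"
proof -
  have "{enat d |d. P d} \<noteq> {}"
  proof
    assume "{enat d |d. P d} = {}"
    then show False using assms by (simp only: Inf_enat_def) simp
  qed
  then have "Inf {enat d |d. P d} \<in> {enat d |d. P d}" by (meson wellorder_InfI ex_in_conv)
  then show ?thesis by blast
qed

theorem theorem2p11:
  fixes D A :: "'h::complex_hilbert_space op set"
    and B :: "'k::complex_hilbert_space op set"
  assumes "cstar_algebra A" and "nondegenerate_subalgebra D A"
    and "cstar_algebra B" and "dim_nuc B < \<infinity>"
    and "dim_diag D A B < \<infinity>"
  shows "nuclear A \<and> dim_nuc A < \<infinity> \<and>
    dim_nuc A + 1 \<le> (dim_nuc B + 1) * (dim_diag D A B + 1)"
proof -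
  obtain n where n: "dim_nuc_le B n" "dim_nuc B = enat n"
    using Inf_enat_attained [OF assms(4) [unfolded dim_nuc_def]] unfolding dim_nuc_def by blast
  obtain d where d: "dim_diag_le D A B d" "dim_diag D A B = enat d"
    using Inf_enat_attained [OF assms(5) [unfolded dim_diag_def]] unfolding dim_diag_def by blast
  define N where "N = Suc n * Suc d - 1"
  have N: "Suc N = Suc n * Suc d" by (simp add: N_def)
  have dim: "dim_nuc_le A N" by (rule dim_nuc_le_tensor [OF assms(1,3) n(1) d(1) N])
  then have le: "dim_nuc A \<le> enat N" unfolding dim_nuc_def by (auto intro: Inf_lower)
  have "enat N + 1 = (enat n + 1) * (enat d + 1)"
    using N by (simp add: one_enat_def)
  then have "dim_nuc A + 1 \<le> (dim_nuc B + 1) * (dim_diag D A B + 1)"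
    unfolding n(2) d(2) using add_right_mono [OF le, of 1] by simp
  moreover have "dim_nuc A < \<infinity>" by (rule order_le_less_trans [OF le]) simp
  moreover have "nuclear A" by (rule nuclear_if_dim_nuc_le [OF assms(1) dim])
  ultimately show ?thesis by blast
qed

end
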